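(* Let $m>0$. There exist asymptotically flat spacelike hypersurfaces in the Schwarzschild spacetime of mass $m$ whose ADM energy-momentum vector is $(E,P)=(m,0,0,0)$ and whose ADM angular momentum is finite and greater than $m$ (i.e. the angular momentum vector, with components $J(\frac{\partial}{\partial x^i}\times\vec x)$, $i=1,2,3$, is finite and has Euclidean norm $|J|>m$).
   Context: The Schwarzschild spacetime of mass $m$ outside the event horizon has metric $ds^2=-(1-\frac{2m}{r})dt^2+(1-\frac{2m}{r})^{-1}dr^2+r^2\tilde\sigma_{ab}du^adu^b$, $r>2m$, where $\{u^a\}_{a=1,2}$ are coordinates on the unit sphere $S^2$ and $\tilde\sigma$ is the round unit metric. The exterior of a spacelike hypersurface is a graph $t=f(r,u^a)$, and the coordinates $x^i=r\tilde x^i$ ($\tilde x^i$ the standard coordinate functions on $S^2\subset\mathbb R^3$) restricted to the graph are used as the asymptotically flat coordinate system. The hypersurface carries the induced metric $g$, second fundamental form $k$, and $\pi=k-(\mathrm{tr}_gk)g$. With the future unit normal $\nu$, the convention is $k(X,Y)=-ds^2(\nu,\nabla_XY)$. Asymptotically flat means: for some $q>\frac12$, $p>\frac32$, $\epsilon>0$, outside a compact set each end is diffeomorphic to the complement of a compact set in $\mathbb R^3$ with $g_{ij}-\delta_{ij}=O_2(r^{-q})$, $k_{ij}=O_1(r^{-p})$, and $\mu,|J|=O(r^{-3-\epsilon})$, where $\mu=\frac12(R_g-|k|_g^2+(\mathrm{tr}_gk)^2)$, $J=\mathrm{div}_g k-d(\mathrm{tr}_gk)$. $O_l(r^a)$ means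 that derivatives of order $s\le l$ are $O(r^{a-s})$. ADM quantities (limits as $r\to\infty$ of integrals over $|x|=r$ with Euclidean area measure $d\sigma_0$): $E=\frac1{16\pi}\lim\int\sum_{j,k}(\partial_kg_{jk}-\partial_jg_{kk})\frac{x^j}{|x|}d\sigma_0$, $P_i=\frac1{8\pi}\lim\int\sum_k\pi_{ik}\frac{x^k}{|x|}d\sigma_0$, $J(Y)=\frac1{8\pi}\lim\int\sum_{j,k}\pi_{jk}Y^j\frac{x^k}{|x|}d\sigma_0$ for $Y=\frac{\partial}{\partial x^i}\times\vec x$. *)

theory Defs
  imports "HOL-Analysis.Analysis" "HOL-Library.Landau_Symbols"
begin

section \<open>Partial derivatives, smoothness and decay\<close>

definition pd :: "'n::finite \<Rightarrow> (real ^ 'n \<Rightarrow> real) \<Rightarrow> real ^ 'n \<Rightarrow> real" where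
  "pd i h x = deriv (\<lambda>s. h (x + s *\<^sub>R axis i 1)) 0"

definition iterated_pd :: "'n::finite list \<Rightarrow> (real ^ 'n \<Rightarrow> real) \<Rightarrow> real ^ 'n \<Rightarrow> real" where
  "iterated_pd is h = foldr pd is h"

text \<open>On an open set this is the class of infinitely differentiable functions: each iterated partial
  derivative is Frechet differentiable, hence continuous.\<close>

definition smooth_on :: "(real ^ 'n::finite) set \<Rightarrow> (real ^ 'n \<Rightarrow> real) \<Rightarrow> bool" where
  "smooth_on U h \<longleftrightarrow> open U \<and> (\<forall>is. iterated_pd is h differentiable_on U)"

text \<open>\<open>O_deriv l a h\<close> is the relation usually written \<open>h = O_l(r^a)\<close>.\<close>

definition O_deriv :: "nat \<Rightarrow> real \<Rightarrow> (real ^ 'n::finite \<Rightarrow> real) \<Rightarrow> bool" where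
  "O_deriv l a h \<longleftrightarrow>
     (\<forall>is. length is \<le> l \<longrightarrow>
        iterated_pd is h \<in> O[at_infinity](\<lambda>x. norm x powr (a - real (length is))))"


section \<open>Pseudo-Riemannian metrics in a global coordinate chart\<close>

definition metric_apply :: "real ^ 'n ^ 'n::finite \<Rightarrow> real ^ 'n \<Rightarrow> real ^ 'n \<Rightarrow> real" where
  "metric_apply G v w = (\<Sum>a\<in>UNIV. \<Sum>b\<in>UNIV. G $ a $ b * v $ a * w $ b)"

text \<open>\<open>christoffel g k i j\<close> is the symbol with upper index \<open>k\<close> and lower indices \<open>i\<close>, \<open>j\<close>.\<close>

definition christoffel ::
  "(real ^ 'n \<Rightarrow> real ^ 'n ^ 'n) \<Rightarrow> 'n::finite \<Rightarrow> 'n \<Rightarrow> 'n \<Rightarrow> real ^ 'n \<Rightarrow> real" where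
  "christoffel g k i j x =
     (1/2) * (\<Sum>l\<in>UNIV. matrix_inv (g x) $ k $ l *
        (pd i (\<lambda>y. g y $ j $ l) x + pd j (\<lambda>y. g y $ i $ l) x - pd l (\<lambda>y. g y $ i $ j) x))"

definition ricci :: "(real ^ 'n \<Rightarrow> real ^ 'n ^ 'n) \<Rightarrow> 'n::finite \<Rightarrow> 'n \<Rightarrow> real ^ 'n \<Rightarrow> real" where
  "ricci g i j x =
     (\<Sum>k\<in>UNIV. pd k (christoffel g k i j) x - pd j (christoffel g k i k) x
        + (\<Sum>l\<in>UNIV. christoffel g k k l x * christoffel g l i j x
                      - christoffel g k j l x * christoffel g l i k x))"

definition scalar_curvature :: "(real ^ 'n \<Rightarrow> real ^ 'n ^ 'n::finite) \<Rightarrow> real ^ 'n \<Rightarrow> real" where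
  "scalar_curvature g x = (\<Sum>i\<in>UNIV. \<Sum>j\<in>UNIV. matrix_inv (g x) $ i $ j * ricci g i j x)"

definition trace_of ::
  "(real ^ 'n \<Rightarrow> real ^ 'n ^ 'n) \<Rightarrow> (real ^ 'n \<Rightarrow> real ^ 'n ^ 'n::finite) \<Rightarrow> real ^ 'n \<Rightarrow> real" where
  "trace_of g k x = (\<Sum>i\<in>UNIV. \<Sum>j\<in>UNIV. matrix_inv (g x) $ i $ j * k x $ i $ j)"

definition norm_sq_of ::
  "(real ^ 'n \<Rightarrow> real ^ 'n ^ 'n) \<Rightarrow> (real ^ 'n \<Rightarrow> real ^ 'n ^ 'n::finite) \<Rightarrow> real ^ 'n \<Rightarrow> real" where
  "norm_sq_of g k x =
     (\<Sum>i\<in>UNIV. \<Sum>j\<in>UNIV. \<Sum>a\<in>UNIV. \<Sum>b\<in>UNIV.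
        matrix_inv (g x) $ i $ a * matrix_inv (g x) $ j $ b * k x $ i $ j * k x $ a $ b)"

definition divergence_of ::
  "(real ^ 'n \<Rightarrow> real ^ 'n ^ 'n) \<Rightarrow> (real ^ 'n \<Rightarrow> real ^ 'n ^ 'n) \<Rightarrow> 'n::finite \<Rightarrow> real ^ 'n \<Rightarrow> real" where
  "divergence_of g k j x =
     (\<Sum>i\<in>UNIV. \<Sum>l\<in>UNIV. matrix_inv (g x) $ i $ l *
        (pd i (\<lambda>y. k y $ l $ j) x
         - (\<Sum>a\<in>UNIV. christoffel g a i l x * k x $ a $ j + christoffel g a i j x * k x $ l $ a)))"


section \<open>Asymptotically flat initial data and ADM quantities\<close>

definition energy_density ::
  "(real ^ 3 \<Rightarrow> real ^ 3 ^ 3) \<Rightarrow> (real ^ 3 \<Rightarrow> real ^ 3 ^ 3) \<Rightarrow> real ^ 3 \<Rightarrow> real" where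
  "energy_density g k x = (1/2) * (scalar_curvature g x - norm_sq_of g k x + (trace_of g k x)\<^sup>2)"

definition current_density ::
  "(real ^ 3 \<Rightarrow> real ^ 3 ^ 3) \<Rightarrow> (real ^ 3 \<Rightarrow> real ^ 3 ^ 3) \<Rightarrow> real ^ 3 \<Rightarrow> real ^ 3" where
  "current_density g k x = (\<chi> j. divergence_of g k j x - pd j (trace_of g k) x)"

definition current_norm ::
  "(real ^ 3 \<Rightarrow> real ^ 3 ^ 3) \<Rightarrow> (real ^ 3 \<Rightarrow> real ^ 3 ^ 3) \<Rightarrow> real ^ 3 \<Rightarrow> real" where
  "current_norm g k x =
     sqrt (metric_apply (matrix_inv (g x)) (current_density g k x) (current_density g k x))"

definition asymptotically_flat ::
  "(real ^ 3 \<Rightarrow> real ^ 3 ^ 3) \<Rightarrow> (real ^ 3 \<Rightarrow> real ^ 3 ^ 3) \<Rightarrow> bool" where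
  "asymptotically_flat g k \<longleftrightarrow>
     (\<exists>q p \<epsilon>. q > 1/2 \<and> p > 3/2 \<and> \<epsilon> > 0 \<and>
        (\<forall>i j. O_deriv 2 (- q) (\<lambda>x. g x $ i $ j - mat 1 $ i $ j)) \<and>
        (\<forall>i j. O_deriv 1 (- p) (\<lambda>x. k x $ i $ j)) \<and>
        energy_density g k \<in> O[at_infinity](\<lambda>x. norm x powr (- 3 - \<epsilon>)) \<and>
        current_norm g k \<in> O[at_infinity](\<lambda>x. norm x powr (- 3 - \<epsilon>)))"

definition conjugate_momentum ::
  "(real ^ 3 \<Rightarrow> real ^ 3 ^ 3) \<Rightarrow> (real ^ 3 \<Rightarrow> real ^ 3 ^ 3) \<Rightarrow> real ^ 3 \<Rightarrow> real ^ 3 ^ 3" where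
  "conjugate_momentum g k x = k x - trace_of g k x *\<^sub>R g x"

definition sphere_point :: "real \<Rightarrow> real \<Rightarrow> real \<Rightarrow> real ^ 3" where
  "sphere_point r \<theta> \<phi> = vector [r * sin \<theta> * cos \<phi>, r * sin \<theta> * sin \<phi>, r * cos \<theta>]"

text \<open>The integral over the sphere of radius \<open>r\<close> with respect to the Euclidean area measure, whose
  density in spherical coordinates is \<open>r\<^sup>2 sin \<theta>\<close>.\<close>

definition sphere_integral :: "real \<Rightarrow> (real ^ 3 \<Rightarrow> real) \<Rightarrow> real" where
  "sphere_integral r h =
     integral (cbox (0, 0) (pi, 2 * pi))
       (\<lambda>(\<theta>, \<phi>). h (sphere_point r \<theta> \<phi>) * (r\<^sup>2 * sin \<theta>))"

definition has_ADM_energy :: "(real ^ 3 \<Rightarrow> real ^ 3 ^ 3) \<Rightarrow> real \<Rightarrow> bool" where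
  "has_ADM_energy g E \<longleftrightarrow>
     ((\<lambda>r. 1 / (16 * pi) * sphere_integral r
        (\<lambda>x. \<Sum>j\<in>UNIV. \<Sum>k\<in>UNIV.
           (pd k (\<lambda>y. g y $ j $ k) x - pd j (\<lambda>y. g y $ k $ k) x) * (x $ j / norm x)))
      \<longlongrightarrow> E) at_top"

definition has_ADM_momentum ::
  "(real ^ 3 \<Rightarrow> real ^ 3 ^ 3) \<Rightarrow> (real ^ 3 \<Rightarrow> real ^ 3 ^ 3) \<Rightarrow> real ^ 3 \<Rightarrow> bool" where
  "has_ADM_momentum g k P \<longleftrightarrow>
     (\<forall>i. ((\<lambda>r. 1 / (8 * pi) * sphere_integral r
        (\<lambda>x. \<Sum>l\<in>UNIV. conjugate_momentum g k x $ i $ l * (x $ l / norm x)))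
      \<longlongrightarrow> P $ i) at_top)"

text \<open>The rotation field about the \<open>i\<close>-th axis is \<open>x \<mapsto> e\<^sub>i \<times> x\<close>.\<close>

definition has_ADM_angular_momentum ::
  "(real ^ 3 \<Rightarrow> real ^ 3 ^ 3) \<Rightarrow> (real ^ 3 \<Rightarrow> real ^ 3 ^ 3) \<Rightarrow> real ^ 3 \<Rightarrow> bool" where
  "has_ADM_angular_momentum g k J \<longleftrightarrow>
     (\<forall>i. ((\<lambda>r. 1 / (8 * pi) * sphere_integral r
        (\<lambda>x. \<Sum>j\<in>UNIV. \<Sum>l\<in>UNIV.
           conjugate_momentum g k x $ j $ l * cross3 (axis i 1) x $ j * (x $ l / norm x)))
      \<longlongrightarrow> J $ i) at_top)"


section \<open>The Schwarzschild exterior and its spacelike hypersurfaces\<close>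

text \<open>Points of \<open>real ^ 4\<close> are \<open>(t, x\<^sup>1, x\<^sup>2, x\<^sup>3)\<close>, where \<open>x = r u\<close> with \<open>u\<close> in the unit sphere.\<close>

definition spatial :: "real ^ 4 \<Rightarrow> real ^ 3" where
  "spatial p = vector [p $ 2, p $ 3, p $ 4]"

definition exterior :: "real \<Rightarrow> (real ^ 4) set" where
  "exterior m = {p. norm (spatial p) > 2 * m}"

text \<open>In these coordinates \<open>dr(v) = u \<bullet> v\<close> and \<open>r du(v) = v - (u \<bullet> v) u\<close>; since the round metric is
  the restriction of the Euclidean one to the sphere, \<open>r\<^sup>2\<close> times the round metric is the inner product
  of the vectors \<open>r du\<close>.\<close>

definition schwarzschild_form :: "real \<Rightarrow> real ^ 4 \<Rightarrow> real ^ 4 \<Rightarrow> real ^ 4 \<Rightarrow> real" where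
  "schwarzschild_form m p v w =
     (let r = norm (spatial p);
          u = spatial p /\<^sub>R r;
          dr = (\<lambda>v. u \<bullet> spatial v);
          r_du = (\<lambda>v. spatial v - (u \<bullet> spatial v) *\<^sub>R u)
      in - (1 - 2 * m / r) * (v $ 1 * w $ 1) + inverse (1 - 2 * m / r) * (dr v * dr w)
         + r_du v \<bullet> r_du w)"

definition schwarzschild :: "real \<Rightarrow> real ^ 4 \<Rightarrow> real ^ 4 ^ 4" where
  "schwarzschild m p = (\<chi> a b. schwarzschild_form m p (axis a 1) (axis b 1))"

text \<open>An embedded hypersurface, locally the regular zero set of a smooth function, on whose tangent
  spaces (the kernels of the differential) the spacetime metric is positive definite.\<close>

definition spacelike_hypersurface :: "real \<Rightarrow> (real ^ 4) set \<Rightarrow> bool" where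
  "spacelike_hypersurface m S \<longleftrightarrow>
     S \<subseteq> exterior m \<and>
     (\<forall>p\<in>S. \<exists>U F. p \<in> U \<and> smooth_on U F \<and> S \<inter> U = {q \<in> U. F q = 0} \<and>
        (\<forall>q\<in>U. \<exists>a. pd a F q \<noteq> 0) \<and>
        (\<forall>q\<in>S \<inter> U. \<forall>v. v \<noteq> 0 \<longrightarrow> (\<Sum>a\<in>UNIV. pd a F q * v $ a) = 0 \<longrightarrow>
           metric_apply (schwarzschild m q) v v > 0))"

definition graph_point :: "(real ^ 3 \<Rightarrow> real) \<Rightarrow> real ^ 3 \<Rightarrow> real ^ 4" where
  "graph_point f x = vector [f x, x $ 1, x $ 2, x $ 3]"

text \<open>Outside radius \<open>R\<close> the hypersurface is the graph of \<open>f\<close>. The remaining part is bounded and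
  relatively closed in the exterior region, so its closure is compact and adds only points with
  \<open>r = 2 m\<close>; in particular the hypersurface is not truncated at some radius beyond the horizon.\<close>

definition graph_end :: "real \<Rightarrow> (real ^ 4) set \<Rightarrow> real \<Rightarrow> (real ^ 3 \<Rightarrow> real) \<Rightarrow> bool" where
  "graph_end m S R f \<longleftrightarrow>
     R > 2 * m \<and> smooth_on {x. norm x > R} f \<and>
     S \<inter> {p. norm (spatial p) > R} = graph_point f ` {x. norm x > R} \<and>
     closedin (top_of_set (exterior m)) S \<and>
     bounded (S \<inter> {p. norm (spatial p) \<le> R})"

definition tangent :: "(real ^ 3 \<Rightarrow> real) \<Rightarrow> 3 \<Rightarrow> real ^ 3 \<Rightarrow> real ^ 4" where
  "tangent f i x = (\<chi> a. pd i (\<lambda>y. graph_point f y $ a) x)"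

definition induced_metric :: "real \<Rightarrow> (real ^ 3 \<Rightarrow> real) \<Rightarrow> real ^ 3 \<Rightarrow> real ^ 3 ^ 3" where
  "induced_metric m f x =
     (\<chi> i j. metric_apply (schwarzschild m (graph_point f x)) (tangent f i x) (tangent f j x))"

definition future_unit_normal :: "real \<Rightarrow> (real ^ 3 \<Rightarrow> real) \<Rightarrow> real ^ 3 \<Rightarrow> real ^ 4" where
  "future_unit_normal m f x =
     (THE \<nu>. let G = schwarzschild m (graph_point f x) in
        metric_apply G \<nu> \<nu> = - 1 \<and> (\<forall>i. metric_apply G \<nu> (tangent f i x) = 0) \<and>
        metric_apply G \<nu> (axis 1 1) < 0)"

text \<open>The ambient covariant derivative of the \<open>j\<close>-th coordinate tangent field of the graph along
  the \<open>i\<close>-th one.\<close>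

definition ambient_derivative ::
  "real \<Rightarrow> (real ^ 3 \<Rightarrow> real) \<Rightarrow> 3 \<Rightarrow> 3 \<Rightarrow> real ^ 3 \<Rightarrow> real ^ 4" where
  "ambient_derivative m f i j x =
     (\<chi> c. pd i (\<lambda>y. tangent f j y $ c) x
        + (\<Sum>a\<in>UNIV. \<Sum>b\<in>UNIV. christoffel (schwarzschild m) c a b (graph_point f x)
             * tangent f i x $ a * tangent f j x $ b))"

definition second_fundamental_form :: "real \<Rightarrow> (real ^ 3 \<Rightarrow> real) \<Rightarrow> real ^ 3 \<Rightarrow> real ^ 3 ^ 3" where
  "second_fundamental_form m f x =
     (\<chi> i j. - metric_apply (schwarzschild m (graph_point f x))
               (future_unit_normal m f x) (ambient_derivative m f i j x))"

end

theory Submission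
  imports Defs
begin

text \<open>With \<open>A = y + x y\<close> restricted to the unit sphere, the hypersurface is the graph of a function asymptotic
  to \<open>f = c r\<^bsup>1/3\<^esup> A\<close>; replacing \<open>r\<^sup>2\<close> by \<open>r\<^sup>2 + L\<^sup>2\<close> with \<open>L\<close> large makes its gradient small enough for the
  graph to be spacelike up to the horizon. Then \<open>g - \<delta>\<close> is \<open>O(r\<^bsup>-1\<^esup>)\<close>, where only the Schwarzschild mass
  term is relevant to the energy, and \<open>k\<close> is the Hessian of \<open>f\<close> up to \<open>O(r\<^bsup>-8/3\<^esup>)\<close>. Thus \<open>\<mu>\<close> and \<open>|J|\<close>
  decay fast enough as soon as their linear leading terms cancel, without recourse to the Gauss and
  Codazzi equations, and the linear momentum is that of a linear perturbation, hence zero.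

  In the angular momentum the terms linear in \<open>f\<close> would diverge like \<open>r\<^bsup>4/3\<^esup>\<close>, but they are rotational
  derivatives and integrate to zero over every sphere. The terms cubic in \<open>f\<close> have exactly the order
  that contributes to the limit. For the rotation field \<open>Y\<close> their integral is \<open>- 1/2\<close> times the integral of
  \<open>Y(A) |\<nabla>A|\<^sup>2\<close> over the unit sphere, which is not zero for the rotation about the third axis, so that the
  angular momentum grows like \<open>c\<^sup>3\<close>.\<close>

section \<open>Partial derivatives\<close>

text \<open>The exponent 1/3 is forced by this mechanism. For f of growth r^a the cubic part of the
  angular momentum integrand multiplies D^2 f, two factors Df and a rotation field, hence has order
  r^(3a - 3); against the area r^2 it has a finite nonzero limit only for a = 1/3. The price is that
  the linear terms diverge, so their sphere integrals have to vanish exactly at every radius and not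
  just asymptotically. All replacements in the integrands are therefore carried to an error
  O(r^(-8/3)), and what remains is built from exactly homogeneous functions, for which one integral
  over the unit sphere settles all radii.

  The angular factor needs two harmonics. A reflection in a plane through the third axis that
  preserves A reverses the sign of the integral of Y(A) |grad A|^2, so this integral is zero for y
  alone (plane x = 0) and for xy alone (plane x = y). The sum y + xy has no such mirror plane.

  Passing to r^2 + L^2 changes the derivatives of f only by a relative O(r^(-2)), which is invisible
  in the limits.\<close>

lemma has_derivative_pd:
  assumes "(h has_derivative D) (at x)"
  shows "pd i h x = D (axis i 1)"
proof -
  have "((\<lambda>s. x + s *\<^sub>R axis i 1) has_derivative (\<lambda>s. s *\<^sub>R axis i 1)) (at 0)"
    by (auto intro!: derivative_eq_intros)
  from has_derivative_compose[OF this, of h D] assms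
  have d: "((\<lambda>s. h (x + s *\<^sub>R axis i 1)) has_derivative (\<lambda>s. D (s *\<^sub>R axis i 1))) (at 0)"
    by simp
  have "(\<lambda>s. D (s *\<^sub>R axis i 1)) = (*) (D (axis i 1))"
    using linear_scale[OF has_derivative_linear[OF assms]] by (auto simp: fun_eq_iff)
  with d have "((\<lambda>s. h (x + s *\<^sub>R axis i 1)) has_real_derivative D (axis i 1)) (at 0)"
    by (simp add: has_field_derivative_def)
  then show ?thesis by (simp add: pd_def DERIV_imp_deriv)
qed

lemma pd_const [simp]: "pd i (\<lambda>x. c) x = 0"
  by (rule has_derivative_pd[OF has_derivative_const])

lemma pd_coord [simp]: "pd i (\<lambda>x. x $ j) x = (if i = j then 1 else 0)"
proof -
  have "((\<lambda>x. x $ j) has_derivative (\<lambda>v. v $ j)) (at x)"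
    by (rule bounded_linear_imp_has_derivative[OF bounded_linear_vec_nth])
  from has_derivative_pd[OF this, of i] show ?thesis by (simp add: axis_def)
qed

lemma differentiable_coord [simp, intro]: "(\<lambda>x. x $ j) differentiable (at x)"
  by (rule bounded_linear_imp_differentiable[OF bounded_linear_vec_nth])

lemma pd_add:
  assumes "f differentiable (at x)" "g differentiable (at x)"
  shows "pd i (\<lambda>x. f x + g x) x = pd i f x + pd i g x"
proof -
  obtain F G where F: "(f has_derivative F) (at x)" and G: "(g has_derivative G) (at x)"
    using assms by (auto simp: differentiable_def)
  show ?thesis using has_derivative_pd[OF has_derivative_add[OF F G]]
      has_derivative_pd[OF F] has_derivative_pd[OF G] by simp
qed

lemma pd_mult:
  fixes f g :: "real ^ 'n::finite \<Rightarrow> real"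
  assumes "f differentiable (at x)" "g differentiable (at x)"
  shows "pd i (\<lambda>x. f x * g x) x = pd i f x * g x + f x * pd i g x"
proof -
  obtain F G where F: "(f has_derivative F) (at x)" and G: "(g has_derivative G) (at x)"
    using assms by (auto simp: differentiable_def)
  show ?thesis using has_derivative_pd[OF has_derivative_mult[OF F G]]
      has_derivative_pd[OF F] has_derivative_pd[OF G] by simp
qed

lemma pd_cmult:
  fixes f :: "real ^ 'n::finite \<Rightarrow> real"
  assumes "f differentiable (at x)"
  shows "pd i (\<lambda>x. c * f x) x = c * pd i f x"
  using pd_mult[of "\<lambda>x. c" x f i] assms by simp

lemma pd_diff:
  assumes "f differentiable (at x)" "g differentiable (at x)"
  shows "pd i (\<lambda>x. f x - g x) x = pd i f x - pd i g x"
proof -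
  obtain F G where F: "(f has_derivative F) (at x)" and G: "(g has_derivative G) (at x)"
    using assms by (auto simp: differentiable_def)
  show ?thesis using has_derivative_pd[OF has_derivative_diff[OF F G]]
      has_derivative_pd[OF F] has_derivative_pd[OF G] by simp
qed

lemma pd_sum:
  assumes "finite A" "\<And>j. j \<in> A \<Longrightarrow> f j differentiable (at x)"
  shows "pd i (\<lambda>x. \<Sum>j\<in>A. f j x) x = (\<Sum>j\<in>A. pd i (f j) x)"
  using assms
proof (induction A)
  case (insert a A)
  then show ?case by (simp add: pd_add)
qed simp

lemma
  fixes h :: "real ^ 'n::finite \<Rightarrow> real"
  assumes "(\<phi> has_real_derivative d) (at (h x))" "h differentiable (at x)"
  shows pd_chain: "pd i (\<lambda>x. \<phi> (h x)) x = d * pd i h x"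
    and differentiable_chain: "(\<lambda>x. \<phi> (h x)) differentiable (at x)"
proof -
  obtain D where D: "(h has_derivative D) (at x)" using assms by (auto simp: differentiable_def)
  have "((\<lambda>x. \<phi> (h x)) has_derivative (\<lambda>v. d * D v)) (at x)"
    using has_derivative_compose[OF D, of \<phi> "(*) d"] assms(1)
    by (simp add: has_field_derivative_def)
  with has_derivative_pd[OF this] has_derivative_pd[OF D]
  show "pd i (\<lambda>x. \<phi> (h x)) x = d * pd i h x" "(\<lambda>x. \<phi> (h x)) differentiable (at x)"
    by (auto simp: differentiable_def)
qed

lemma
  fixes h :: "real ^ 'n::finite \<Rightarrow> real"
  assumes "h x > 0" "h differentiable (at x)"
  shows pd_powr: "pd i (\<lambda>x. h x powr s) x = s * h x powr (s - 1) * pd i h x"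
    and differentiable_powr: "(\<lambda>x. h x powr s) differentiable (at x)"
  by (rule pd_chain[OF has_real_derivative_powr] differentiable_chain[OF has_real_derivative_powr];
      use assms in simp)+

lemma
  assumes "eventually (\<lambda>y. f y = g y) (nhds x)"
  shows pd_cong_nhds: "pd i f x = pd i g x"
    and differentiable_cong_nhds: "f differentiable (at x) \<Longrightarrow> g differentiable (at x)"
proof -
  have "((\<lambda>s. x + s *\<^sub>R axis i 1) \<longlongrightarrow> x + 0 *\<^sub>R axis i 1) (nhds 0)"
    by (intro tendsto_intros filterlim_ident)
  then have "filterlim (\<lambda>s. x + s *\<^sub>R axis i 1) (nhds x) (nhds 0)" by simp
  from eventually_compose_filterlim[OF assms this]
  show "pd i f x = pd i g x" unfolding pd_def by (intro deriv_cong_ev) auto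
  assume "f differentiable (at x)"
  then obtain D where "(f has_derivative D) (at x)" by (auto simp: differentiable_def)
  moreover from eventually_nhds_x_imp_x[OF assms] have "f x = g x" .
  moreover from assms have "eventually (\<lambda>y. f y = g y) (at x)"
    by (auto simp: eventually_at_filter elim: eventually_mono)
  ultimately have "(g has_derivative D) (at x)"
    using has_derivative_transform_eventually by blast
  then show "g differentiable (at x)" by (auto simp: differentiable_def)
qed

text \<open>Differentiating an identity requires it on a neighbourhood of the point. Near infinity
  this costs nothing, because the radius can be enlarged by one.\<close>

lemma eventually_at_infinity_nhds:
  fixes P :: "'a::real_normed_vector \<Rightarrow> bool"
  assumes "eventually P at_infinity"
  shows "eventually (\<lambda>x. eventually P (nhds x)) at_infinity"
proof -
  obtain b where b: "\<And>x. norm x \<ge> b \<Longrightarrow> P x" using assms by (auto simp: eventually_at_infinity)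
  show ?thesis
  proof (rule eventually_at_infinityI[of "b + 1"])
    fix x :: 'a assume "b + 1 \<le> norm x"
    moreover have "open {x::'a. norm x > b}" by (intro open_Collect_less continuous_intros)
    ultimately show "eventually P (nhds x)"
      by (auto intro!: eventually_nhds[THEN iffD2] exI[of _ "{x. norm x > b}"] b)
  qed
qed

lemma pd_cong_ev:
  assumes "eventually (\<lambda>x. f x = g x) at_infinity"
  shows "eventually (\<lambda>x. pd i f x = pd i g x) at_infinity"
  using eventually_at_infinity_nhds[OF assms] by eventually_elim (rule pd_cong_nhds)

section \<open>Symbols\<close>

text \<open>A symbol of order \<open>a\<close> satisfies \<open>h = O_l(r^a)\<close> for every \<open>l\<close>. Closure under products and powers needs
  differentiability, which is only demanded near infinity.\<close>

fun symbol_upto :: "nat \<Rightarrow> real \<Rightarrow> (real ^ 'n::finite \<Rightarrow> real) \<Rightarrow> bool" where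
  "symbol_upto 0 a h \<longleftrightarrow> h \<in> O[at_infinity](\<lambda>x. norm x powr a)"
| "symbol_upto (Suc n) a h \<longleftrightarrow> h \<in> O[at_infinity](\<lambda>x. norm x powr a) \<and>
     eventually (\<lambda>x. h differentiable (at x)) at_infinity \<and> (\<forall>i. symbol_upto n (a - 1) (pd i h))"

definition symbol :: "real \<Rightarrow> (real ^ 'n::finite \<Rightarrow> real) \<Rightarrow> bool" where
  "symbol a h \<longleftrightarrow> (\<forall>n. symbol_upto n a h)"

lemma symbol_upto_Suc: "symbol_upto (Suc n) a h \<Longrightarrow> symbol_upto n a h"
  by (induction n arbitrary: a h) auto

lemma norm_powr_bigo:
  "a \<le> b \<Longrightarrow> (\<lambda>x::'a::real_normed_vector. norm x powr a) \<in> O[at_infinity](\<lambda>x. norm x powr b)"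
  by (intro bigoI[of _ 1] eventually_at_infinityI[of 1]) (auto intro!: powr_mono)

lemma symbol_upto_weaken: "symbol_upto n a h \<Longrightarrow> a \<le> b \<Longrightarrow> symbol_upto n b h"
proof (induction n arbitrary: a b h)
  case 0 then show ?case using landau_o.big_trans[OF _ norm_powr_bigo] by auto
next
  case (Suc n)
  have "h \<in> O[at_infinity](\<lambda>x. norm x powr b)"
    using Suc.prems landau_o.big_trans[OF _ norm_powr_bigo] by auto
  with Suc show ?case by (auto intro: Suc.IH[of "a - 1" _ "b - 1"])
qed

lemma symbol_upto_cong:
  assumes "symbol_upto n a f" "eventually (\<lambda>x. f x = g x) at_infinity"
  shows "symbol_upto n a g"
  using assms
proof (induction n arbitrary: a f g)
  case 0 then show ?case using landau_o.big.in_cong[of f g] by auto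
next
  case (Suc n)
  have "g \<in> O[at_infinity](\<lambda>x. norm x powr a)" using Suc.prems landau_o.big.in_cong[of f g] by auto
  moreover have "eventually (\<lambda>x. f differentiable (at x)) at_infinity" using Suc.prems by simp
  with eventually_at_infinity_nhds[OF Suc.prems(2)]
  have "eventually (\<lambda>x. g differentiable (at x)) at_infinity"
    by eventually_elim (rule differentiable_cong_nhds)
  moreover have "symbol_upto n (a - 1) (pd i g)" for i
    using Suc.prems by (auto intro: Suc.IH[of _ "pd i f"] pd_cong_ev)
  ultimately show ?case by simp
qed

lemma symbol_upto_add:
  "symbol_upto n a f \<Longrightarrow> symbol_upto n a g \<Longrightarrow> symbol_upto n a (\<lambda>x. f x + g x)"
proof (induction n arbitrary: a f g)
  case 0 then show ?case by (auto intro: sum_in_bigo)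
next
  case (Suc n)
  have ev: "eventually (\<lambda>x. f differentiable (at x)) at_infinity"
    "eventually (\<lambda>x. g differentiable (at x)) at_infinity" using Suc.prems by auto
  have "symbol_upto n (a - 1) (pd i (\<lambda>x. f x + g x))" for i
  proof (rule symbol_upto_cong)
    show "symbol_upto n (a - 1) (\<lambda>x. pd i f x + pd i g x)" using Suc by auto
    show "eventually (\<lambda>x. pd i f x + pd i g x = pd i (\<lambda>x. f x + g x) x) at_infinity"
      using ev by eventually_elim (simp add: pd_add)
  qed
  moreover from ev have "eventually (\<lambda>x. (\<lambda>x. f x + g x) differentiable (at x)) at_infinity"
    by eventually_elim (rule differentiable_add)
  ultimately show ?case using Suc.prems by (auto intro: sum_in_bigo)
qed

lemma symbol_upto_mult:
  "symbol_upto n a f \<Longrightarrow> symbol_upto n b g \<Longrightarrow> symbol_upto n (a + b) (\<lambda>x. f x * g x)"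
proof (induction n arbitrary: a b f g)
  case 0 then show ?case by (auto simp: powr_add intro: landau_o.big.mult)
next
  case (Suc n)
  have ev: "eventually (\<lambda>x. f differentiable (at x)) at_infinity"
    "eventually (\<lambda>x. g differentiable (at x)) at_infinity" using Suc.prems by auto
  have "symbol_upto n (a + b - 1) (pd i (\<lambda>x. f x * g x))" for i
  proof (rule symbol_upto_cong)
    have "symbol_upto n ((a - 1) + b) (\<lambda>x. pd i f x * g x)"
      using Suc.prems by (intro Suc.IH symbol_upto_Suc[of n b]) auto
    moreover have "symbol_upto n (a + (b - 1)) (\<lambda>x. f x * pd i g x)"
      using Suc.prems by (intro Suc.IH symbol_upto_Suc[of n a]) auto
    ultimately show "symbol_upto n (a + b - 1) (\<lambda>x. pd i f x * g x + f x * pd i g x)"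
      by (intro symbol_upto_add) (simp_all add: algebra_simps)
    show "eventually (\<lambda>x. pd i f x * g x + f x * pd i g x = pd i (\<lambda>x. f x * g x) x) at_infinity"
      using ev by eventually_elim (simp add: pd_mult)
  qed
  moreover from ev have "eventually (\<lambda>x. (\<lambda>x. f x * g x) differentiable (at x)) at_infinity"
    by eventually_elim (rule differentiable_mult)
  ultimately show ?case using Suc.prems by (auto simp: powr_add intro: landau_o.big.mult)
qed

lemma symbol_upto_zero: "symbol_upto n a (\<lambda>x::real^'n::finite. 0)"
proof (induction n arbitrary: a)
  case (Suc n)
  have "pd i (\<lambda>x::real^'n. 0) = (\<lambda>x. 0)" for i by (rule ext) simp
  with Suc show ?case by simp
qed simp

lemma symbol_upto_const: "symbol_upto n 0 (\<lambda>x::real^'n::finite. c)"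
proof -
  have *: "(\<lambda>x. c) \<in> O[at_infinity](\<lambda>x::real^'n. norm x powr 0)"
    by (rule bigoI[of _ "\<bar>c\<bar>"], rule eventually_at_infinityI[of 1]) auto
  have "pd i (\<lambda>x::real^'n. c) = (\<lambda>x. 0)" for i by (rule ext) simp
  then show ?thesis using * symbol_upto_zero by (cases n) auto
qed

lemma symbol_upto_coord: "symbol_upto n 1 (\<lambda>x::real^'n::finite. x $ j)"
proof -
  have *: "(\<lambda>x. x $ j) \<in> O[at_infinity](\<lambda>x::real^'n. norm x powr 1)"
    by (rule bigoI[of _ 1], rule eventually_at_infinityI[of 1]) (auto simp: component_le_norm_cart)
  have "pd i (\<lambda>x::real^'n. x $ j) = (\<lambda>x. if i = j then 1 else 0)" for i by (rule ext) simp
  then show ?thesis using * symbol_upto_const by (cases n) auto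
qed

text \<open>A positive limit keeps u away from 0, so every power of u is bounded and differentiable
  near infinity. The derivative brings in the exponent s - 1, hence the induction runs over all s at
  once.\<close>

lemma symbol_upto_powr:
  assumes "symbol_upto n 0 u" "(u \<longlongrightarrow> l) at_infinity" "l > 0"
  shows "symbol_upto n 0 (\<lambda>x. u x powr s)"
proof -
  have bigo: "(\<lambda>x. u x powr s) \<in> O[at_infinity](\<lambda>x. norm x powr 0)" for s
  proof -
    have "((\<lambda>x. u x powr s) \<longlongrightarrow> l powr s) at_infinity"
      using assms by (intro tendsto_intros) auto
    then have "(\<lambda>x. u x powr s) \<in> O[at_infinity](\<lambda>x. 1)"
      by (intro bigoI_tendsto[of _ _ "l powr s"]) auto
    moreover have "eventually (\<lambda>x::real^'n. norm x powr 0 = 1) at_infinity"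
      by (rule eventually_at_infinityI[of 1]) auto
    ultimately show ?thesis by (subst landau_o.big.cong) auto
  qed
  have pos: "eventually (\<lambda>x. u x > 0) at_infinity" using assms(2,3) by (rule order_tendstoD)
  show ?thesis
    using assms(1)
  proof (induction n arbitrary: s)
    case 0
    with bigo show ?case by simp
  next
    case (Suc n)
    have ev: "eventually (\<lambda>x. u differentiable (at x)) at_infinity" using Suc.prems by simp
    have "symbol_upto n (0 - 1) (pd i (\<lambda>x. u x powr s))" for i
    proof (rule symbol_upto_cong)
      have "symbol_upto n (0 + 0 + (0 - 1)) (\<lambda>x. s * u x powr (s - 1) * pd i u x)"
        using Suc.prems by (intro symbol_upto_mult[OF symbol_upto_mult[OF symbol_upto_const
              Suc.IH[OF symbol_upto_Suc[OF Suc.prems]]]]) auto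
      then show "symbol_upto n (0 - 1) (\<lambda>x. s * u x powr (s - 1) * pd i u x)" by simp
      show "eventually (\<lambda>x. s * u x powr (s - 1) * pd i u x = pd i (\<lambda>x. u x powr s) x) at_infinity"
        using ev pos by eventually_elim (simp add: pd_powr)
    qed
    moreover from ev pos have "eventually (\<lambda>x. (\<lambda>x. u x powr s) differentiable (at x)) at_infinity"
      by eventually_elim (rule differentiable_powr)
    ultimately show ?case using bigo by simp
  qed
qed

lemma symbol_weaken: "symbol a h \<Longrightarrow> a \<le> b \<Longrightarrow> symbol b h"
  unfolding symbol_def by (blast intro: symbol_upto_weaken)

lemma symbol_cong: "symbol a f \<Longrightarrow> eventually (\<lambda>x. f x = g x) at_infinity \<Longrightarrow> symbol a g"
  unfolding symbol_def by (blast intro: symbol_upto_cong)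

lemma symbol_add: "symbol a f \<Longrightarrow> symbol a g \<Longrightarrow> symbol a (\<lambda>x. f x + g x)"
  unfolding symbol_def by (blast intro: symbol_upto_add)

lemma symbol_mult: "symbol a f \<Longrightarrow> symbol b g \<Longrightarrow> a + b \<le> c \<Longrightarrow> symbol c (\<lambda>x. f x * g x)"
  unfolding symbol_def by (blast intro: symbol_upto_weaken[OF symbol_upto_mult])

lemma symbol_const: "0 \<le> a \<Longrightarrow> symbol a (\<lambda>x. c)"
  unfolding symbol_def by (blast intro: symbol_upto_weaken[OF symbol_upto_const])

lemma symbol_zero: "symbol a (\<lambda>x. 0)"
  by (simp add: symbol_def symbol_upto_zero)

lemma symbol_coord: "1 \<le> a \<Longrightarrow> symbol a (\<lambda>x. x $ j)"
  unfolding symbol_def by (blast intro: symbol_upto_weaken[OF symbol_upto_coord])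

lemma symbol_cmult: "symbol a f \<Longrightarrow> symbol a (\<lambda>x. c * f x)"
  by (rule symbol_mult[OF symbol_const[of 0]]) auto

lemma symbol_minus: "symbol a f \<Longrightarrow> symbol a (\<lambda>x. - f x)"
  using symbol_cmult[of a f "-1"] by simp

lemma symbol_diff: "symbol a f \<Longrightarrow> symbol a g \<Longrightarrow> symbol a (\<lambda>x. f x - g x)"
  using symbol_add[of a f "\<lambda>x. - g x"] symbol_minus[of a g] by simp

lemma symbol_sum: "(\<And>j. j \<in> A \<Longrightarrow> symbol a (f j)) \<Longrightarrow> symbol a (\<lambda>x. \<Sum>j\<in>A. f j x)"
  by (induction A rule: infinite_finite_induct) (auto simp: symbol_zero symbol_add)

lemma symbol_powr:
  "symbol 0 u \<Longrightarrow> (u \<longlongrightarrow> l) at_infinity \<Longrightarrow> l > 0 \<Longrightarrow> symbol 0 (\<lambda>x. u x powr s)"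
  unfolding symbol_def by (blast intro: symbol_upto_powr)

lemma symbol_pd: "symbol a h \<Longrightarrow> symbol (a - 1) (pd i h)"
  unfolding symbol_def using symbol_upto.simps(2) by blast

lemma symbol_bigo: "symbol a h \<Longrightarrow> h \<in> O[at_infinity](\<lambda>x. norm x powr a)"
  unfolding symbol_def by (auto dest: spec[of _ 0])

lemma symbol_differentiable:
  "symbol a h \<Longrightarrow> eventually (\<lambda>x. h differentiable (at x)) at_infinity"
  unfolding symbol_def by (auto dest: spec[of _ "Suc 0"])

lemma symbol_O_deriv: "symbol a h \<Longrightarrow> O_deriv l a h"
proof -
  assume "symbol a h"
  then have "symbol (a - real (length is)) (iterated_pd is h)" for "is"
  proof (induction "is")
    case (Cons i "is")
    from symbol_pd[OF Cons.IH[OF Cons.prems], of i] show ?case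
      by (simp add: iterated_pd_def algebra_simps)
  qed (simp add: iterated_pd_def)
  then show ?thesis by (auto simp: O_deriv_def intro: symbol_bigo)
qed

lemma symbol_tendsto_0:
  assumes "symbol a h" "a < 0"
  shows "(h \<longlongrightarrow> 0) at_infinity"
proof -
  have "((\<lambda>x::real^'n. norm x powr a) \<longlongrightarrow> 0) at_infinity"
    using assms(2) by (intro tendsto_neg_powr filterlim_norm_at_top)
  moreover obtain C where "eventually (\<lambda>x. norm (h x) \<le> C * norm (norm x powr a)) at_infinity"
    using symbol_bigo[OF assms(1)] by (auto elim: landau_o.bigE)
  ultimately show ?thesis
    by (intro Lim_null_comparison[of h "\<lambda>x. C * norm (norm x powr a)"])
       (auto intro!: tendsto_mult_right_zero)
qed

text \<open>For \<open>L = 0\<close> this is the power \<open>r\<^bsup>2s\<^esup>\<close>, and for \<open>L \<noteq> 0\<close> a smooth regularization of it.\<close>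

definition rho :: "real \<Rightarrow> real \<Rightarrow> real ^ 'n::finite \<Rightarrow> real" where
  "rho L s x = ((norm x)\<^sup>2 + L\<^sup>2) powr s"

lemma rho_0: "rho 0 s x = norm x powr (2 * s)"
proof (cases "x = 0")
  case False
  then have "(norm x)\<^sup>2 powr s = (norm x powr 2) powr s" by simp
  then show ?thesis by (simp add: rho_def powr_powr del: powr_numeral)
qed (simp add: rho_def)

lemma norm_sq_eq_sum: "(norm x)\<^sup>2 = (\<Sum>i\<in>UNIV. x $ i * x $ i)"
  for x :: "real ^ 'n::finite"
  by (simp add: inner_vec_def power2_norm_eq_inner)

lemma
  fixes x :: "real ^ 'n::finite"
  assumes "x \<noteq> 0 \<or> L \<noteq> 0"
  shows pd_rho: "pd i (rho L s) x = 2 * s * x $ i * rho L (s - 1) x"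
    and differentiable_rho: "rho L s differentiable (at x)"
proof -
  have d: "(\<lambda>x::real^'n. (norm x)\<^sup>2 + L\<^sup>2) differentiable (at x)"
    unfolding norm_sq_eq_sum by (intro derivative_intros ballI differentiable_coord) auto
  have pos: "(norm x)\<^sup>2 + L\<^sup>2 > 0" using assms by (auto simp: add_nonneg_pos add_pos_nonneg)
  have "pd i (\<lambda>x::real^'n. (norm x)\<^sup>2 + L\<^sup>2) x = 2 * x $ i"
    unfolding norm_sq_eq_sum
    by (subst pd_add, auto simp: pd_sum pd_mult if_distrib sum.distrib cong: if_cong)
  with pd_powr[OF pos d, of i s] differentiable_powr[OF pos d, of s]
  show "pd i (rho L s) x = 2 * s * x $ i * rho L (s - 1) x" "rho L s differentiable (at x)"
    unfolding rho_def by simp_all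
qed

text \<open>After t^(2s) is factored out, (1 + y)^s - 1 at y = L^2/t^2 is y times a difference
  quotient that tends to s; the factor y is the gain of two orders. The case \<open>L = 0\<close> is
  separate because the quotient needs y nonzero.\<close>

lemma powr_shift_bigo:
  fixes L s :: real
  shows "(\<lambda>t::real. (t\<^sup>2 + L\<^sup>2) powr s - t powr (2 * s)) \<in> O(\<lambda>t. t powr (2 * s - 2))"
proof -
  have "((\<lambda>y. (1 + y) powr s) has_real_derivative s) (at 0)"
    by (auto intro!: derivative_eq_intros)
  then have *: "((\<lambda>y. ((1 + y) powr s - 1) / y) \<longlongrightarrow> s) (at 0)"
    by (simp add: has_field_derivative_iff)
  show ?thesis
  proof (cases "L = 0")
    case True
    have "eventually (\<lambda>t::real. (t\<^sup>2 + L\<^sup>2) powr s - t powr (2 * s) = 0) at_top"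
      using eventually_gt_at_top[of 0]
      by eventually_elim (simp add: True powr_powr flip: powr_numeral)
    from landau_o.big.in_cong[OF this] show ?thesis by simp
  next
    case False
    have "filterlim (\<lambda>t. L\<^sup>2 / t\<^sup>2) (at 0) at_top"
    proof (rule filterlim_atI)
      show "((\<lambda>t. L\<^sup>2 / t\<^sup>2) \<longlongrightarrow> 0) at_top"
        by (intro tendsto_divide_0[OF tendsto_const] filterlim_at_top_imp_at_infinity
            filterlim_pow_at_top filterlim_ident) simp
      show "\<forall>\<^sub>F t in at_top. L\<^sup>2 / t\<^sup>2 \<noteq> 0"
        using eventually_gt_at_top[of 0] by eventually_elim (simp add: False)
    qed
    from filterlim_compose[OF * this]
    have "((\<lambda>t. ((1 + L\<^sup>2 / t\<^sup>2) powr s - 1) / (L\<^sup>2 / t\<^sup>2) * L\<^sup>2) \<longlongrightarrow> s * L\<^sup>2) at_top"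
      by (rule tendsto_mult_right)
    moreover have "eventually (\<lambda>t. ((1 + L\<^sup>2 / t\<^sup>2) powr s - 1) / (L\<^sup>2 / t\<^sup>2) * L\<^sup>2 =
        ((t\<^sup>2 + L\<^sup>2) powr s - t powr (2 * s)) / t powr (2 * s - 2)) at_top"
      using eventually_gt_at_top[of 0]
    proof eventually_elim
      case (elim t)
      have "(t\<^sup>2 + L\<^sup>2) powr s = (t\<^sup>2 * (1 + L\<^sup>2 / t\<^sup>2)) powr s" using elim by (simp add: distrib_left)
      also have "\<dots> = (t powr 2) powr s * (1 + L\<^sup>2 / t\<^sup>2) powr s" using elim by (subst powr_mult) auto
      also have "(t powr 2) powr s = t powr (2 * s)" by (simp only: powr_powr)
      finally have "(t\<^sup>2 + L\<^sup>2) powr s - t powr (2 * s) = t powr (2 * s) * ((1 + L\<^sup>2 / t\<^sup>2) powr s - 1)"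
        by (simp add: algebra_simps)
      moreover have "t powr (2 * s - 2) = t powr (2 * s) / t\<^sup>2" using elim by (simp add: powr_diff)
      ultimately show ?case using elim False by (simp add: field_simps)
    qed
    ultimately have "((\<lambda>t. ((t\<^sup>2 + L\<^sup>2) powr s - t powr (2 * s)) / t powr (2 * s - 2)) \<longlongrightarrow> s * L\<^sup>2) at_top"
      using tendsto_cong by fast
    moreover have "eventually (\<lambda>t::real. t powr (2 * s - 2) \<noteq> 0) at_top"
      using eventually_gt_at_top[of 0] by eventually_elim simp
    ultimately show ?thesis by (intro bigoI_tendsto) auto
  qed
qed

lemma symbol_rho: "2 * s \<le> a \<Longrightarrow> symbol a (rho L s)"
proof -
  have O: "rho L s \<in> O[at_infinity](\<lambda>x::real^'n. norm x powr (2 * s))" for s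
  proof -
    have "(\<lambda>t::real. t powr (2 * s - 2)) \<in> O(\<lambda>t. t powr (2 * s))"
      by (intro bigoI[of _ 1] eventually_at_top_linorderI[of 1]) (auto intro!: powr_mono)
    from sum_in_bigo(1)[OF landau_o.big_trans[OF powr_shift_bigo this] landau_o.big_refl]
    have "(\<lambda>t::real. (t\<^sup>2 + L\<^sup>2) powr s) \<in> O(\<lambda>t. t powr (2 * s))" by simp
    from landau_o.big.compose[OF this filterlim_norm_at_top] show ?thesis by (simp add: rho_def[abs_def])
  qed
  have "symbol_upto n (2 * s) (rho L s :: real^'n \<Rightarrow> real)" for n
  proof (induction n arbitrary: s)
    case (Suc n)
    have ev: "eventually (\<lambda>x::real^'n. x \<noteq> 0) at_infinity"
      by (rule eventually_not_equal_at_infinity)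
    have "symbol_upto n (2 * s - 1) (pd i (rho L s :: real^'n \<Rightarrow> real))" for i
    proof (rule symbol_upto_cong)
      have "symbol_upto n (0 + 1 + 2 * (s - 1)) (\<lambda>x::real^'n. 2 * s * x $ i * rho L (s - 1) x)"
        by (intro symbol_upto_mult symbol_upto_const symbol_upto_coord Suc.IH)
      then show "symbol_upto n (2 * s - 1) (\<lambda>x::real^'n. 2 * s * x $ i * rho L (s - 1) x)"
        by (simp add: algebra_simps)
      show "eventually (\<lambda>x::real^'n. 2 * s * x $ i * rho L (s - 1) x = pd i (rho L s) x) at_infinity"
        using ev by eventually_elim (simp add: pd_rho)
    qed
    moreover have "eventually (\<lambda>x::real^'n. rho L s differentiable (at x)) at_infinity"
      using ev by eventually_elim (simp add: differentiable_rho)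
    ultimately show ?case using O by simp
  qed (use O in simp)
  then show "2 * s \<le> a \<Longrightarrow> symbol a (rho L s :: real^'n \<Rightarrow> real)"
    unfolding symbol_def by (blast intro: symbol_upto_weaken)
qed

text \<open>Differentiation keeps the shape of the difference, with \<open>s - 1\<close> in place of
  \<open>s\<close> and a factor x_i, so the gain of two orders passes to all derivatives. This is
  why L leaves no trace in the ADM limits.\<close>

lemma symbol_rho_diff:
  fixes L s :: real
  assumes "2 * s - 2 \<le> a"
  shows "symbol a (\<lambda>x::real^'n::finite. rho L s x - rho 0 s x)"
proof -
  have O: "(\<lambda>x::real^'n. rho L s x - rho 0 s x) \<in> O[at_infinity](\<lambda>x::real^'n. norm x powr (2 * s - 2))" for s
  proof -
    have "(\<lambda>t::real. (t\<^sup>2 + L\<^sup>2) powr s - t powr (2 * s)) \<in> O(\<lambda>t. t powr (2 * s - 2))"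
      by (rule powr_shift_bigo)
    from landau_o.big.compose[OF this filterlim_norm_at_top] show ?thesis
      by (simp add: rho_0) (simp add: rho_def)
  qed
  have "symbol_upto n (2 * s - 2) (\<lambda>x::real^'n. rho L s x - rho 0 s x)" for n
  proof (induction n arbitrary: s)
    case (Suc n)
    have ev: "eventually (\<lambda>x::real^'n. x \<noteq> 0) at_infinity"
      by (rule eventually_not_equal_at_infinity)
    have "symbol_upto n (2 * s - 2 - 1) (pd i (\<lambda>x::real^'n. rho L s x - rho 0 s x))" for i
    proof (rule symbol_upto_cong)
      have "symbol_upto n (0 + 1 + (2 * (s - 1) - 2))
        (\<lambda>x::real^'n. 2 * s * x $ i * (rho L (s - 1) x - rho 0 (s - 1) x))"
        by (intro symbol_upto_mult symbol_upto_const symbol_upto_coord Suc.IH)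
      then show "symbol_upto n (2 * s - 2 - 1)
        (\<lambda>x::real^'n. 2 * s * x $ i * (rho L (s - 1) x - rho 0 (s - 1) x))"
        by (simp add: algebra_simps)
      show "eventually (\<lambda>x::real^'n. 2 * s * x $ i * (rho L (s - 1) x - rho 0 (s - 1) x)
          = pd i (\<lambda>x. rho L s x - rho 0 s x) x) at_infinity"
        using ev by eventually_elim (simp add: pd_diff differentiable_rho pd_rho right_diff_distrib)
    qed
    moreover have "eventually (\<lambda>x::real^'n. (\<lambda>x. rho L s x - rho 0 s x) differentiable (at x)) at_infinity"
      using ev by eventually_elim (auto intro!: derivative_intros differentiable_rho)
    ultimately show ?case using O by simp
  qed (use O in simp)
  from symbol_upto_weaken[OF this assms] show ?thesis
    unfolding symbol_def by (rule allI)
qed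

section \<open>Smooth functions\<close>

text \<open>For nonzero \<open>L\<close> these functions are defined and differentiable everywhere
  and closed under \<open>pd\<close>, so smoothness and the symmetry of derivatives follow by
  structural induction. The index set \<open>I\<close> lets one class serve on R^3 (all coordinates)
  and on R^4 (the spatial ones).\<close>

inductive elementary :: "'n::finite set \<Rightarrow> real \<Rightarrow> (real ^ 'n \<Rightarrow> real) \<Rightarrow> bool" for I L where
  const: "elementary I L (\<lambda>x. c)"
| coord: "elementary I L (\<lambda>x. x $ i)"
| powr: "elementary I L (\<lambda>x. ((\<Sum>i\<in>I. x $ i * x $ i) + L\<^sup>2) powr s)"
| add: "elementary I L f \<Longrightarrow> elementary I L g \<Longrightarrow> elementary I L (\<lambda>x. f x + g x)"
| mult: "elementary I L f \<Longrightarrow> elementary I L g \<Longrightarrow> elementary I L (\<lambda>x. f x * g x)"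

lemma
  fixes x :: "real ^ 'n::finite"
  assumes "L \<noteq> 0"
  shows pd_partial_rho: "pd j (\<lambda>x::real^'n. ((\<Sum>i\<in>I. x $ i * x $ i) + L\<^sup>2) powr s) x =
      (if j \<in> I then 2 * s else 0) * (x $ j * ((\<Sum>i\<in>I. x $ i * x $ i) + L\<^sup>2) powr (s - 1))"
    and differentiable_partial_rho:
      "(\<lambda>x::real^'n. ((\<Sum>i\<in>I. x $ i * x $ i) + L\<^sup>2) powr s) differentiable (at x)"
proof -
  have d: "(\<lambda>x::real^'n. (\<Sum>i\<in>I. x $ i * x $ i) + L\<^sup>2) differentiable (at x)"
    by (intro derivative_intros ballI differentiable_coord) auto
  have pos: "(\<Sum>i\<in>I. x $ i * x $ i) + L\<^sup>2 > 0"
    using assms by (intro add_nonneg_pos sum_nonneg) auto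
  have "pd j (\<lambda>x::real^'n. x $ i * x $ i) x = (if i = j then 2 * x $ j else 0)" for i
    by (simp add: pd_mult)
  then have "pd j (\<lambda>x::real^'n. (\<Sum>i\<in>I. x $ i * x $ i) + L\<^sup>2) x = (\<Sum>i\<in>I. if i = j then 2 * x $ j else 0)"
    by (subst pd_add) (auto simp: pd_sum)
  also have "\<dots> = (if j \<in> I then 2 * x $ j else 0)" by simp
  finally have "pd j (\<lambda>x::real^'n. (\<Sum>i\<in>I. x $ i * x $ i) + L\<^sup>2) x = (if j \<in> I then 2 * x $ j else 0)" .
  with pd_powr[OF pos d, of j s] differentiable_powr[OF pos d, of s]
  show "pd j (\<lambda>x::real^'n. ((\<Sum>i\<in>I. x $ i * x $ i) + L\<^sup>2) powr s) x =
      (if j \<in> I then 2 * s else 0) * (x $ j * ((\<Sum>i\<in>I. x $ i * x $ i) + L\<^sup>2) powr (s - 1))"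
    "(\<lambda>x::real^'n. ((\<Sum>i\<in>I. x $ i * x $ i) + L\<^sup>2) powr s) differentiable (at x)"
    by simp_all
qed

lemma elementary_differentiable: "elementary I L h \<Longrightarrow> L \<noteq> 0 \<Longrightarrow> h differentiable (at x)"
  by (induction rule: elementary.induct)
     (auto intro: differentiable_partial_rho differentiable_add differentiable_mult)

lemma pd_add_elementary:
  "elementary I L f \<Longrightarrow> elementary I L g \<Longrightarrow> L \<noteq> 0 \<Longrightarrow>
    pd i (\<lambda>x. f x + g x) = (\<lambda>x. pd i f x + pd i g x)"
  by (rule ext) (simp add: pd_add elementary_differentiable)

lemma pd_mult_elementary:
  "elementary I L f \<Longrightarrow> elementary I L g \<Longrightarrow> L \<noteq> 0 \<Longrightarrow>
    pd i (\<lambda>x. f x * g x) = (\<lambda>x. pd i f x * g x + f x * pd i g x)"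
  by (rule ext) (simp add: pd_mult elementary_differentiable)

lemma elementary_pd: "elementary I L h \<Longrightarrow> L \<noteq> 0 \<Longrightarrow> elementary I L (pd j h)"
proof (induction rule: elementary.induct)
  case (const c)
  have "pd j (\<lambda>x. c) = (\<lambda>x. 0)" by (rule ext) simp
  then show ?case by (simp add: elementary.const)
next
  case (coord i)
  have "pd j (\<lambda>x. x $ i) = (\<lambda>x. if j = i then 1 else 0)" by (rule ext) simp
  then show ?case by (simp add: elementary.const)
next
  case (powr s)
  show ?case unfolding pd_partial_rho[OF powr, abs_def]
    by (intro elementary.intros)
next
  case (add f g)
  then show ?case by (simp add: pd_add_elementary elementary.add)
next
  case (mult f g)
  then show ?case by (simp add: pd_mult_elementary elementary.add elementary.mult)
qed

text \<open>Explicit formulas on the generators, then the sum and product rules. The symmetry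
  matters because the leading part of J cancels only after third derivatives of f are
  exchanged.\<close>

lemma elementary_pd_commute:
  "elementary I L h \<Longrightarrow> L \<noteq> 0 \<Longrightarrow> pd i (pd j h) = pd j (pd i h)"
proof (induction rule: elementary.induct)
  case (const c)
  have "pd j (\<lambda>x. c) = (\<lambda>x. 0)" for j by (rule ext) simp
  then show ?case by simp
next
  case (coord k)
  have "pd j (\<lambda>x. x $ k) = (\<lambda>x. if j = k then 1 else 0)" for j by (rule ext) simp
  then show ?case by (auto simp: fun_eq_iff)
next
  case (powr s)
  have e: "elementary I L (\<lambda>x. x $ j * ((\<Sum>i\<in>I. x $ i * x $ i) + L\<^sup>2) powr s)" for j s
    by (intro elementary.intros)
  show ?case unfolding pd_partial_rho[OF powr, abs_def]
    by (rule ext)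
       (auto simp: pd_mult pd_partial_rho[OF powr] elementary_differentiable[OF e powr] powr
          differentiable_partial_rho)
next
  case (add f g)
  then show ?case by (simp add: pd_add_elementary[of I L] elementary_pd)
next
  case (mult f g)
  then show ?case
    by (simp add: pd_mult_elementary[of I L] pd_add_elementary[of I L] elementary_pd elementary.mult)
      (auto simp: fun_eq_iff algebra_simps)
qed

lemma elementary_smooth:
  assumes "elementary I L h" "L \<noteq> 0" "open U"
  shows "smooth_on U h"
proof -
  have "elementary I L (iterated_pd is h)" for "is"
    by (induction "is") (auto simp: iterated_pd_def assms elementary_pd)
  with assms show ?thesis unfolding smooth_on_def differentiable_on_def
    by (auto intro: differentiable_at_withinI elementary_differentiable)
qed

section \<open>Linear algebra\<close>

lemma matrix_inv_eqI:
  fixes A B :: "real ^ 'n::finite ^ 'n"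
  assumes "\<And>i j. (\<Sum>k\<in>UNIV. A $ i $ k * B $ k $ j) = (if i = j then 1 else 0)"
  shows "matrix_inv A = B"
proof -
  have AB: "A ** B = mat 1"
    using assms by (simp add: matrix_matrix_mult_def mat_def vec_eq_iff)
  then have BA: "B ** A = mat 1" by (simp add: matrix_left_right_inverse)
  have "\<exists>A'. A ** A' = mat 1 \<and> A' ** A = mat 1" using AB BA by blast
  then have "A ** matrix_inv A = mat 1 \<and> matrix_inv A ** A = mat 1"
    unfolding matrix_inv_def by (rule someI_ex)
  then show ?thesis using BA by (metis matrix_mul_assoc matrix_mul_lid matrix_mul_rid)
qed

text \<open>The place of the i-th space coordinate in (t, x). Through
  \<open>sum_spatial_index\<close> every sum over four indices splits into its time term and a sum
  over three.\<close>

definition spatial_index :: "3 \<Rightarrow> 4" where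
  "spatial_index i = (if i = 1 then 2 else if i = 2 then 3 else 4)"

lemma spatial_index_simps [simp]: "spatial_index 1 = 2" "spatial_index 2 = 3" "spatial_index 3 = 4" "spatial_index i \<noteq> 1" "1 \<noteq> spatial_index i"
  by (auto simp: spatial_index_def)

lemma spatial_index_eq_iff [simp]: "spatial_index i = spatial_index j \<longleftrightarrow> i = j"
  using exhaust_3[of i] exhaust_3[of j] by (auto simp: spatial_index_def)

lemma spatial_index_cases: obtains "a = 1" | i where "a = spatial_index i"
  using exhaust_4[of a] by (metis spatial_index_simps(1-3))

lemma sum_spatial_index: "(\<Sum>a\<in>UNIV. F a) = F 1 + (\<Sum>i\<in>UNIV. F (spatial_index i))"
  for F :: "4 \<Rightarrow> real"
  by (simp add: sum_3 sum_4)

lemma spatial_nth [simp]: "spatial p $ i = p $ spatial_index i"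
  using exhaust_3[of i] by (auto simp: spatial_def)

lemma vector_4_nth [simp]:
  "(vector [a, b, c, d] :: real ^ 4) $ 1 = a" "(vector [a, b, c, d] :: real ^ 4) $ 2 = b"
  "(vector [a, b, c, d] :: real ^ 4) $ 3 = c" "(vector [a, b, c, d] :: real ^ 4) $ 4 = d"
  by (simp_all add: vector_def)

lemma graph_point_nth [simp]: "graph_point f x $ 1 = f x" "graph_point f x $ spatial_index i = x $ i"
  using exhaust_3[of i] by (auto simp: graph_point_def)

lemma spatial_graph_point [simp]: "spatial (graph_point f x) = x"
  by (simp add: vec_eq_iff)

lemma spatial_axis [simp]: "spatial (axis 1 c) = 0" "spatial (axis (spatial_index i) c) = axis i c"
  by (auto simp: vec_eq_iff axis_def)

lemma spatial_add_axis:
  "spatial (p + s *\<^sub>R axis 1 1) = spatial p"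
  "spatial (p + s *\<^sub>R axis (spatial_index i) 1) = spatial p + s *\<^sub>R axis i 1"
  by (auto simp: vec_eq_iff axis_def)

lemma pd_spatial [simp]:
  "pd 1 (\<lambda>p. H (spatial p)) p = 0"
  "pd (spatial_index i) (\<lambda>p. H (spatial p)) p = pd i H (spatial p)"
  by (simp_all add: pd_def spatial_add_axis)

lemma continuous_spatial: "continuous_on UNIV spatial"
proof -
  have eq: "spatial = (\<lambda>p. \<chi> i. p $ spatial_index i)" by (simp add: fun_eq_iff vec_eq_iff)
  show ?thesis unfolding eq by (intro continuous_intros)
qed

lemma open_exterior: "open (exterior m)"
  unfolding exterior_def
  by (intro open_Collect_less continuous_intros continuous_spatial)

section \<open>The Schwarzschild metric in Cartesian coordinates\<close>

definition lapse_sq :: "real \<Rightarrow> real ^ 3 \<Rightarrow> real" where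
  "lapse_sq m x = 1 - 2 * m * rho 0 (-1/2) x"

text \<open>The metric of the slices t = const. With u = x/r it is the identity plus (1 /
  \<open>lapse_sq\<close> - 1) times u u^T: eigenvalue 1 / \<open>lapse_sq\<close> along u and 1
  across.\<close>

definition spatial_metric :: "real \<Rightarrow> real ^ 3 \<Rightarrow> real ^ 3 ^ 3" where
  "spatial_metric m x = (\<chi> i j. (if i = j then 1 else 0) + (1 / lapse_sq m x - 1) * rho 0 (-1) x * (x $ i * x $ j))"

text \<open>Inversion turns the radial eigenvalue into \<open>lapse_sq\<close>, and
  (\<open>lapse_sq\<close> - 1)/r^2 = -2m/r^3.\<close>

definition spatial_metric_inv :: "real \<Rightarrow> real ^ 3 \<Rightarrow> real ^ 3 ^ 3" where
  "spatial_metric_inv m x = (\<chi> i j. (if i = j then 1 else 0) + (- 2 * m * rho 0 (-3/2) x) * (x $ i * x $ j))"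

lemma rho_0_inverse:
  assumes "x \<noteq> 0"
  shows "rho 0 (-1/2) x = 1 / norm x" "rho 0 (-1) x = 1 / (norm x)\<^sup>2" "rho 0 (-3/2) x = 1 / (norm x)^3"
proof -
  have "norm x > 0" using assms by simp
  then show "rho 0 (-1/2) x = 1 / norm x" "rho 0 (-1) x = 1 / (norm x)\<^sup>2" "rho 0 (-3/2) x = 1 / (norm x)^3"
    by (simp_all add: rho_0 powr_minus_divide)
qed

lemma lapse_sq_eq: "x \<noteq> 0 \<Longrightarrow> lapse_sq m x = 1 - 2 * m / norm x"
  unfolding lapse_sq_def rho_0_inverse(1) by simp

lemma differentiable_lapse_sq: "x \<noteq> 0 \<Longrightarrow> lapse_sq m differentiable (at x)"
  unfolding lapse_sq_def[abs_def] by (intro derivative_intros differentiable_rho) auto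

lemma schwarzschild_nth:
  assumes "spatial p \<noteq> 0"
  shows "schwarzschild m p $ 1 $ 1 = - lapse_sq m (spatial p)"
    "schwarzschild m p $ 1 $ spatial_index i = 0" "schwarzschild m p $ spatial_index i $ 1 = 0"
    "schwarzschild m p $ spatial_index i $ spatial_index j = spatial_metric m (spatial p) $ i $ j"
proof -
  define x where "x = spatial p"
  define u where "u = x /\<^sub>R norm x"
  have x: "x \<noteq> 0" using assms by (simp add: x_def)
  have uu: "u \<bullet> u = 1" using x by (simp add: u_def dot_square_norm power2_eq_square)
  have form: "schwarzschild_form m p v w = - lapse_sq m x * (v $ 1 * w $ 1) +
      1 / lapse_sq m x * ((u \<bullet> spatial v) * (u \<bullet> spatial w)) +
      (spatial v - (u \<bullet> spatial v) *\<^sub>R u) \<bullet> (spatial w - (u \<bullet> spatial w) *\<^sub>R u)" for v w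
    unfolding schwarzschild_form_def Let_def x_def[symmetric] u_def[symmetric] lapse_sq_eq[OF x]
    by (simp add: inverse_eq_divide)
  show "schwarzschild m p $ 1 $ 1 = - lapse_sq m (spatial p)"
    by (simp add: schwarzschild_def form x_def)
  show "schwarzschild m p $ 1 $ spatial_index i = 0" "schwarzschild m p $ spatial_index i $ 1 = 0"
    by (simp_all add: schwarzschild_def form, simp_all add: axis_def)
  have "axis i 1 \<bullet> (axis j 1 :: real^3) = (if i = j then 1 else 0)"
    by (simp add: inner_axis_axis)
  moreover have "axis i 1 \<bullet> u = u $ i" for i by (simp add: inner_commute inner_axis)
  ultimately have "schwarzschild m p $ spatial_index i $ spatial_index j = 1 / lapse_sq m x * (u $ i * u $ j) +
      ((if i = j then 1 else 0) - u $ i * u $ j)"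
    by (simp add: schwarzschild_def form inner_diff_left inner_diff_right uu inner_axis)
       (simp add: axis_def)
  then show "schwarzschild m p $ spatial_index i $ spatial_index j = spatial_metric m (spatial p) $ i $ j"
    using x by (simp add: spatial_metric_def x_def[symmetric] u_def rho_0_inverse field_simps power2_eq_square)
qed

lemma sum_delta_mult:
  fixes F :: "'n::finite \<Rightarrow> real"
  shows "(\<Sum>j\<in>UNIV. (if i = j then 1 else 0) * F j) = F i" "(\<Sum>j\<in>UNIV. F j * (if i = j then 1 else 0)) = F i"
    "(\<Sum>j\<in>UNIV. F j * (if i = j then 1 else 0) * G j) = F i * G i"
    "(\<Sum>j\<in>UNIV. F j * (if i = j then 1 else 0) / c) = F i / c"
    "(\<Sum>j\<in>UNIV. (if i = j then 1 else 0) * F j / c) = F i / c"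
    "(\<Sum>j\<in>UNIV. F j * ((if i = j then 1 else 0) * G j)) = F i * G i"
    "(\<Sum>j\<in>UNIV. F j * ((if i = j then 1 else 0) * G j) / c) = F i * G i / c"
    "(\<Sum>j\<in>UNIV. (if i = j then 1 else 0)) = (1 :: real)"
    "(\<Sum>j\<in>UNIV. F j * (G j * (if i = j then 1 else 0)) / c) = F i * G i / c"
proof -
  have *: "(\<Sum>j\<in>UNIV. if i = j then F j else 0) = F i" for F :: "'n \<Rightarrow> real" by simp
  show "(\<Sum>j\<in>UNIV. (if i = j then 1 else 0) * F j) = F i" "(\<Sum>j\<in>UNIV. F j * (if i = j then 1 else 0)) = F i"
    "(\<Sum>j\<in>UNIV. F j * (if i = j then 1 else 0) * G j) = F i * G i"
    "(\<Sum>j\<in>UNIV. F j * (if i = j then 1 else 0) / c) = F i / c"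
    "(\<Sum>j\<in>UNIV. (if i = j then 1 else 0) * F j / c) = F i / c"
    "(\<Sum>j\<in>UNIV. F j * ((if i = j then 1 else 0) * G j)) = F i * G i"
    "(\<Sum>j\<in>UNIV. F j * ((if i = j then 1 else 0) * G j) / c) = F i * G i / c"
    "(\<Sum>j\<in>UNIV. (if i = j then 1 else 0)) = (1 :: real)"
    "(\<Sum>j\<in>UNIV. F j * (G j * (if i = j then 1 else 0)) / c) = F i * G i / c"
    by (subst *[symmetric], rule sum.cong; simp)+
qed

lemma metric_apply_schwarzschild:
  assumes "spatial p \<noteq> 0"
  shows "metric_apply (schwarzschild m p) v w = - lapse_sq m (spatial p) * v $ 1 * w $ 1 +
    (\<Sum>i\<in>UNIV. \<Sum>j\<in>UNIV. spatial_metric m (spatial p) $ i $ j * v $ spatial_index i * w $ spatial_index j)"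
  by (simp add: metric_apply_def sum_spatial_index schwarzschild_nth[OF assms])

text \<open>Matrices I + a x x^T multiply within their own family, so inverting the slice metric
  becomes an identity between scalars.\<close>

lemma sum_rank_one:
  fixes x :: "real ^ 'n::finite"
  shows "(\<Sum>k\<in>UNIV. ((if i = k then 1 else 0) + a * (x $ i * x $ k)) *
      ((if k = j then 1 else 0) + b * (x $ k * x $ j))) =
    (if i = j then 1 else 0) + (a + b + a * b * (norm x)\<^sup>2) * (x $ i * x $ j)"
proof -
  have "(\<Sum>k\<in>UNIV. ((if i = k then 1 else 0) + a * (x $ i * x $ k)) *
      ((if k = j then 1 else 0) + b * (x $ k * x $ j))) =
    (\<Sum>k\<in>UNIV. (if i = k then (if k = j then 1 else 0) + b * (x $ k * x $ j) else 0) +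
      (if k = j then a * (x $ i * x $ k) else 0) + a * b * (x $ i * x $ j) * (x $ k * x $ k))"
    by (rule sum.cong) (auto simp: algebra_simps)
  also have "\<dots> = (if i = j then 1 else 0) + b * (x $ i * x $ j) + a * (x $ i * x $ j) +
      a * b * (x $ i * x $ j) * (norm x)\<^sup>2"
    unfolding norm_sq_eq_sum sum_distrib_left by (simp add: sum.distrib)
  also have "\<dots> = (if i = j then 1 else 0) + (a + b + a * b * (norm x)\<^sup>2) * (x $ i * x $ j)"
    by (simp add: algebra_simps)
  finally show ?thesis .
qed

lemma lapse_sq_pos: "m > 0 \<Longrightarrow> norm x > 2 * m \<Longrightarrow> lapse_sq m x > 0"
  by (subst lapse_sq_eq) (auto simp: divide_less_eq)

lemma spatial_metric_spatial_metric_inv: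
  assumes "x \<noteq> 0" "lapse_sq m x \<noteq> 0"
  shows "(\<Sum>k\<in>UNIV. spatial_metric m x $ i $ k * spatial_metric_inv m x $ k $ j) = (if i = j then 1 else 0)"
proof -
  have "norm x \<noteq> 0" using assms by simp
  have s: "2 * m / norm x = 1 - lapse_sq m x" by (simp add: lapse_sq_eq[OF assms(1)])
  have "(1 / lapse_sq m x - 1) * rho 0 (-1) x + (- 2 * m * rho 0 (-3/2) x) +
    (1 / lapse_sq m x - 1) * rho 0 (-1) x * (- 2 * m * rho 0 (-3/2) x) * (norm x)\<^sup>2 =
    ((1 / lapse_sq m x - 1) * (1 - 2 * m / norm x) - 2 * m / norm x) / (norm x)\<^sup>2"
    using \<open>norm x \<noteq> 0\<close> assms(2) unfolding rho_0_inverse[OF assms(1)]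
    by (simp add: field_simps power2_eq_square power3_eq_cube)
  also have "\<dots> = 0"
    using assms(2) unfolding lapse_sq_eq[OF assms(1), symmetric] s by (simp add: algebra_simps)
  finally show ?thesis
    unfolding spatial_metric_def spatial_metric_inv_def using sum_rank_one[of i "(1 / lapse_sq m x - 1) * rho 0 (-1) x" x j "- 2 * m * rho 0 (-3/2) x"]
    by simp
qed

lemma spatial_metric_sym: "spatial_metric m x $ i $ j = spatial_metric m x $ j $ i" and spatial_metric_inv_sym: "spatial_metric_inv m x $ i $ j = spatial_metric_inv m x $ j $ i"
  by (auto simp: spatial_metric_def spatial_metric_inv_def)

lemma matrix_inv_spatial_metric: "x \<noteq> 0 \<Longrightarrow> lapse_sq m x \<noteq> 0 \<Longrightarrow> matrix_inv (spatial_metric m x) = spatial_metric_inv m x"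
  by (rule matrix_inv_eqI) (rule spatial_metric_spatial_metric_inv)

lemma matrix_inv_schwarzschild:
  assumes "spatial p \<noteq> 0" "lapse_sq m (spatial p) \<noteq> 0"
  shows "matrix_inv (schwarzschild m p) $ 1 $ 1 = - 1 / lapse_sq m (spatial p)"
    "matrix_inv (schwarzschild m p) $ 1 $ spatial_index i = 0"
    "matrix_inv (schwarzschild m p) $ spatial_index i $ 1 = 0"
    "matrix_inv (schwarzschild m p) $ spatial_index i $ spatial_index j = spatial_metric_inv m (spatial p) $ i $ j"
proof -
  define B :: "real ^ 4 ^ 4" where "B = (\<chi> a b. if a = 1 then (if b = 1 then - 1 / lapse_sq m (spatial p) else 0)
      else if b = 1 then 0 else spatial_metric_inv m (spatial p) $ inv spatial_index a $ inv spatial_index b)"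
  have "inj spatial_index" by (simp add: inj_def)
  then have B: "B $ 1 $ 1 = - 1 / lapse_sq m (spatial p)" "B $ 1 $ spatial_index i = 0" "B $ spatial_index i $ 1 = 0"
    "B $ spatial_index i $ spatial_index j = spatial_metric_inv m (spatial p) $ i $ j" for i j
    by (simp_all add: B_def)
  have "matrix_inv (schwarzschild m p) = B"
  proof (rule matrix_inv_eqI)
    fix a b
    show "(\<Sum>k\<in>UNIV. schwarzschild m p $ a $ k * B $ k $ b) = (if a = b then 1 else 0)"
      by (cases a rule: spatial_index_cases; cases b rule: spatial_index_cases)
        (simp_all add: sum_spatial_index B schwarzschild_nth[OF assms(1)] assms spatial_metric_spatial_metric_inv[OF assms])
  qed
  with B show "matrix_inv (schwarzschild m p) $ 1 $ 1 = - 1 / lapse_sq m (spatial p)"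
    "matrix_inv (schwarzschild m p) $ 1 $ spatial_index i = 0"
    "matrix_inv (schwarzschild m p) $ spatial_index i $ 1 = 0"
    "matrix_inv (schwarzschild m p) $ spatial_index i $ spatial_index j = spatial_metric_inv m (spatial p) $ i $ j"
    by simp_all
qed

lemma pd_schwarzschild:
  assumes "spatial p \<noteq> 0"
  shows "pd 1 (\<lambda>y. schwarzschild m y $ a $ b) p = 0"
    "pd c (\<lambda>y. schwarzschild m y $ 1 $ spatial_index i) p = 0"
    "pd c (\<lambda>y. schwarzschild m y $ spatial_index i $ 1) p = 0"
    "pd (spatial_index k) (\<lambda>y. schwarzschild m y $ 1 $ 1) p = - pd k (lapse_sq m) (spatial p)"
    "pd (spatial_index k) (\<lambda>y. schwarzschild m y $ spatial_index i $ spatial_index j) p = pd k (\<lambda>y. spatial_metric m y $ i $ j) (spatial p)"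
proof -
  have "open {y. spatial y \<noteq> 0}"
    by (intro open_Collect_neq continuous_on_const continuous_spatial)
  then have ev: "\<forall>\<^sub>F y in nhds p. spatial y \<noteq> 0"
    using assms eventually_nhds by auto
  have 1: "\<forall>\<^sub>F y in nhds p. schwarzschild m y $ 1 $ 1 = - lapse_sq m (spatial y)"
    using ev by eventually_elim (rule schwarzschild_nth)
  have 2: "\<forall>\<^sub>F y in nhds p. schwarzschild m y $ 1 $ spatial_index i = 0" for i
    using ev by eventually_elim (rule schwarzschild_nth)
  have 3: "\<forall>\<^sub>F y in nhds p. schwarzschild m y $ spatial_index i $ 1 = 0" for i
    using ev by eventually_elim (rule schwarzschild_nth)
  have 4: "\<forall>\<^sub>F y in nhds p. schwarzschild m y $ spatial_index i $ spatial_index j = spatial_metric m (spatial y) $ i $ j" for i j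
    using ev by eventually_elim (rule schwarzschild_nth)
  have "pd k (\<lambda>x. - lapse_sq m x) (spatial p) = - pd k (lapse_sq m) (spatial p)" for k
    using pd_cmult[OF differentiable_lapse_sq[OF assms], of k "-1" m] by simp
  then show 5: "pd (spatial_index k) (\<lambda>y. schwarzschild m y $ 1 $ 1) p = - pd k (lapse_sq m) (spatial p)"
    by (simp add: pd_cong_nhds[OF 1] pd_spatial(2)[of k "\<lambda>x. - lapse_sq m x"])
  show 6: "pd c (\<lambda>y. schwarzschild m y $ 1 $ spatial_index i) p = 0"
    "pd c (\<lambda>y. schwarzschild m y $ spatial_index i $ 1) p = 0" for i
    by (simp_all add: pd_cong_nhds[OF 2] pd_cong_nhds[OF 3])
  show "pd (spatial_index k) (\<lambda>y. schwarzschild m y $ spatial_index i $ spatial_index j) p = pd k (\<lambda>y. spatial_metric m y $ i $ j) (spatial p)"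
    by (simp add: pd_cong_nhds[OF 4] pd_spatial(2)[of k "\<lambda>x. spatial_metric m x $ i $ j"])
  show "pd 1 (\<lambda>y. schwarzschild m y $ a $ b) p = 0"
    by (cases a rule: spatial_index_cases; cases b rule: spatial_index_cases)
      (simp_all add: pd_cong_nhds[OF 1] pd_cong_nhds[OF 2] pd_cong_nhds[OF 3] pd_cong_nhds[OF 4]
        pd_spatial(1)[of "\<lambda>x. - lapse_sq m x"] pd_spatial(1)[of "\<lambda>x. spatial_metric m x $ i $ j" for i j])
qed

text \<open>The metric is block diagonal and independent of t, so symbols with an odd number of time
  indices vanish, and those without a time index belong to the slice metric.\<close>

lemma christoffel_schwarzschild:
  assumes "spatial p \<noteq> 0" "lapse_sq m (spatial p) \<noteq> 0"
  shows "christoffel (schwarzschild m) 1 1 1 p = 0"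
    "christoffel (schwarzschild m) 1 1 (spatial_index i) p = pd i (lapse_sq m) (spatial p) / (2 * lapse_sq m (spatial p))"
    "christoffel (schwarzschild m) 1 (spatial_index i) 1 p = pd i (lapse_sq m) (spatial p) / (2 * lapse_sq m (spatial p))"
    "christoffel (schwarzschild m) 1 (spatial_index i) (spatial_index j) p = 0"
    "christoffel (schwarzschild m) (spatial_index k) 1 1 p =
      (1/2) * (\<Sum>l\<in>UNIV. spatial_metric_inv m (spatial p) $ k $ l * pd l (lapse_sq m) (spatial p))"
    "christoffel (schwarzschild m) (spatial_index k) 1 (spatial_index j) p = 0"
    "christoffel (schwarzschild m) (spatial_index k) (spatial_index i) 1 p = 0"
    "christoffel (schwarzschild m) (spatial_index k) (spatial_index i) (spatial_index j) p = christoffel (spatial_metric m) k i j (spatial p)"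
  by (simp_all add: christoffel_def sum_spatial_index matrix_inv_schwarzschild[OF assms]
      pd_schwarzschild[OF assms(1)] matrix_inv_spatial_metric[OF assms])

section \<open>Graphs over the exterior\<close>

lemma tangent_nth: "tangent f i x $ 1 = pd i f x" "tangent f i x $ spatial_index j = (if i = j then 1 else 0)"
  by (simp_all add: tangent_def)

lemma induced_metric_nth:
  assumes "x \<noteq> 0"
  shows "induced_metric m f x $ i $ j = spatial_metric m x $ i $ j - lapse_sq m x * pd i f x * pd j f x"
  using assms by (simp add: induced_metric_def metric_apply_schwarzschild tangent_nth sum_delta_mult)

definition grad :: "real \<Rightarrow> (real ^ 3 \<Rightarrow> real) \<Rightarrow> 3 \<Rightarrow> real ^ 3 \<Rightarrow> real" where
  "grad m f i x = (\<Sum>j\<in>UNIV. spatial_metric_inv m x $ i $ j * pd j f x)"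

text \<open>This is \<open>- |dt - df|\<^sup>2\<close>, so that its square root normalizes the conormal \<open>dt - df\<close> of the graph.\<close>

definition wsq :: "real \<Rightarrow> (real ^ 3 \<Rightarrow> real) \<Rightarrow> real ^ 3 \<Rightarrow> real" where
  "wsq m f x = 1 / lapse_sq m x - (\<Sum>i\<in>UNIV. pd i f x * grad m f i x)"

lemma spatial_metric_grad:
  assumes "x \<noteq> 0" "lapse_sq m x \<noteq> 0"
  shows "(\<Sum>j\<in>UNIV. spatial_metric m x $ i $ j * grad m f j x) = pd i f x"
proof -
  have "(\<Sum>j\<in>UNIV. spatial_metric m x $ i $ j * grad m f j x) =
      (\<Sum>l\<in>UNIV. (\<Sum>j\<in>UNIV. spatial_metric m x $ i $ j * spatial_metric_inv m x $ j $ l) * pd l f x)"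
    unfolding grad_def sum_distrib_left sum_distrib_right by (subst sum.swap) (simp add: mult.assoc)
  also have "\<dots> = pd i f x" by (simp add: spatial_metric_spatial_metric_inv[OF assms] sum_delta_mult)
  finally show ?thesis .
qed

text \<open>This is the Sherman-Morrison formula: the induced metric is the slice metric minus the
  rank-one term \<open>lapse_sq\<close> df df. The denominator 1 - \<open>lapse_sq\<close> |df|^2,
  divided by \<open>lapse_sq\<close>, is \<open>wsq\<close>.\<close>

lemma matrix_inv_induced_metric:
  assumes "x \<noteq> 0" "lapse_sq m x \<noteq> 0" "wsq m f x \<noteq> 0"
  shows "matrix_inv (induced_metric m f x) =
    (\<chi> i j. spatial_metric_inv m x $ i $ j + 1 / wsq m f x * (grad m f i x * grad m f j x))"
proof (rule matrix_inv_eqI)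
  fix i j
  let ?N = "\<Sum>i\<in>UNIV. pd i f x * grad m f i x"
  let ?t = "1 / wsq m f x"
  have "(\<Sum>k\<in>UNIV. induced_metric m f x $ i $ k *
      (\<chi> i j. spatial_metric_inv m x $ i $ j + ?t * (grad m f i x * grad m f j x)) $ k $ j) =
    (\<Sum>k\<in>UNIV. spatial_metric m x $ i $ k * spatial_metric_inv m x $ k $ j) +
    ?t * grad m f j x * (\<Sum>k\<in>UNIV. spatial_metric m x $ i $ k * grad m f k x) -
    lapse_sq m x * pd i f x * (\<Sum>k\<in>UNIV. spatial_metric_inv m x $ j $ k * pd k f x) -
    lapse_sq m x * ?t * pd i f x * grad m f j x * ?N"
    unfolding sum_distrib_left sum_distrib_right sum.distrib[symmetric] sum_subtractf[symmetric]
    by (rule sum.cong) (simp_all add: induced_metric_nth assms spatial_metric_inv_sym[of m x j] algebra_simps)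
  also have "\<dots> = (if i = j then 1 else 0) +
      pd i f x * grad m f j x * (?t - lapse_sq m x - lapse_sq m x * ?t * ?N)"
    unfolding grad_def[symmetric] spatial_metric_spatial_metric_inv[OF assms(1,2)] spatial_metric_grad[OF assms(1,2)]
    by (simp add: algebra_simps)
  also have "?t - lapse_sq m x - lapse_sq m x * ?t * ?N = ?t * (1 - lapse_sq m x * wsq m f x - lapse_sq m x * ?N)"
    using assms by (simp add: field_simps)
  also have "1 - lapse_sq m x * wsq m f x - lapse_sq m x * ?N = 0"
    using assms unfolding wsq_def by (simp add: algebra_simps)
  finally show "(\<Sum>k\<in>UNIV. induced_metric m f x $ i $ k *
      (\<chi> i j. spatial_metric_inv m x $ i $ j + ?t * (grad m f i x * grad m f j x)) $ k $ j) =
      (if i = j then 1 else 0)" by simp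
qed

text \<open>Orthogonality to the tangent fields determines the spatial part of a normal v as
  \<open>lapse_sq\<close> v^0 grad f, which leaves one scalar. Normalization fixes it up to sign,
  and the sign of the product with d/dt selects one. Existence and uniqueness together resolve the
  \<open>THE\<close>.\<close>

lemma future_unit_normal_nth:
  assumes x: "x \<noteq> 0" and lapse_sq: "lapse_sq m x > 0" and W: "wsq m f x > 0"
  shows "lapse_sq m x * future_unit_normal m f x $ 1 = 1 / sqrt (wsq m f x)"
    "future_unit_normal m f x $ spatial_index i = grad m f i x / sqrt (wsq m f x)"
proof -
  define W where "W = sqrt (wsq m f x)"
  define N where "N = (\<Sum>i\<in>UNIV. pd i f x * grad m f i x)"
  have W2: "W * W = 1 / lapse_sq m x - N" and Wpos: "W > 0"
    using W by (simp_all add: W_def wsq_def N_def)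
  define \<nu> :: "real ^ 4" where "\<nu> = (\<chi> a. if a = 1 then 1 / (lapse_sq m x * W) else grad m f (inv spatial_index a) x / W)"
  have "inj spatial_index" by (simp add: inj_def)
  then have \<nu>: "\<nu> $ 1 = 1 / (lapse_sq m x * W)" "\<nu> $ spatial_index i = grad m f i x / W" for i
    by (simp_all add: \<nu>_def)
  have lapse_ne: "lapse_sq m x \<noteq> 0" using lapse_sq by simp
  let ?G = "schwarzschild m (graph_point f x)"
  have G: "metric_apply ?G v w = - lapse_sq m x * v $ 1 * w $ 1 +
      (\<Sum>i\<in>UNIV. w $ spatial_index i * (\<Sum>j\<in>UNIV. spatial_metric m x $ i $ j * v $ spatial_index j))" for v w
    using x by (simp add: metric_apply_schwarzschild)
      (subst sum.swap, simp add: sum_distrib_left spatial_metric_sym[of m x] mult_ac)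
  have orth: "metric_apply ?G v (tangent f i x) = - lapse_sq m x * v $ 1 * pd i f x +
      (\<Sum>j\<in>UNIV. spatial_metric m x $ i $ j * v $ spatial_index j)" for v i
    by (simp add: G tangent_nth sum_delta_mult)
  have time: "metric_apply ?G v (axis 1 1) = - lapse_sq m x * v $ 1" for v
    by (simp add: G) (simp add: axis_def)
  have scaled: "(\<Sum>j\<in>UNIV. spatial_metric m x $ i $ j * (c * grad m f j x)) = c * pd i f x" for i c
    using spatial_metric_grad[OF x lapse_ne, of i f] by (simp add: sum_distrib_left mult_ac flip: sum_distrib_left)
  have normsq: "metric_apply ?G v v = (lapse_sq m x * v $ 1)\<^sup>2 * (N - 1 / lapse_sq m x)"
    if "\<And>i. v $ spatial_index i = lapse_sq m x * v $ 1 * grad m f i x" for v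
  proof -
    have "metric_apply ?G v v = - lapse_sq m x * v $ 1 * v $ 1 +
        (\<Sum>i\<in>UNIV. lapse_sq m x * v $ 1 * grad m f i x * (lapse_sq m x * v $ 1 * pd i f x))"
      by (simp only: G that scaled)
    then have "metric_apply ?G v v = - lapse_sq m x * (v $ 1)\<^sup>2 + (lapse_sq m x * v $ 1)\<^sup>2 * N"
      by (simp add: N_def sum_distrib_left power2_eq_square mult_ac)
    moreover have "lapse_sq m x * (v $ 1)\<^sup>2 = (lapse_sq m x * v $ 1)\<^sup>2 * (1 / lapse_sq m x)"
      using lapse_sq by (simp add: power2_eq_square)
    ultimately show ?thesis by (simp add: right_diff_distrib)
  qed
  have eq: "future_unit_normal m f x = \<nu>"
    unfolding future_unit_normal_def Let_def
  proof (rule the_equality)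
    have "(lapse_sq m x * \<nu> $ 1)\<^sup>2 * (W * W) = 1"
      using Wpos lapse_sq by (simp add: \<nu> power2_eq_square)
    then have "metric_apply ?G \<nu> \<nu> = - 1"
      using normsq[of \<nu>] lapse_sq unfolding W2 by (simp add: \<nu> algebra_simps)
    moreover have "metric_apply ?G \<nu> (tangent f i x) = 0" for i
      using scaled[of i "1 / W"] lapse_sq by (simp add: orth \<nu>)
    moreover have "metric_apply ?G \<nu> (axis 1 1) < 0" using lapse_sq Wpos by (simp add: time \<nu>)
    ultimately show "metric_apply ?G \<nu> \<nu> = - 1 \<and>
        (\<forall>i. metric_apply ?G \<nu> (tangent f i x) = 0) \<and> metric_apply ?G \<nu> (axis 1 1) < 0" by blast
  next
    fix v assume v: "metric_apply ?G v v = - 1 \<and>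
        (\<forall>i. metric_apply ?G v (tangent f i x) = 0) \<and> metric_apply ?G v (axis 1 1) < 0"
    then have g: "(\<Sum>j\<in>UNIV. spatial_metric m x $ i $ j * v $ spatial_index j) = lapse_sq m x * v $ 1 * pd i f x" for i
      by (simp add: orth)
    have sp: "v $ spatial_index k = lapse_sq m x * v $ 1 * grad m f k x" for k
    proof -
      have "v $ spatial_index k = (\<Sum>j\<in>UNIV. (if k = j then 1 else 0) * v $ spatial_index j)" by (simp add: sum_delta_mult)
      also have "\<dots> = (\<Sum>j\<in>UNIV. (\<Sum>i\<in>UNIV. spatial_metric m x $ j $ i * spatial_metric_inv m x $ i $ k) * v $ spatial_index j)"
        by (simp add: spatial_metric_spatial_metric_inv[OF x lapse_ne] eq_commute)
      also have "\<dots> = (\<Sum>i\<in>UNIV. spatial_metric_inv m x $ k $ i * (\<Sum>j\<in>UNIV. spatial_metric m x $ i $ j * v $ spatial_index j))"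
        unfolding sum_distrib_left sum_distrib_right
        by (subst sum.swap) (simp add: spatial_metric_sym[of m x] spatial_metric_inv_sym[of m x k] mult_ac)
      also have "\<dots> = lapse_sq m x * v $ 1 * grad m f k x"
        unfolding g by (simp add: grad_def sum_distrib_left mult_ac)
      finally show ?thesis .
    qed
    have pos: "lapse_sq m x * v $ 1 > 0" using v by (simp add: time)
    have "(lapse_sq m x * v $ 1)\<^sup>2 * (W * W) = 1"
      using v normsq[OF sp] unfolding W2 by (simp add: algebra_simps)
    then have "(lapse_sq m x * v $ 1 * W)\<^sup>2 = 1\<^sup>2" by (simp add: power2_eq_square mult_ac)
    then have *: "lapse_sq m x * v $ 1 * W = 1"
      using pos Wpos by (subst (asm) power2_eq_iff_nonneg) auto
    then have **: "lapse_sq m x * v $ 1 = 1 / W" using Wpos by (simp add: field_simps)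
    have "v $ a = \<nu> $ a" for a
    proof (cases a rule: spatial_index_cases)
      case 1 then show ?thesis using * lapse_sq Wpos by (simp add: \<nu> field_simps)
    next
      case (2 i) then show ?thesis using sp[of i] unfolding ** by (simp add: \<nu>)
    qed
    then show "v = \<nu>" by (simp add: vec_eq_iff)
  qed
  show "lapse_sq m x * future_unit_normal m f x $ 1 = 1 / sqrt (wsq m f x)"
    "future_unit_normal m f x $ spatial_index i = grad m f i x / sqrt (wsq m f x)"
    using lapse_sq by (simp_all add: eq \<nu> W_def)
qed

text \<open>Lowering the index of the normal gives -(dt - df)/W with W = sqrt(\<open>wsq\<close>),
  because the lapse factor cancels and the slice metric turns grad f back into df. Hence -<nu, A> =
  (A^0 - df(A))/W for the ambient derivative A.\<close>

lemma second_fundamental_form_nth: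
  assumes x: "x \<noteq> 0" and lapse_sq: "lapse_sq m x > 0" and W: "wsq m f x > 0"
  shows "second_fundamental_form m f x $ i $ j =
    wsq m f x powr (-1/2) * (pd i (pd j f) x
      + (pd i (lapse_sq m) x * pd j f x + pd j (lapse_sq m) x * pd i f x) / (2 * lapse_sq m x)
      - (\<Sum>l\<in>UNIV. pd l f x * (christoffel (spatial_metric m) l i j x + grad m (lapse_sq m) l x / 2 * (pd i f x * pd j f x))))"
proof -
  let ?A = "ambient_derivative m f i j x"
  let ?W = "sqrt (wsq m f x)"
  have lapse_ne: "lapse_sq m x \<noteq> 0" using lapse_sq by simp
  have c: "spatial (graph_point f x) \<noteq> 0" "lapse_sq m (spatial (graph_point f x)) \<noteq> 0"
    using x lapse_sq by auto
  have t: "(\<lambda>y. tangent f j y $ 1) = pd j f" "(\<lambda>y. tangent f j y $ spatial_index l) = (\<lambda>y. if j = l then 1 else 0)" for l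
    by (auto simp: tangent_nth)
  have A1: "?A $ 1 = pd i (pd j f) x + (pd i (lapse_sq m) x * pd j f x + pd j (lapse_sq m) x * pd i f x) / (2 * lapse_sq m x)"
    by (simp add: ambient_derivative_def t sum_spatial_index christoffel_schwarzschild[OF c] tangent_nth add_divide_distrib sum_delta_mult mult_ac)
  have Al: "?A $ spatial_index l = christoffel (spatial_metric m) l i j x + grad m (lapse_sq m) l x / 2 * (pd i f x * pd j f x)" for l
    by (simp add: ambient_derivative_def t sum_spatial_index christoffel_schwarzschild[OF c] tangent_nth grad_def
        sum_delta_mult)
  have "second_fundamental_form m f x $ i $ j =
     lapse_sq m x * future_unit_normal m f x $ 1 * ?A $ 1 -
     (\<Sum>k\<in>UNIV. \<Sum>l\<in>UNIV. spatial_metric m x $ k $ l * (grad m f k x / ?W) * ?A $ spatial_index l)"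
    using x by (simp add: second_fundamental_form_def metric_apply_schwarzschild
        future_unit_normal_nth(2)[OF assms])
  also have "(\<Sum>k\<in>UNIV. \<Sum>l\<in>UNIV. spatial_metric m x $ k $ l * (grad m f k x / ?W) * ?A $ spatial_index l) =
      (\<Sum>l\<in>UNIV. (\<Sum>k\<in>UNIV. spatial_metric m x $ l $ k * grad m f k x) * ?A $ spatial_index l) / ?W"
    unfolding sum_distrib_right sum_divide_distrib
    by (subst sum.swap) (simp add: spatial_metric_sym[of m x])
  also have "\<dots> = (\<Sum>l\<in>UNIV. pd l f x * ?A $ spatial_index l) / ?W"
    by (simp add: spatial_metric_grad[OF x lapse_ne])
  finally show ?thesis
    using W unfolding future_unit_normal_nth(1)[OF assms] A1 Al
    by (simp add: powr_minus_divide powr_half_sqrt diff_divide_distrib right_diff_distrib)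
qed

section \<open>Asymptotics of the Schwarzschild metric\<close>

lemma symbol_pd_diff:
  assumes "symbol a (\<lambda>x. F x - H x)" "symbol b H"
  shows "symbol (a - 1) (\<lambda>x. pd i F x - pd i H x)"
proof (rule symbol_cong[OF symbol_pd[OF assms(1), of i]])
  show "\<forall>\<^sub>F x in at_infinity. pd i (\<lambda>x. F x - H x) x = pd i F x - pd i H x"
    using symbol_differentiable[OF assms(1)] symbol_differentiable[OF assms(2)]
  proof eventually_elim
    case (elim x)
    have "(\<lambda>x. (F x - H x) + H x) differentiable (at x)" by (rule differentiable_add[OF elim])
    with elim show ?case by (simp add: pd_diff)
  qed
qed

lemma symbol_of_diff: "symbol a (\<lambda>x. F x - H x) \<Longrightarrow> symbol a H \<Longrightarrow> symbol a F"
  using symbol_add[of a "\<lambda>x. F x - H x" H] by simp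

lemma rho_mult: "rho L a x * rho L b x = rho L (a + b) x"
  by (simp add: rho_def powr_add)

lemma norm_sq_rho: "x \<noteq> 0 \<Longrightarrow> (norm x)\<^sup>2 * rho 0 s x = rho 0 (s + 1) x"
proof -
  assume "x \<noteq> 0"
  then have "(norm x)\<^sup>2 = rho 0 1 x" by (simp add: rho_0)
  then show ?thesis by (simp add: rho_mult add.commute)
qed

lemma symbol_limit_0_add:
  assumes "symbol a (\<lambda>x. u x - c)" "a < 0"
  shows "(u \<longlongrightarrow> c) at_infinity" "symbol 0 u"
  using symbol_tendsto_0[OF assms] assms
  by (simp_all add: LIM_zero_iff symbol_of_diff[OF symbol_weaken symbol_const])

lemma eventually_nonzero: "\<forall>\<^sub>F x :: real ^ 'n::finite in at_infinity. x \<noteq> 0"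
  by (rule eventually_not_equal_at_infinity)

text \<open>The r^(-1) part of the slice metric minus the identity. The graph changes the metric
  only from order r^(-4/3) on, so the induced metric has the same leading part.\<close>

definition mass_term :: "real \<Rightarrow> 3 \<Rightarrow> 3 \<Rightarrow> real ^ 3 \<Rightarrow> real" where
  "mass_term m i j x = 2 * m * (x $ i * x $ j * rho 0 (-3/2) x)"

text \<open>The Christoffel symbols of identity plus \<open>mass_term\<close>, linearized at the
  flat metric; \<open>k\<close> is the upper index.\<close>

definition mass_christoffel :: "real \<Rightarrow> 3 \<Rightarrow> 3 \<Rightarrow> 3 \<Rightarrow> real ^ 3 \<Rightarrow> real" where
  "mass_christoffel m k i j x = 2 * m * ((if i = j then 1 else 0) * (x $ k * rho 0 (-3/2) x)
     - 3/2 * (x $ i * x $ j * x $ k * rho 0 (-5/2) x))"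

lemma symbol_xr: "1 + 2 * s \<le> a \<Longrightarrow> symbol a (\<lambda>x. x $ i * rho L s x)"
  by (rule symbol_mult[OF symbol_coord[of 1] symbol_rho]) auto

lemma symbol_xxr: "2 + 2 * s \<le> a \<Longrightarrow> symbol a (\<lambda>x. x $ i * x $ j * rho L s x)"
  by (rule symbol_mult[OF symbol_mult[OF symbol_coord[of 1] symbol_coord[of 1], of 2] symbol_rho[of s]]) auto

lemma symbol_xxxr: "3 + 2 * s \<le> a \<Longrightarrow> symbol a (\<lambda>x. x $ i * x $ j * x $ k * rho L s x)"
  by (rule symbol_mult[OF symbol_mult[OF symbol_mult[OF symbol_coord[of 1] symbol_coord[of 1], of 2]
        symbol_coord[of 1], of 3] symbol_rho[of s]]) auto

lemma symbol_mass_term: "symbol (-1) (mass_term m i j)"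
  unfolding mass_term_def[abs_def] by (intro symbol_cmult symbol_xxr) simp

lemma symbol_mass_christoffel: "symbol (-2) (mass_christoffel m k i j)"
  unfolding mass_christoffel_def[abs_def] by (intro symbol_cmult symbol_diff symbol_xr symbol_xxxr) simp_all

lemma
  assumes "x \<noteq> 0 \<or> L \<noteq> 0"
  shows pd_xr: "pd c (\<lambda>x. x $ i * rho L s x) x =
      (if c = i then 1 else 0) * rho L s x + 2 * s * (x $ i * x $ c * rho L (s - 1) x)"
    and pd_xxr: "pd c (\<lambda>x. x $ i * x $ j * rho L s x) x =
      (if c = i then 1 else 0) * (x $ j * rho L s x) + (if c = j then 1 else 0) * (x $ i * rho L s x)
      + 2 * s * (x $ i * x $ j * x $ c * rho L (s - 1) x)"
    and pd_xxxr: "pd c (\<lambda>x. x $ i * x $ j * x $ k * rho L s x) x =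
      (if c = i then 1 else 0) * (x $ j * x $ k * rho L s x) + (if c = j then 1 else 0) * (x $ i * x $ k * rho L s x)
      + (if c = k then 1 else 0) * (x $ i * x $ j * rho L s x)
      + 2 * s * (x $ i * x $ j * x $ k * x $ c * rho L (s - 1) x)"
  using assms
  by (auto simp: pd_mult differentiable_rho pd_rho differentiable_mult algebra_simps)

lemma pd_mass_term:
  assumes "x \<noteq> 0"
  shows "pd i (\<lambda>x. (if j = l then 1 else 0) + mass_term m j l x) x = 2 * m *
    ((if i = j then 1 else 0) * (x $ l * rho 0 (-3/2) x) + (if i = l then 1 else 0) * (x $ j * rho 0 (-3/2) x)
      - 3 * (x $ j * x $ l * x $ i * rho 0 (-5/2) x))"
proof -
  have d: "(\<lambda>x. x $ j * x $ l * rho 0 (-3/2) x) differentiable (at x)"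
    using assms by (auto intro!: differentiable_mult differentiable_rho)
  have "pd i (\<lambda>x. (if j = l then 1 else 0) + mass_term m j l x) x = 2 * m * pd i (\<lambda>x. x $ j * x $ l * rho 0 (-3/2) x) x"
    unfolding mass_term_def by (subst pd_add) (use d in \<open>auto simp: pd_cmult intro!: differentiable_mult\<close>)
  then show ?thesis using assms by (simp add: pd_xxr)
qed

text \<open>Replacing the inverse metric by the identity costs order -1 times first derivatives of
  order -2, that is -3, hence the bound \<open>e \<le> 2\<close>. The lemma serves the slice metric
  with e = 2 and the induced metric with e = 4/3.\<close>

lemma symbol_christoffel:
  assumes G: "\<And>i j. symbol (-e) (\<lambda>x. G x $ i $ j - ((if i = j then 1 else 0) + mass_term m i j x))"
    and inv: "\<And>i j. symbol (-1) (\<lambda>x. matrix_inv (G x) $ i $ j - (if i = j then 1 else 0))"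
    and e: "1 < e" "e \<le> 2"
  shows "symbol (-e - 1) (\<lambda>x. christoffel G k i j x - mass_christoffel m k i j x)"
proof -
  define H where "H i j = (\<lambda>x. (if i = j then 1 else 0) + mass_term m i j x)" for i j
  define S where "S l = (\<lambda>x. pd i (\<lambda>y. G y $ j $ l) x + pd j (\<lambda>y. G y $ i $ l) x - pd l (\<lambda>y. G y $ i $ j) x)" for l
  define S0 where "S0 l = (\<lambda>x. pd i (H j l) x + pd j (H i l) x - pd l (H i j) x)" for l
  have sH: "symbol 0 (H i j)" for i j
    unfolding H_def by (intro symbol_add symbol_const symbol_weaken[OF symbol_mass_term]) auto
  have diff: "symbol (-e - 1) (\<lambda>x. pd i (\<lambda>y. G y $ j $ l) x - pd i (H j l) x)" for i j l
    by (rule symbol_pd_diff[OF _ sH]) (use G[of j l] in \<open>simp add: H_def\<close>)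
  have SS0: "symbol (-e - 1) (\<lambda>x. S l x - S0 l x)" for l
    using symbol_diff[OF symbol_add[OF diff[of i j l] diff[of j i l]] diff[of l i j]]
    by (simp add: S_def S0_def algebra_simps)
  have S0: "\<forall>\<^sub>F x in at_infinity. S0 l x = 2 * mass_christoffel m l i j x" for l
    using eventually_nonzero
  proof eventually_elim
    case (elim x)
    show ?case unfolding S0_def H_def pd_mass_term[OF elim] mass_christoffel_def
      by (auto simp: algebra_simps)
  qed
  have "symbol (-2) (\<lambda>x. 2 * mass_christoffel m l i j x)" for l by (intro symbol_cmult symbol_mass_christoffel)
  then have "symbol (-2) (S0 l)" for l
    by (rule symbol_cong) (use S0[of l] in \<open>auto elim: eventually_mono\<close>)
  then have sS: "symbol (-2) (S l)" for l
    using e by (intro symbol_of_diff[OF symbol_weaken[OF SS0]]) auto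
  have "symbol (-e - 1) (\<lambda>x. (1/2) * ((\<Sum>l\<in>UNIV. (matrix_inv (G x) $ k $ l - (if k = l then 1 else 0)) * S l x) + (S k x - S0 k x)))"
    using e by (intro symbol_cmult symbol_add symbol_sum symbol_mult[OF inv sS] SS0) auto
  then show ?thesis
  proof (rule symbol_cong)
    show "\<forall>\<^sub>F x in at_infinity. (1/2) * ((\<Sum>l\<in>UNIV. (matrix_inv (G x) $ k $ l - (if k = l then 1 else 0)) * S l x) + (S k x - S0 k x))
        = christoffel G k i j x - mass_christoffel m k i j x"
      using S0[of k]
    proof eventually_elim
      case (elim x)
      show ?case unfolding elim left_diff_distrib sum_subtractf sum_delta_mult
        by (simp add: christoffel_def S_def)
    qed
  qed
qed

lemma mass_christoffel_traces:
  "(\<Sum>i\<in>UNIV. mass_christoffel m k i i x) = 3 * m * (x $ k * rho 0 (-3/2) x)"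
  "(\<Sum>k\<in>UNIV. mass_christoffel m k i k x) = - m * (x $ i * rho 0 (-3/2) x)"
proof -
  have r: "rho 0 (-5/2) x * (\<Sum>i\<in>UNIV. x $ i * x $ i) * x $ k = rho 0 (-3/2) x * x $ k" for k
    using norm_sq_rho[of x "-5/2"] by (cases "x = 0") (auto simp: norm_sq_eq_sum mult_ac)
  have "(\<Sum>i\<in>UNIV. mass_christoffel m k i i x) = 2 * m * (3 * (x $ k * rho 0 (-3/2) x)
      - 3/2 * (rho 0 (-5/2) x * (\<Sum>i\<in>UNIV. x $ i * x $ i) * x $ k))"
    by (simp add: mass_christoffel_def sum_3 algebra_simps)
  then show "(\<Sum>i\<in>UNIV. mass_christoffel m k i i x) = 3 * m * (x $ k * rho 0 (-3/2) x)"
    unfolding r by (simp add: algebra_simps)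
  have "(\<Sum>k\<in>UNIV. mass_christoffel m k i k x) = 2 * m * ((x $ i * rho 0 (-3/2) x)
      - 3/2 * (rho 0 (-5/2) x * (\<Sum>i\<in>UNIV. x $ i * x $ i) * x $ i))"
    by (cases i rule: exhaust_3[THEN disjE]) (auto simp: mass_christoffel_def sum_3 algebra_simps)
  then show "(\<Sum>k\<in>UNIV. mass_christoffel m k i k x) = - m * (x $ i * rho 0 (-3/2) x)"
    unfolding r by (simp add: algebra_simps)
qed

lemma div_xr3: "x \<noteq> 0 \<Longrightarrow> (\<Sum>k\<in>UNIV. pd k (\<lambda>x::real^3. x $ k * rho 0 (-3/2) x) x) = 0"
proof -
  assume x: "x \<noteq> 0"
  have "(\<Sum>k\<in>UNIV. pd k (\<lambda>x::real^3. x $ k * rho 0 (-3/2) x) x) =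
      3 * rho 0 (-3/2) x - 3 * ((norm x)\<^sup>2 * rho 0 (-5/2) x)"
    unfolding norm_sq_eq_sum by (simp add: pd_xr x sum_3 algebra_simps)
  then show ?thesis using norm_sq_rho[OF x, of "-5/2"] by simp
qed

text \<open>The linearized scalar curvature of \<open>mass_term\<close> has order r^(-3), which
  would be too slow for flatness. It vanishes because both traces of \<open>mass_christoffel\<close>
  are multiples of x/r^3, a divergence-free field. There remain the derivative of the Christoffel
  error, of order -10/3, and products of order -4.\<close>

lemma symbol_scalar_curvature:
  assumes G: "\<And>i j. symbol (-4/3) (\<lambda>x. G x $ i $ j - ((if i = j then 1 else 0) + mass_term m i j x))"
    and inv: "\<And>i j. symbol (-1) (\<lambda>x. matrix_inv (G x) $ i $ j - (if i = j then 1 else 0))"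
  shows "symbol (-10/3) (scalar_curvature G)"
proof -
  have C: "symbol (-7/3) (\<lambda>x. christoffel G k i j x - mass_christoffel m k i j x)" for k i j
    using symbol_christoffel[of "4/3" G m k i j] G inv by simp
  have C2: "symbol (-2) (christoffel G k i j)" for k i j
    by (rule symbol_of_diff[OF symbol_weaken[OF C] symbol_mass_christoffel]) simp
  have dC: "symbol (-10/3) (\<lambda>x. pd c (christoffel G k i j) x - pd c (mass_christoffel m k i j) x)" for c k i j
    using symbol_pd_diff[OF C symbol_mass_christoffel] by simp
  define r0 where "r0 i j = (\<lambda>x. \<Sum>k\<in>UNIV. pd k (mass_christoffel m k i j) x - pd j (mass_christoffel m k i k) x)" for i j
  have r: "symbol (-10/3) (\<lambda>x. ricci G i j x - r0 i j x)" for i j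
  proof -
    have "symbol (-10/3) (\<lambda>x. \<Sum>k\<in>UNIV. (pd k (christoffel G k i j) x - pd k (mass_christoffel m k i j) x)
      - (pd j (christoffel G k i k) x - pd j (mass_christoffel m k i k) x)
      + (\<Sum>l\<in>UNIV. christoffel G k k l x * christoffel G l i j x
                      - christoffel G k j l x * christoffel G l i k x))"
      by (intro symbol_sum symbol_add symbol_diff dC symbol_mult[OF C2 C2]) simp_all
    then show ?thesis by (simp add: ricci_def[abs_def] r0_def algebra_simps sum.distrib sum_subtractf)
  qed
  have "symbol (-3) (r0 i j)" for i j
    unfolding r0_def
    by (intro symbol_sum symbol_diff symbol_weaken[OF symbol_pd[OF symbol_mass_christoffel]]) simp_all
  then have r3: "symbol (-3) (ricci G i j)" for i j
    using symbol_weaken[OF r, of "-3"] symbol_of_diff by fastforce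
  have "symbol (-10/3) (\<lambda>x. (\<Sum>i\<in>UNIV. \<Sum>j\<in>UNIV.
      (matrix_inv (G x) $ i $ j - (if i = j then 1 else 0)) * ricci G i j x) +
      (\<Sum>i\<in>UNIV. ricci G i i x - r0 i i x))"
    by (intro symbol_sum symbol_add symbol_mult[OF inv r3] r) simp
  then show ?thesis
  proof (rule symbol_cong)
    have "\<forall>\<^sub>F x in at_infinity. mass_christoffel m k i j differentiable (at x)" for k i j
      by (rule symbol_differentiable[OF symbol_mass_christoffel])
    then have "\<forall>\<^sub>F x in at_infinity. \<forall>k i j. mass_christoffel m k i j differentiable (at x)"
      by (simp add: eventually_all_finite)
    with eventually_nonzero
    show "\<forall>\<^sub>F x in at_infinity. (\<Sum>i\<in>UNIV. \<Sum>j\<in>UNIV.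
      (matrix_inv (G x) $ i $ j - (if i = j then 1 else 0)) * ricci G i j x) +
      (\<Sum>i\<in>UNIV. ricci G i i x - r0 i i x) = scalar_curvature G x"
    proof eventually_elim
      case (elim x)
      have d: "(\<lambda>x. x $ k * rho 0 (-3/2) x) differentiable (at x)" for k
        using elim by (auto intro!: differentiable_mult differentiable_rho)
      have "(\<Sum>i\<in>UNIV. r0 i i x) = (\<Sum>k\<in>UNIV. pd k (\<lambda>x. \<Sum>i\<in>UNIV. mass_christoffel m k i i x) x)
         - (\<Sum>i\<in>UNIV. pd i (\<lambda>x. \<Sum>k\<in>UNIV. mass_christoffel m k i k x) x)"
        unfolding r0_def sum_subtractf
        by (subst sum.swap) (simp add: pd_sum elim(2))
      also have "\<dots> = 0"
        unfolding mass_christoffel_traces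
        by (simp only: pd_cmult[OF d] sum_distrib_left[symmetric] div_xr3[OF elim(1)])
      finally show ?case
        by (simp add: left_diff_distrib sum_subtractf sum_delta_mult scalar_curvature_def)
    qed
  qed
qed

section \<open>Expansion of the lapse and of the slice metric in powers of m/r\<close>

lemma symbol_lapse_sq: "symbol (-1) (\<lambda>x. lapse_sq m x - 1)"
  unfolding lapse_sq_def using symbol_cmult[OF symbol_rho[of "-1/2" "-1" 0], of "-2 * m"] by simp

lemmas lapse_sq_tendsto = symbol_limit_0_add(1)[OF symbol_lapse_sq, simplified]
lemmas symbol_lapse_sq_0 = symbol_limit_0_add(2)[OF symbol_lapse_sq, simplified]

lemma eventually_lapse_sq_pos: "\<forall>\<^sub>F x in at_infinity. lapse_sq m x > 0"
  using order_tendstoD(1)[OF lapse_sq_tendsto] by simp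

lemma symbol_inverse_lapse_sq: "symbol 0 (\<lambda>x. 1 / lapse_sq m x)"
proof (rule symbol_cong)
  show "symbol 0 (\<lambda>x. lapse_sq m x powr (-1))"
    by (rule symbol_powr[OF symbol_lapse_sq_0 lapse_sq_tendsto]) simp
  show "\<forall>\<^sub>F x in at_infinity. lapse_sq m x powr (-1) = 1 / lapse_sq m x"
    using eventually_lapse_sq_pos[of m] by eventually_elim (simp add: powr_minus_divide)
qed

text \<open>With q = 2m/r this is the identity 1/(1 - q) - 1 - q = q^2/(1 - q).\<close>

lemma symbol_inverse_lapse_sq_2: "symbol (-2) (\<lambda>x. 1 / lapse_sq m x - 1 - 2 * m * rho 0 (-1/2) x)"
proof -
  have r: "symbol (-1) (\<lambda>x. 2 * m * rho 0 (-1/2) x)"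
    by (intro symbol_cmult symbol_rho) simp
  have "symbol (-2) (\<lambda>x. (2 * m * rho 0 (-1/2) x) * (2 * m * rho 0 (-1/2) x) * (1 / lapse_sq m x))"
    by (rule symbol_mult[OF symbol_mult[OF r r] symbol_inverse_lapse_sq]) auto
  then show ?thesis
  proof (rule symbol_cong)
    show "\<forall>\<^sub>F x in at_infinity. (2 * m * rho 0 (-1/2) x) * (2 * m * rho 0 (-1/2) x) * (1 / lapse_sq m x)
        = 1 / lapse_sq m x - 1 - 2 * m * rho 0 (-1/2) x"
      using eventually_lapse_sq_pos[of m]
    proof eventually_elim
      case (elim x)
      define q where "q = 2 * m * rho 0 (-1/2) x"
      have l: "lapse_sq m x = 1 - q" by (simp add: lapse_sq_def q_def)
      show ?case using elim unfolding q_def[symmetric] l by (simp add: field_simps)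
    qed
  qed
qed

lemma symbol_spatial_metric: "symbol (-2) (\<lambda>x. spatial_metric m x $ i $ j - ((if i = j then 1 else 0) + mass_term m i j x))"
proof -
  have "symbol (-2) (\<lambda>x. (1 / lapse_sq m x - 1 - 2 * m * rho 0 (-1/2) x) * (x $ i * x $ j * rho 0 (-1) x))"
    by (rule symbol_mult[OF symbol_inverse_lapse_sq_2 symbol_xxr[of "-1" 0]]) auto
  moreover have "(1 / lapse_sq m x - 1 - 2 * m * rho 0 (-1/2) x) * (x $ i * x $ j * rho 0 (-1) x) =
      spatial_metric m x $ i $ j - ((if i = j then 1 else 0) + mass_term m i j x)" for x
    using rho_mult[of 0 "-1/2" x "-1"] by (simp add: spatial_metric_def mass_term_def algebra_simps)
  ultimately show ?thesis by simp
qed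

lemma symbol_spatial_metric_inv: "symbol (-1) (\<lambda>x. spatial_metric_inv m x $ i $ j - (if i = j then 1 else 0))"
  using symbol_cmult[OF symbol_xxr[of "-3/2" "-1" i j 0], of "-2 * m"]
  by (simp add: spatial_metric_inv_def mult_ac)

lemma symbol_spatial_metric_inv_0: "symbol 0 (\<lambda>x. spatial_metric_inv m x $ i $ j)"
  by (rule symbol_of_diff[OF symbol_weaken[OF symbol_spatial_metric_inv] symbol_const]) auto

lemma symbol_christoffel_spatial_metric: "symbol (-3) (\<lambda>x. christoffel (spatial_metric m) k i j x - mass_christoffel m k i j x)"
proof -
  have "symbol (-1) (\<lambda>x. matrix_inv (spatial_metric m x) $ i $ j - (if i = j then 1 else 0))" for i j
    using symbol_spatial_metric_inv
  proof (rule symbol_cong)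
    show "\<forall>\<^sub>F x in at_infinity. spatial_metric_inv m x $ i $ j - (if i = j then 1 else 0) =
        matrix_inv (spatial_metric m x) $ i $ j - (if i = j then 1 else 0)"
      using eventually_nonzero eventually_lapse_sq_pos[of m]
      by eventually_elim (simp add: matrix_inv_spatial_metric)
  qed
  with symbol_christoffel[of 2 "spatial_metric m" m k i j] symbol_spatial_metric show ?thesis by simp
qed

lemma symbol_christoffel_spatial_metric_2: "symbol (-2) (christoffel (spatial_metric m) k i j)"
  by (rule symbol_of_diff[OF symbol_weaken[OF symbol_christoffel_spatial_metric] symbol_mass_christoffel]) simp

lemma symbol_pd_lapse_sq: "symbol (-2) (pd i (lapse_sq m))"
  using symbol_pd_diff[OF symbol_lapse_sq symbol_const[of 0 1], where i = i] by simp

section \<open>Initial data of asymptotically flat graphs\<close>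

text \<open>Asymptotic flatness and the energy use only the growth order of f and the symmetry of
  its derivatives. The two momenta need the explicit leading part, which
  \<open>modelled_graph\<close> adds.\<close>

locale asymptotic_graph =
  fixes m :: real and f :: "real ^ 3 \<Rightarrow> real"
  assumes symbol_f: "symbol (1/3) f"
    and pd_pd_commute: "\<And>i j. pd i (pd j f) = pd j (pd i f)"
    and pd_pd_pd_commute: "\<And>i j k. pd i (pd j (pd k f)) = pd j (pd i (pd k f))"
begin

abbreviation "g \<equiv> induced_metric m f"
abbreviation "k \<equiv> second_fundamental_form m f"

definition z :: "real ^ 3 \<Rightarrow> real" where "z x = wsq m f x powr (-1/2)"
definition N :: "real ^ 3 \<Rightarrow> real" where "N x = (\<Sum>i\<in>UNIV. pd i f x * grad m f i x)"
definition laplacian :: "real ^ 3 \<Rightarrow> real" where "laplacian x = (\<Sum>i\<in>UNIV. pd i (pd i f) x)"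

lemma symbol_pd_f: "symbol (-2/3) (pd i f)"
  using symbol_pd[OF symbol_f] by simp

lemma symbol_pd_pd_f: "symbol (-5/3) (pd i (pd j f))"
  using symbol_pd[OF symbol_pd_f] by simp

lemma symbol_grad: "symbol (-2/3) (grad m f i)"
  unfolding grad_def[abs_def] by (intro symbol_sum symbol_mult[OF symbol_spatial_metric_inv_0 symbol_pd_f]) simp

lemma symbol_N: "symbol (-4/3) N"
  unfolding N_def[abs_def] by (intro symbol_sum symbol_mult[OF symbol_pd_f symbol_grad]) simp

lemma symbol_wsq: "symbol (-4/3) (\<lambda>x. wsq m f x - 1 - 2 * m * rho 0 (-1/2) x)"
proof -
  have "symbol (-4/3) (\<lambda>x. (1 / lapse_sq m x - 1 - 2 * m * rho 0 (-1/2) x) - N x)"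
    by (intro symbol_diff symbol_weaken[OF symbol_inverse_lapse_sq_2] symbol_N) simp
  then show ?thesis by (simp add: wsq_def N_def algebra_simps)
qed

lemma symbol_wsq_1: "symbol (-1) (\<lambda>x. wsq m f x - 1)"
proof -
  have "symbol (-1) (\<lambda>x. (wsq m f x - 1 - 2 * m * rho 0 (-1/2) x) + 2 * m * rho 0 (-1/2) x)"
    by (intro symbol_add symbol_weaken[OF symbol_wsq] symbol_cmult symbol_rho) auto
  then show ?thesis by simp
qed

lemmas wsq_tendsto = symbol_limit_0_add(1)[OF symbol_wsq_1, simplified]
lemmas symbol_wsq_0 = symbol_limit_0_add(2)[OF symbol_wsq_1, simplified]

lemma eventually_regular:
  "\<forall>\<^sub>F x in at_infinity. x \<noteq> 0 \<and> lapse_sq m x > 0 \<and> wsq m f x > 0 \<and> z x > 0 \<and> (z x)\<^sup>2 * wsq m f x = 1"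
  using eventually_nonzero eventually_lapse_sq_pos[of m] order_tendstoD(1)[OF wsq_tendsto zero_less_one]
proof eventually_elim
  case (elim x)
  then have "z x = 1 / sqrt (wsq m f x)" by (simp add: z_def powr_minus_divide powr_half_sqrt)
  with elim show ?case by (simp add: power_divide)
qed

lemma symbol_z_0: "symbol 0 z"
  unfolding z_def[abs_def] by (rule symbol_powr[OF symbol_wsq_0 wsq_tendsto]) simp

lemma z_tendsto: "(z \<longlongrightarrow> 1) at_infinity"
proof -
  have "((\<lambda>x. wsq m f x powr (-1/2)) \<longlongrightarrow> 1 powr (-1/2)) at_infinity"
    by (intro tendsto_intros wsq_tendsto) simp
  then show ?thesis by (simp add: z_def[abs_def])
qed

lemma symbol_inverse_z_plus_1: "symbol 0 (\<lambda>x. 1 / (z x + 1))"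
proof (rule symbol_cong)
  show "symbol 0 (\<lambda>x. (z x + 1) powr (-1))"
  proof (rule symbol_powr)
    show "((\<lambda>x. z x + 1) \<longlongrightarrow> 1 + 1) at_infinity" by (intro tendsto_intros z_tendsto)
    show "symbol 0 (\<lambda>x. z x + 1)" by (intro symbol_add symbol_z_0 symbol_const) simp
  qed simp
  show "\<forall>\<^sub>F x in at_infinity. (z x + 1) powr (-1) = 1 / (z x + 1)"
    using eventually_regular by eventually_elim (simp add: powr_minus_divide)
qed

text \<open>With \<open>v = w\<^sup>2 - 1\<close> and \<open>z = 1 / w\<close>, the expansion \<open>z = 1 - v / 2 + O(v\<^sup>2)\<close> is read off the
  identities \<open>z - 1 = - v z\<^sup>2 / (z + 1)\<close> and \<open>z - 1 + v / 2 = v (1 - z) (1 + 2 z) / (2 (z + 1))\<close>.\<close>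

lemma symbol_z: "symbol (-1) (\<lambda>x. z x - 1)"
proof (rule symbol_cong)
  show "symbol (-1) (\<lambda>x. - ((wsq m f x - 1) * (z x * z x) * (1 / (z x + 1))))"
    by (intro symbol_minus symbol_mult[OF symbol_mult[OF symbol_wsq_1
            symbol_mult[OF symbol_z_0 symbol_z_0, of 0], of "-1"] symbol_inverse_z_plus_1]) auto
  show "\<forall>\<^sub>F x in at_infinity. - ((wsq m f x - 1) * (z x * z x) * (1 / (z x + 1))) = z x - 1"
    using eventually_regular
  proof eventually_elim
    case (elim x)
    then have *: "(wsq m f x - 1) * (z x * z x) = 1 - z x * z x"
      by (simp add: algebra_simps power2_eq_square)
    show ?case unfolding * using elim by (simp add: field_simps)
  qed
qed

lemma symbol_z_expansion: "symbol (-2) (\<lambda>x. z x - 1 + (wsq m f x - 1) / 2)"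
proof (rule symbol_cong)
  have 1: "symbol 0 (\<lambda>x. 1 + 2 * z x)"
    by (intro symbol_add symbol_const symbol_cmult symbol_z_0) simp
  show "symbol (-2) (\<lambda>x. (-1/2) * ((wsq m f x - 1) * (z x - 1) * ((1 + 2 * z x) * (1 / (z x + 1)))))"
    by (intro symbol_cmult symbol_mult[OF symbol_mult[OF symbol_wsq_1 symbol_z, of "-2"]
          symbol_mult[OF 1 symbol_inverse_z_plus_1, of 0]]) auto
  show "\<forall>\<^sub>F x in at_infinity. (-1/2) * ((wsq m f x - 1) * (z x - 1) * ((1 + 2 * z x) * (1 / (z x + 1)))) =
      z x - 1 + (wsq m f x - 1) / 2"
    using eventually_regular
  proof eventually_elim
    case (elim x)
    then have "wsq m f x = 1 / (z x * z x)" by (simp add: field_simps power2_eq_square)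
    then show ?case using elim by (simp add: divide_simps) (simp add: algebra_simps)
  qed
qed

lemma symbol_g: "symbol (-4/3) (\<lambda>x. g x $ i $ j - ((if i = j then 1 else 0) + mass_term m i j x))"
proof (rule symbol_cong)
  show "symbol (-4/3) (\<lambda>x. (spatial_metric m x $ i $ j - ((if i = j then 1 else 0) + mass_term m i j x))
      - lapse_sq m x * pd i f x * pd j f x)"
    by (intro symbol_diff symbol_weaken[OF symbol_spatial_metric]
        symbol_mult[OF symbol_mult[OF symbol_lapse_sq_0 symbol_pd_f, of "-2/3"] symbol_pd_f]) auto
  show "\<forall>\<^sub>F x in at_infinity. (spatial_metric m x $ i $ j - ((if i = j then 1 else 0) + mass_term m i j x))
      - lapse_sq m x * pd i f x * pd j f x = g x $ i $ j - ((if i = j then 1 else 0) + mass_term m i j x)"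
    using eventually_nonzero by eventually_elim (simp add: induced_metric_nth)
qed

lemma symbol_g_1: "symbol (-1) (\<lambda>x. g x $ i $ j - (if i = j then 1 else 0))"
proof -
  have "symbol (-1) (\<lambda>x. (g x $ i $ j - ((if i = j then 1 else 0) + mass_term m i j x)) + mass_term m i j x)"
    by (intro symbol_add symbol_mass_term symbol_weaken[OF symbol_g]) simp
  then show ?thesis by simp
qed

lemma symbol_g_0: "symbol 0 (\<lambda>x. g x $ i $ j)"
  by (rule symbol_of_diff[OF symbol_weaken[OF symbol_g_1] symbol_const]) auto

lemma symbol_ginv: "symbol (-1) (\<lambda>x. matrix_inv (g x) $ i $ j - (if i = j then 1 else 0))"
proof (rule symbol_cong)
  show "symbol (-1) (\<lambda>x. (spatial_metric_inv m x $ i $ j - (if i = j then 1 else 0)) +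
      (z x * z x) * (grad m f i x * grad m f j x))"
    by (intro symbol_add symbol_spatial_metric_inv symbol_mult[OF symbol_mult[OF symbol_z_0 symbol_z_0, of 0]
          symbol_mult[OF symbol_grad symbol_grad, of "-4/3"]]) auto
  show "\<forall>\<^sub>F x in at_infinity. (spatial_metric_inv m x $ i $ j - (if i = j then 1 else 0)) +
      (z x * z x) * (grad m f i x * grad m f j x) = matrix_inv (g x) $ i $ j - (if i = j then 1 else 0)"
    using eventually_regular
  proof eventually_elim
    case (elim x)
    then have "z x * z x = 1 / wsq m f x" by (simp add: field_simps power2_eq_square)
    with elim show ?case by (simp add: matrix_inv_induced_metric)
  qed
qed

lemma symbol_ginv_0: "symbol 0 (\<lambda>x. matrix_inv (g x) $ i $ j)"
  by (rule symbol_of_diff[OF symbol_weaken[OF symbol_ginv] symbol_const]) auto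

lemma symbol_christoffel_g: "symbol (-2) (christoffel g l i j)"
proof -
  have "symbol (-7/3) (\<lambda>x. christoffel g l i j x - mass_christoffel m l i j x)"
    using symbol_christoffel[of "4/3" g m l i j] symbol_g symbol_ginv by simp
  from symbol_of_diff[OF symbol_weaken[OF this] symbol_mass_christoffel] show ?thesis by simp
qed

lemma k_eq:
  "\<forall>\<^sub>F x in at_infinity. k x $ i $ j = z x * (pd i (pd j f) x
      + (pd i (lapse_sq m) x * pd j f x + pd j (lapse_sq m) x * pd i f x) * (1 / lapse_sq m x) / 2
      - (\<Sum>l\<in>UNIV. pd l f x * (christoffel (spatial_metric m) l i j x + grad m (lapse_sq m) l x / 2 * (pd i f x * pd j f x))))"
  using eventually_regular
  by eventually_elim (simp add: second_fundamental_form_nth z_def)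

lemma symbol_grad_lapse_sq: "symbol (-2) (grad m (lapse_sq m) l)"
  unfolding grad_def[abs_def] by (intro symbol_sum symbol_mult[OF symbol_spatial_metric_inv_0 symbol_pd_lapse_sq]) simp

text \<open>Each correction to the Hessian is either z - 1 = O(r^(-1)) times the Hessian, or a first
  derivative of the Schwarzschild metric, O(r^(-2)), times df = O(r^(-2/3)), up to bounded
  factors.\<close>

lemma symbol_k_diff: "symbol (-8/3) (\<lambda>x. k x $ i $ j - pd i (pd j f) x)"
proof (rule symbol_cong)
  have A: "symbol (-8/3) (\<lambda>x. (1/2) * ((pd i (lapse_sq m) x * pd j f x + pd j (lapse_sq m) x * pd i f x) * (1 / lapse_sq m x)))"
    by (intro symbol_cmult symbol_mult[OF symbol_add symbol_inverse_lapse_sq]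
        symbol_mult[OF symbol_pd_lapse_sq symbol_pd_f]) auto
  have "symbol (-2) (\<lambda>x. christoffel (spatial_metric m) l i j x + (1/2) * (grad m (lapse_sq m) l x * (pd i f x * pd j f x)))" for l
    by (intro symbol_add symbol_christoffel_spatial_metric_2 symbol_cmult
        symbol_mult[OF symbol_grad_lapse_sq symbol_mult[OF symbol_pd_f symbol_pd_f, of "-4/3"]]) auto
  then have B: "symbol (-8/3) (\<lambda>x. \<Sum>l\<in>UNIV. pd l f x *
      (christoffel (spatial_metric m) l i j x + (1/2) * (grad m (lapse_sq m) l x * (pd i f x * pd j f x))))"
    by (intro symbol_sum symbol_mult[OF symbol_pd_f]) auto
  show "symbol (-8/3) (\<lambda>x. (z x - 1) * pd i (pd j f) x +
      z x * ((1/2) * ((pd i (lapse_sq m) x * pd j f x + pd j (lapse_sq m) x * pd i f x) * (1 / lapse_sq m x)) -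
       (\<Sum>l\<in>UNIV. pd l f x *
      (christoffel (spatial_metric m) l i j x + (1/2) * (grad m (lapse_sq m) l x * (pd i f x * pd j f x))))))"
    by (rule symbol_add[OF symbol_mult[OF symbol_z symbol_pd_pd_f]
          symbol_mult[OF symbol_z_0 symbol_diff[OF A B]]]) auto
  show "\<forall>\<^sub>F x in at_infinity. (z x - 1) * pd i (pd j f) x +
      z x * ((1/2) * ((pd i (lapse_sq m) x * pd j f x + pd j (lapse_sq m) x * pd i f x) * (1 / lapse_sq m x)) -
       (\<Sum>l\<in>UNIV. pd l f x *
      (christoffel (spatial_metric m) l i j x + (1/2) * (grad m (lapse_sq m) l x * (pd i f x * pd j f x))))) =
      k x $ i $ j - pd i (pd j f) x"
    using k_eq[of i j] by eventually_elim (simp add: algebra_simps)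
qed

lemma symbol_k: "symbol (-5/3) (\<lambda>x. k x $ i $ j)"
  by (rule symbol_of_diff[OF symbol_weaken[OF symbol_k_diff] symbol_pd_pd_f]) simp

lemma symbol_laplacian: "symbol (-5/3) laplacian"
  unfolding laplacian_def[abs_def] by (intro symbol_sum symbol_pd_pd_f)

lemma symbol_trace_diff: "symbol (-8/3) (\<lambda>x. trace_of g k x - laplacian x)"
proof -
  have "symbol (-8/3) (\<lambda>x. (\<Sum>i\<in>UNIV. \<Sum>j\<in>UNIV.
      (matrix_inv (g x) $ i $ j - (if i = j then 1 else 0)) * k x $ i $ j) +
      (\<Sum>i\<in>UNIV. k x $ i $ i - pd i (pd i f) x))"
    by (intro symbol_add symbol_sum symbol_mult[OF symbol_ginv symbol_k] symbol_k_diff) simp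
  then show ?thesis
    by (simp add: left_diff_distrib sum_subtractf sum_delta_mult trace_of_def laplacian_def)
qed

lemma symbol_trace: "symbol (-5/3) (trace_of g k)"
  by (rule symbol_of_diff[OF symbol_weaken[OF symbol_trace_diff] symbol_laplacian]) simp

lemma symbol_energy_density: "symbol (-10/3) (energy_density g k)"
proof -
  have "symbol (-10/3) (norm_sq_of g k)"
    unfolding norm_sq_of_def[abs_def]
    by (intro symbol_sum symbol_mult[OF symbol_mult[OF symbol_mult[OF symbol_ginv_0 symbol_ginv_0, of 0]
         symbol_k, of "-5/3"] symbol_k]) auto
  moreover have "symbol (-10/3) (\<lambda>x. trace_of g k x * trace_of g k x)"
    by (rule symbol_mult[OF symbol_trace symbol_trace]) simp
  moreover have "symbol (-10/3) (scalar_curvature g)"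
    using symbol_scalar_curvature[of g m] symbol_g symbol_ginv by simp
  ultimately show ?thesis
    unfolding energy_density_def[abs_def] power2_eq_square
    by (intro symbol_cmult symbol_add symbol_diff)
qed

text \<open>To leading order J is the divergence of the Hessian of f minus the differential of its
  Laplacian, which is zero once third derivatives are exchanged. Every other term gains a factor
  r^(-1) over the order -8/3 of a derivative of k.\<close>

lemma symbol_current_density: "symbol (-11/3) (\<lambda>x. current_density g k x $ j)"
proof -
  have dk: "symbol (-8/3) (pd i (\<lambda>y. k y $ l $ j))" for i l j
    using symbol_pd[OF symbol_k] by simp
  have Ck: "symbol (-11/3) (\<lambda>x. christoffel g a i l x * k x $ b $ c)" for a i l b c
    by (rule symbol_mult[OF symbol_christoffel_g symbol_k]) simp
  define T where "T i l = (\<lambda>x. \<Sum>a\<in>UNIV. christoffel g a i l x * k x $ a $ j + christoffel g a i j x * k x $ l $ a)" for i l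
  have T_apply: "(\<Sum>a\<in>UNIV. christoffel g a i l x * k x $ a $ j + christoffel g a i j x * k x $ l $ a) = T i l x" for i l x
    by (simp add: T_def)
  have T: "symbol (-11/3) (T i l)" for i l
    unfolding T_def by (intro symbol_sum symbol_add Ck)
  have kd: "symbol (-11/3) (\<lambda>x. pd i (\<lambda>y. k y $ l $ j) x - pd i (pd l (pd j f)) x)" for i l j
    using symbol_pd_diff[OF symbol_k_diff symbol_pd_pd_f] by simp
  have td: "symbol (-11/3) (\<lambda>x. pd j (trace_of g k) x - pd j laplacian x)"
    using symbol_pd_diff[OF symbol_trace_diff symbol_laplacian] by simp
  have "symbol (-11/3) (\<lambda>x. (\<Sum>i\<in>UNIV. \<Sum>l\<in>UNIV.
      (matrix_inv (g x) $ i $ l - (if i = l then 1 else 0)) * (pd i (\<lambda>y. k y $ l $ j) x - T i l x))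
      + (\<Sum>i\<in>UNIV. (pd i (\<lambda>y. k y $ i $ j) x - pd i (pd i (pd j f)) x) - T i i x)
      - (pd j (trace_of g k) x - pd j laplacian x))"
    by (intro symbol_add symbol_diff symbol_sum symbol_mult[OF symbol_ginv symbol_diff[OF dk symbol_weaken[OF T]]]
        T kd td) auto
  then show ?thesis
  proof (rule symbol_cong)
    have "\<forall>\<^sub>F x in at_infinity. pd i (pd i f) differentiable (at x)" for i
      by (rule symbol_differentiable[OF symbol_pd_pd_f])
    then have "\<forall>\<^sub>F x in at_infinity. \<forall>i. pd i (pd i f) differentiable (at x)"
      by (simp add: eventually_all_finite)
    then show "\<forall>\<^sub>F x in at_infinity. (\<Sum>i\<in>UNIV. \<Sum>l\<in>UNIV.
      (matrix_inv (g x) $ i $ l - (if i = l then 1 else 0)) * (pd i (\<lambda>y. k y $ l $ j) x - T i l x))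
      + (\<Sum>i\<in>UNIV. (pd i (\<lambda>y. k y $ i $ j) x - pd i (pd i (pd j f)) x) - T i i x)
      - (pd j (trace_of g k) x - pd j laplacian x) = current_density g k x $ j"
    proof eventually_elim
      case (elim x)
      have "pd j laplacian x = (\<Sum>i\<in>UNIV. pd j (pd i (pd i f)) x)"
        unfolding laplacian_def by (rule pd_sum) (use elim in auto)
      also have "\<dots> = (\<Sum>i\<in>UNIV. pd i (pd i (pd j f)) x)"
        by (rule sum.cong) (simp_all only: pd_pd_pd_commute[of j] pd_pd_commute[of j])
      finally show ?case
        by (simp add: current_density_def divergence_of_def T_apply
            left_diff_distrib sum_subtractf sum_delta_mult)
    qed
  qed
qed

lemma current_norm_bigo: "current_norm g k \<in> O[at_infinity](\<lambda>x. norm x powr (-11/3))"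
proof -
  let ?Q = "\<lambda>x. metric_apply (matrix_inv (g x)) (current_density g k x) (current_density g k x)"
  have "symbol (-22/3) ?Q"
    unfolding metric_apply_def
    by (intro symbol_sum symbol_mult[OF symbol_mult[OF symbol_ginv_0 symbol_current_density, of "-11/3"]
          symbol_current_density]) auto
  from symbol_bigo[OF this] obtain C where C: "C > 0"
    "\<forall>\<^sub>F x in at_infinity. norm (?Q x) \<le> C * norm (norm x powr (-22/3))"
    by (auto elim: landau_o.bigE)
  show ?thesis
  proof (rule bigoI)
    show "\<forall>\<^sub>F x in at_infinity. norm (current_norm g k x) \<le> sqrt C * norm (norm x powr (-11/3))"
      using C(2)
    proof eventually_elim
      case (elim x)
      have "norm x powr (-22/3) = (norm x powr (-11/3))\<^sup>2"
        by (simp add: power2_eq_square powr_add[symmetric])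
      \<comment> \<open>The real square root is odd, so |sqrt Q| = sqrt |Q| whatever the sign of Q,
        and a bound on |Q| is enough.\<close>
      then have "sqrt \<bar>?Q x\<bar> \<le> sqrt (C * (norm x powr (-11/3))\<^sup>2)"
        using elim by simp
      then show ?case by (simp add: current_norm_def real_sqrt_mult real_sqrt_abs2 flip: real_sqrt_abs')
    qed
  qed
qed

lemma asymptotically_flat: "asymptotically_flat g k"
  unfolding asymptotically_flat_def
\<comment> \<open>q = 1 comes from the mass term, p = 5/3 from the Hessian of a function of order
  1/3, and epsilon = 1/3 from the energy density, the slower of the two densities.\<close>
proof (rule exI[of _ 1], rule exI[of _ "5/3"], rule exI[of _ "1/3"], intro conjI allI)
  show "O_deriv 2 (- 1) (\<lambda>x. g x $ i $ j - mat 1 $ i $ j)" for i j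
    using symbol_O_deriv[OF symbol_g_1] by (simp add: mat_def)
  show "O_deriv 1 (- (5/3)) (\<lambda>x. k x $ i $ j)" for i j
    using symbol_O_deriv[OF symbol_k] by simp
  show "energy_density g k \<in> O[at_infinity](\<lambda>x. norm x powr (- 3 - 1/3))"
    using symbol_bigo[OF symbol_energy_density] by simp
  show "current_norm g k \<in> O[at_infinity](\<lambda>x. norm x powr (- 3 - 1/3))"
    by (rule landau_o.big_trans[OF current_norm_bigo norm_powr_bigo]) simp
qed auto

end

section \<open>Integrals over spheres\<close>

lemma sphere_point_nth [simp]:
  "sphere_point r \<theta> \<phi> $ 1 = r * sin \<theta> * cos \<phi>"
  "sphere_point r \<theta> \<phi> $ 2 = r * sin \<theta> * sin \<phi>"
  "sphere_point r \<theta> \<phi> $ 3 = r * cos \<theta>"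
  by (simp_all add: sphere_point_def)

lemma norm_sphere_point [simp]: "norm (sphere_point r \<theta> \<phi>) = \<bar>r\<bar>"
proof -
  have "(norm (sphere_point r \<theta> \<phi>))\<^sup>2 = r\<^sup>2 * ((sin \<theta>)\<^sup>2 * ((cos \<phi>)\<^sup>2 + (sin \<phi>)\<^sup>2) + (cos \<theta>)\<^sup>2)"
    unfolding norm_sq_eq_sum sum_3 sphere_point_nth by algebra
  also have "\<dots> = r\<^sup>2" by simp
  finally show ?thesis by (metis abs_norm_cancel real_sqrt_abs)
qed

lemma continuous_sphere_point:
  "continuous_on S (\<lambda>p. sphere_point r (fst p) (snd p))"
  unfolding continuous_on_componentwise[of _ "\<lambda>p. sphere_point r (fst p) (snd p)"]
proof
  have nth: "sphere_point r \<theta> \<phi> $ i = (if i = 1 then r * sin \<theta> * cos \<phi> else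
      if i = 2 then r * sin \<theta> * sin \<phi> else r * cos \<theta>)" for \<theta> \<phi> i
    using exhaust_3[of i] by auto
  fix b :: "real ^ 3" assume "b \<in> Basis"
  then obtain i where b: "b = axis i 1" by (auto simp: Basis_vec_def)
  show "continuous_on S (\<lambda>p. sphere_point r (fst p) (snd p) \<bullet> b)"
    unfolding b inner_axis nth by (cases "i = 1"; cases "i = 2"; simp; intro continuous_intros)
qed

text \<open>A relation, since it carries integrability along with the value: such statements add and
  scale freely, whereas \<open>sphere_integral\<close> has a default value on functions that are not
  integrable.\<close>

definition has_sphere_integral :: "real \<Rightarrow> (real ^ 3 \<Rightarrow> real) \<Rightarrow> real \<Rightarrow> bool" where
  "has_sphere_integral r h v \<longleftrightarrow>
     ((\<lambda>p. h (sphere_point r (fst p) (snd p)) * (r\<^sup>2 * sin (fst p))) has_integral v) (cbox (0, 0) (pi, 2 * pi))"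

lemma has_sphere_integralD: "has_sphere_integral r h v \<Longrightarrow> sphere_integral r h = v"
  unfolding has_sphere_integral_def sphere_integral_def case_prod_beta' by (rule integral_unique)

lemma has_sphere_integral_add:
  "has_sphere_integral r f v \<Longrightarrow> has_sphere_integral r g w \<Longrightarrow> has_sphere_integral r (\<lambda>x. f x + g x) (v + w)"
  unfolding has_sphere_integral_def
  by (drule (1) has_integral_add) (simp add: distrib_right)

lemma has_sphere_integral_cmult:
  "has_sphere_integral r f v \<Longrightarrow> has_sphere_integral r (\<lambda>x. c * f x) (c * v)"
  unfolding has_sphere_integral_def
  by (drule has_integral_mult_right[where c = c]) (simp add: mult.assoc)

lemma has_sphere_integral_cong:
  assumes "has_sphere_integral r f v" "\<And>x. norm x = \<bar>r\<bar> \<Longrightarrow> f x = h x"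
  shows "has_sphere_integral r h v"
  using assms by (simp add: has_sphere_integral_def)

lemma has_sphere_integral_continuous:
  assumes "\<And>x. norm x = \<bar>r\<bar> \<Longrightarrow> isCont h x"
  shows "has_sphere_integral r h (sphere_integral r h)"
proof -
  have "continuous_on (sphere 0 \<bar>r\<bar>) h"
    using assms by (intro continuous_at_imp_continuous_on) auto
  then have "continuous_on (cbox (0, 0) (pi, 2 * pi)) (\<lambda>p. h (sphere_point r (fst p) (snd p)))"
    by (rule continuous_on_compose2[OF _ continuous_sphere_point]) auto
  then have "continuous_on (cbox (0, 0) (pi, 2 * pi)) (\<lambda>p. h (sphere_point r (fst p) (snd p)) * (r\<^sup>2 * sin (fst p)))"
    by (intro continuous_intros)
  then show ?thesis unfolding has_sphere_integral_def sphere_integral_def case_prod_beta'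
    by (intro integrable_integral integrable_continuous)
qed

text \<open>The factor 2 pi^2 is the content of the parameter rectangle, with the sine estimated by
  1. The loss against the true area 4 pi is harmless, as the bound is applied only to errors that
  tend to 0.\<close>

lemma sphere_integral_bound:
  assumes "has_sphere_integral r h v" "\<And>x. norm x = \<bar>r\<bar> \<Longrightarrow> \<bar>h x\<bar> \<le> B"
  shows "\<bar>v\<bar> \<le> B * r\<^sup>2 * (2 * pi\<^sup>2)"
proof -
  have B: "0 \<le> B" using assms(2)[of "sphere_point r 0 0"] by (meson abs_ge_zero norm_sphere_point order_trans)
  have "norm v \<le> (B * r\<^sup>2) * Henstock_Kurzweil_Integration.content (cbox (0, 0) (pi, 2 * pi))"
  proof (rule has_integral_bound)
    show "((\<lambda>p. h (sphere_point r (fst p) (snd p)) * (r\<^sup>2 * sin (fst p))) has_integral v) (cbox (0, 0) (pi, 2 * pi))"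
      using assms(1) by (simp add: has_sphere_integral_def)
    fix p :: "real \<times> real"
    have "\<bar>h (sphere_point r (fst p) (snd p))\<bar> * (r\<^sup>2 * \<bar>sin (fst p)\<bar>) \<le> B * (r\<^sup>2 * 1)"
      using B by (intro mult_mono assms(2)) auto
    then show "norm (h (sphere_point r (fst p) (snd p)) * (r\<^sup>2 * sin (fst p))) \<le> B * r\<^sup>2"
      by (simp add: abs_mult)
  qed (use B in simp)
  also have "Henstock_Kurzweil_Integration.content (cbox (0 :: real, 0 :: real) (pi, 2 * pi)) = 2 * pi\<^sup>2"
    by (simp add: content_Pair power2_eq_square)
  finally show ?thesis by simp
qed

lemma symbol_continuous: "symbol a h \<Longrightarrow> \<forall>\<^sub>F x in at_infinity. isCont h x"
  by (drule symbol_differentiable) (auto elim: eventually_mono intro: differentiable_imp_continuous_within)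

lemma eventually_sphere:
  assumes "\<forall>\<^sub>F x :: real ^ 3 in at_infinity. P x"
  shows "\<forall>\<^sub>F r in at_top. r > 0 \<and> (\<forall>x. norm x = \<bar>r\<bar> \<longrightarrow> P x)"
proof -
  obtain b where b: "\<And>x. norm x \<ge> b \<Longrightarrow> P x" using assms by (auto simp: eventually_at_infinity)
  show ?thesis using eventually_gt_at_top[of "max 0 b"] by eventually_elim (auto intro: b)
qed

text \<open>A discrepancy of order below -2 is beaten by the area r^2. The comparison function
  \<open>H\<close> has the exact integral \<open>v\<close> on all large spheres, so it may contain
  parts that grow too fast, as long as these integrate to zero.\<close>

lemma sphere_integral_limit:
  assumes diff: "symbol a (\<lambda>x. F x - H x)" and a: "a < -2" and H: "symbol b H"
    and lim: "\<forall>\<^sub>F r in at_top. has_sphere_integral r H v"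
  shows "((\<lambda>r. sphere_integral r F) \<longlongrightarrow> v) at_top"
proof -
  obtain C where C: "\<forall>\<^sub>F x in at_infinity. norm (F x - H x) \<le> C * norm (norm x powr a)"
    using symbol_bigo[OF diff] by (auto elim: landau_o.bigE)
  have "\<forall>\<^sub>F r in at_top. norm (sphere_integral r F - v) \<le> C * r powr (a + 2) * (2 * pi\<^sup>2)"
    using eventually_sphere[OF C] eventually_sphere[OF symbol_continuous[OF diff]] lim
  proof eventually_elim
    case (elim r)
    define e where "e = sphere_integral r (\<lambda>x. F x - H x)"
    have e: "has_sphere_integral r (\<lambda>x. F x - H x) e"
      unfolding e_def using elim by (intro has_sphere_integral_continuous) auto
    from has_sphere_integral_add[OF elim(3) e] have "sphere_integral r F = v + e"
      by (simp add: has_sphere_integralD)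
    moreover have "\<bar>e\<bar> \<le> (C * r powr a) * r\<^sup>2 * (2 * pi\<^sup>2)"
      using elim by (intro sphere_integral_bound[OF e]) auto
    moreover have "r powr a * r\<^sup>2 = r powr (a + 2)" using elim by (simp add: powr_add)
    ultimately show ?case by (simp add: mult.assoc)
  qed
  moreover have "((\<lambda>r. C * r powr (a + 2) * (2 * pi\<^sup>2)) \<longlongrightarrow> 0) at_top"
    using a by (intro tendsto_mult_left_zero tendsto_mult_right_zero tendsto_neg_powr filterlim_ident) auto
  ultimately have "((\<lambda>r. sphere_integral r F - v) \<longlongrightarrow> 0) at_top"
    by (rule Lim_null_comparison)
  then show ?thesis by (simp add: LIM_zero_iff)
qed

section \<open>Moments of monomials over spheres\<close>

definition polar_int :: "nat \<Rightarrow> nat \<Rightarrow> real" where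
  "polar_int p c = integral {0..pi} (\<lambda>t. sin t ^ p * cos t ^ c)"

definition azimuth_int :: "nat \<Rightarrow> nat \<Rightarrow> real" where
  "azimuth_int a b = integral {0..2 * pi} (\<lambda>t. cos t ^ a * sin t ^ b)"

lemma has_polar_int: "((\<lambda>t. sin t ^ p * cos t ^ c) has_integral polar_int p c) {0..pi}"
  unfolding polar_int_def by (intro integrable_integral integrable_continuous_real continuous_intros)

lemma has_azimuth_int: "((\<lambda>t. cos t ^ a * sin t ^ b) has_integral azimuth_int a b) {0..2 * pi}"
  unfolding azimuth_int_def by (intro integrable_integral integrable_continuous_real continuous_intros)

lemma polar_int_eqI: "((\<lambda>t. sin t ^ p * cos t ^ c) has_integral v) {0..pi} \<Longrightarrow> polar_int p c = v"
  unfolding polar_int_def by (rule integral_unique)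

lemma azimuth_int_eqI: "((\<lambda>t. cos t ^ a * sin t ^ b) has_integral v) {0..2 * pi} \<Longrightarrow> azimuth_int a b = v"
  unfolding azimuth_int_def by (rule integral_unique)

lemma has_integral_DERIV:
  assumes "a \<le> b" "\<And>t. (F has_real_derivative f t) (at t)"
  shows "(f has_integral (F b - F a)) {a..b}"
  using assms by (intro fundamental_theorem_of_calculus)
    (auto simp: has_real_derivative_iff_has_vector_derivative[symmetric] intro: has_field_derivative_at_within)

text \<open>Arranged as terminating rewrite rules: cos^2 = 1 - sin^2 lowers the exponent of the
  cosine to 0 or 1, and then the Wallis recursion lowers that of the sine.\<close>

lemma polar_int_simps:
  "polar_int 0 0 = pi" "polar_int (Suc 0) 0 = 2"
  "polar_int (Suc (Suc n)) 0 = real (n + 1) / real (n + 2) * polar_int n 0"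
  "polar_int p (Suc 0) = 0"
  "polar_int p (Suc (Suc c)) = polar_int p c - polar_int (Suc (Suc p)) c"
proof -
  show "polar_int 0 0 = pi" by (simp add: polar_int_def)
  have "((\<lambda>t. sin t ^ Suc 0 * cos t ^ 0) has_integral (- cos pi - - cos 0)) {0..pi}"
    by (rule has_integral_DERIV) (auto intro!: derivative_eq_intros)
  from polar_int_eqI[OF this] show "polar_int (Suc 0) 0 = 2" by simp
  \<comment> \<open>Integration by parts read backwards: the integrand is the derivative of -cos t
    sin^(n+1) t, which vanishes at both ends.\<close>
  have 1: "((\<lambda>t. (real n + 2) * (sin t ^ (n + 2) * cos t ^ 0) - (real n + 1) * (sin t ^ n * cos t ^ 0))
      has_integral (- cos pi * sin pi ^ (n + 1) - - cos 0 * sin 0 ^ (n + 1))) {0..pi}"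
  proof (rule has_integral_DERIV)
    fix t :: real
    have c: "cos t * cos t = 1 - sin t * sin t" using sin_cos_squared_add[of t] by (simp add: power2_eq_square)
    have "((\<lambda>t. - cos t * sin t ^ (n + 1)) has_real_derivative
        sin t * sin t ^ (n + 1) - (real n + 1) * sin t ^ n * (cos t * cos t)) (at t)"
      using DERIV_mult[OF DERIV_minus[OF DERIV_cos[of t]] DERIV_power_Suc[OF DERIV_sin[of t], of n]]
      by (simp add: algebra_simps)
    then show "((\<lambda>t. - cos t * sin t ^ (n + 1)) has_real_derivative
        (real n + 2) * (sin t ^ (n + 2) * cos t ^ 0) - (real n + 1) * (sin t ^ n * cos t ^ 0)) (at t)"
      unfolding c by (simp add: algebra_simps)
  qed simp
  have 2: "((\<lambda>t. (real n + 2) * (sin t ^ (n + 2) * cos t ^ 0) - (real n + 1) * (sin t ^ n * cos t ^ 0))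
      has_integral ((real n + 2) * polar_int (n + 2) 0 - (real n + 1) * polar_int n 0)) {0..pi}"
    by (intro has_integral_diff has_integral_mult_right has_polar_int)
  from has_integral_unique[OF 1 2]
  show "polar_int (Suc (Suc n)) 0 = real (n + 1) / real (n + 2) * polar_int n 0"
    by (simp add: field_simps)
  have "((\<lambda>t. sin t ^ p * cos t ^ Suc 0) has_integral
      (sin pi ^ Suc p / (1 + real p) - sin 0 ^ Suc p / (1 + real p))) {0..pi}"
    using DERIV_cdivide[OF DERIV_power_Suc[OF DERIV_sin, of p], of "1 + real p"]
    by (intro has_integral_DERIV) (simp_all add: mult.commute nonzero_mult_div_cancel_left add_nonneg_eq_0_iff)
  from polar_int_eqI[OF this] show "polar_int p (Suc 0) = 0" by simp
  have eq: "(\<lambda>t. sin t ^ p * cos t ^ Suc (Suc c)) = (\<lambda>t::real. sin t ^ p * cos t ^ c - sin t ^ Suc (Suc p) * cos t ^ c)"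
  proof
    fix t :: real
    have "cos t * cos t = 1 - sin t * sin t" using sin_cos_squared_add[of t] by (simp add: power2_eq_square)
    then have "sin t ^ p * cos t ^ c * (cos t * cos t) = sin t ^ p * cos t ^ c * (1 - sin t * sin t)" by simp
    then show "sin t ^ p * cos t ^ Suc (Suc c) = sin t ^ p * cos t ^ c - sin t ^ Suc (Suc p) * cos t ^ c"
      by (simp add: algebra_simps)
  qed
  show "polar_int p (Suc (Suc c)) = polar_int p c - polar_int (Suc (Suc p)) c"
    by (rule polar_int_eqI, unfold eq) (intro has_integral_diff has_polar_int)
qed

lemma azimuth_int_simps:
  "azimuth_int 0 0 = 2 * pi" "azimuth_int (Suc 0) 0 = 0"
  "azimuth_int (Suc (Suc n)) 0 = real (n + 1) / real (n + 2) * azimuth_int n 0"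
  "azimuth_int a (Suc 0) = 0"
  "azimuth_int a (Suc (Suc b)) = azimuth_int a b - azimuth_int (Suc (Suc a)) b"
proof -
  show "azimuth_int 0 0 = 2 * pi" by (simp add: azimuth_int_def)
  have "((\<lambda>t. cos t ^ Suc 0 * sin t ^ 0) has_integral (sin (2 * pi) - sin 0)) {0..2 * pi}"
    by (rule has_integral_DERIV) (auto intro!: derivative_eq_intros)
  from azimuth_int_eqI[OF this] show "azimuth_int (Suc 0) 0 = 0" by simp
  have 1: "((\<lambda>t. (real n + 2) * (cos t ^ (n + 2) * sin t ^ 0) - (real n + 1) * (cos t ^ n * sin t ^ 0))
      has_integral (sin (2 * pi) * cos (2 * pi) ^ (n + 1) - sin 0 * cos 0 ^ (n + 1))) {0..2 * pi}"
  proof (rule has_integral_DERIV)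
    fix t :: real
    have c: "sin t * sin t = 1 - cos t * cos t" using sin_cos_squared_add[of t] by (simp add: power2_eq_square)
    have "((\<lambda>t. sin t * cos t ^ (n + 1)) has_real_derivative
        cos t * cos t ^ (n + 1) - (real n + 1) * cos t ^ n * (sin t * sin t)) (at t)"
      using DERIV_mult[OF DERIV_sin[of t] DERIV_power_Suc[OF DERIV_cos[of t], of n]]
      by (simp add: algebra_simps)
    then show "((\<lambda>t. sin t * cos t ^ (n + 1)) has_real_derivative
        (real n + 2) * (cos t ^ (n + 2) * sin t ^ 0) - (real n + 1) * (cos t ^ n * sin t ^ 0)) (at t)"
      unfolding c by (simp add: algebra_simps)
  qed simp
  have 2: "((\<lambda>t. (real n + 2) * (cos t ^ (n + 2) * sin t ^ 0) - (real n + 1) * (cos t ^ n * sin t ^ 0))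
      has_integral ((real n + 2) * azimuth_int (n + 2) 0 - (real n + 1) * azimuth_int n 0)) {0..2 * pi}"
    by (intro has_integral_diff has_integral_mult_right has_azimuth_int)
  from has_integral_unique[OF 1 2]
  show "azimuth_int (Suc (Suc n)) 0 = real (n + 1) / real (n + 2) * azimuth_int n 0"
    by (simp add: field_simps)
  have "((\<lambda>t. cos t ^ a * sin t ^ Suc 0) has_integral
      (cos (2 * pi) ^ Suc a / (- (1 + real a)) - cos 0 ^ Suc a / (- (1 + real a)))) {0..2 * pi}"
  proof (rule has_integral_DERIV)
    fix t :: real
    have "1 + real a \<noteq> 0" by linarith
    then have "(1 + real a) * (- sin t * cos t ^ a) / (- (1 + real a)) = cos t ^ a * sin t ^ Suc 0"
      by (simp add: divide_simps) (simp add: algebra_simps)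
    then show "((\<lambda>t. cos t ^ Suc a / (- (1 + real a))) has_real_derivative cos t ^ a * sin t ^ Suc 0) (at t)"
      using DERIV_cdivide[OF DERIV_power_Suc[OF DERIV_cos[of t], of a], of "- (1 + real a)"] by metis
  qed simp
  from azimuth_int_eqI[OF this] show "azimuth_int a (Suc 0) = 0" by simp
  have eq: "(\<lambda>t. cos t ^ a * sin t ^ Suc (Suc b)) = (\<lambda>t::real. cos t ^ a * sin t ^ b - cos t ^ Suc (Suc a) * sin t ^ b)"
  proof
    fix t :: real
    have "sin t * sin t = 1 - cos t * cos t" using sin_cos_squared_add[of t] by (simp add: power2_eq_square)
    then have "cos t ^ a * sin t ^ b * (sin t * sin t) = cos t ^ a * sin t ^ b * (1 - cos t * cos t)" by simp
    then show "cos t ^ a * sin t ^ Suc (Suc b) = cos t ^ a * sin t ^ b - cos t ^ Suc (Suc a) * sin t ^ b"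
      by (simp add: algebra_simps)
  qed
  show "azimuth_int a (Suc (Suc b)) = azimuth_int a b - azimuth_int (Suc (Suc a)) b"
    by (rule azimuth_int_eqI, unfold eq) (intro has_integral_diff has_azimuth_int)
qed

text \<open>Monomials separate in spherical coordinates; the area density adds one to the exponent
  of the sine and two to that of r. All explicit values of sphere integrals below rest on this
  formula.\<close>

lemma has_sphere_integral_monomial:
  "has_sphere_integral r (\<lambda>x. x $ 1 ^ a * x $ 2 ^ b * x $ 3 ^ c)
     (r ^ (a + b + c + 2) * (polar_int (a + b + 1) c * azimuth_int a b))"
proof -
  let ?h = "\<lambda>p. (sin (fst p) ^ (a + b + 1) * cos (fst p) ^ c) * (cos (snd p) ^ a * sin (snd p) ^ b) :: real"
  have cont: "continuous_on (cbox (0, 0) (pi, 2 * pi)) ?h"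
    by (intro continuous_intros)
  have "integral (cbox (0, 0) (pi, 2 * pi)) ?h = polar_int (a + b + 1) c * azimuth_int a b"
    using integral_prod_continuous[OF cont] by (simp add: polar_int_def azimuth_int_def)
  then have "(?h has_integral (polar_int (a + b + 1) c * azimuth_int a b)) (cbox (0, 0) (pi, 2 * pi))"
    using integrable_integral[OF integrable_continuous[OF cont]] by simp
  from has_integral_mult_right[OF this, of "r ^ (a + b + c + 2)"]
  show ?thesis unfolding has_sphere_integral_def
    by (simp add: power_mult_distrib power_add power2_eq_square mult_ac)
qed

lemma has_sphere_integral_const: "has_sphere_integral r (\<lambda>x. c) (c * (4 * pi * r\<^sup>2))"
  using has_sphere_integral_cmult[OF has_sphere_integral_monomial[of r 0 0 0], of c]
  by (simp add: polar_int_simps azimuth_int_simps power2_eq_square mult_ac)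

section \<open>ADM quantities of asymptotically flat graphs\<close>

lemma unit_eq: "x $ l / norm x = x $ l * rho 0 (-1/2) x" for x :: "real ^ 3"
  by (cases "x = 0") (simp_all add: rho_0 powr_minus_divide)

lemma symbol_unit: "symbol 0 (\<lambda>x. x $ l * rho 0 (-1/2) x)"
  by (rule symbol_xr) simp

lemma symbol_mult_diff:
  assumes "symbol a (\<lambda>x. F x - F0 x)" "symbol b G" "symbol p F0" "symbol q (\<lambda>x. G x - G0 x)"
    "a + b \<le> c" "p + q \<le> c"
  shows "symbol c (\<lambda>x. F x * G x - F0 x * G0 x)"
proof -
  have "symbol c (\<lambda>x. (F x - F0 x) * G x + F0 x * (G x - G0 x))"
    by (intro symbol_add symbol_mult[OF assms(1,2,5)] symbol_mult[OF assms(3,4,6)])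
  then show ?thesis by (simp add: algebra_simps)
qed

lemma symbol_model: "symbol a (\<lambda>x. F x - H x) \<Longrightarrow> symbol b F \<Longrightarrow> a \<le> b \<Longrightarrow> symbol b H"
  using symbol_diff[of b F "\<lambda>x. F x - H x"] symbol_weaken[of a "\<lambda>x. F x - H x" b] by simp

lemma symbol_trans:
  "symbol a (\<lambda>x. F x - G x) \<Longrightarrow> symbol a (\<lambda>x. G x - H x) \<Longrightarrow> symbol a (\<lambda>x. F x - H x)"
  using symbol_add[of a "\<lambda>x. F x - G x" "\<lambda>x. G x - H x"] by simp

context asymptotic_graph
begin

text \<open>The mass term has divergence 2m x/r^3 and trace 2m/r, so its flux density is exactly
  4m/r^2 and integrates to 16 pi m over every sphere. The remaining derivatives of the metric are
  O(r^(-7/3)) and are lost against the area.\<close>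

lemma has_ADM_energy: "has_ADM_energy g m"
proof -
  define B where "B j l = (\<lambda>x. (if j = l then 1 else 0) + mass_term m j l x)" for j l
  have sB: "symbol 0 (B j l)" for j l
    unfolding B_def by (intro symbol_add symbol_const symbol_weaken[OF symbol_mass_term]) auto
  have d: "symbol (-7/3) (\<lambda>x. pd i (\<lambda>y. g y $ j $ l) x - pd i (B j l) x)" for i j l
    using symbol_pd_diff[OF _ sB, of "-4/3" "\<lambda>x. g x $ j $ l" j l i] symbol_g[of j l] by (simp add: B_def)
  let ?F = "\<lambda>x. \<Sum>j\<in>UNIV. \<Sum>k\<in>UNIV.
           (pd k (\<lambda>y. g y $ j $ k) x - pd j (\<lambda>y. g y $ k $ k) x) * (x $ j / norm x)"
  let ?H = "\<lambda>x. 4 * m * rho 0 (-1) x"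
  have "symbol (-7/3) (\<lambda>x. \<Sum>j\<in>UNIV. \<Sum>k\<in>UNIV.
      ((pd k (\<lambda>y. g y $ j $ k) x - pd k (B j k) x) - (pd j (\<lambda>y. g y $ k $ k) x - pd j (B k k) x)) *
      (x $ j * rho 0 (-1/2) x))"
    by (intro symbol_sum symbol_mult[OF symbol_diff[OF d d] symbol_unit]) simp
  then have "symbol (-7/3) (\<lambda>x. ?F x - ?H x)"
  proof (rule symbol_cong)
    show "\<forall>\<^sub>F x in at_infinity. (\<Sum>j\<in>UNIV. \<Sum>k\<in>UNIV.
      ((pd k (\<lambda>y. g y $ j $ k) x - pd k (B j k) x) - (pd j (\<lambda>y. g y $ k $ k) x - pd j (B k k) x)) *
      (x $ j * rho 0 (-1/2) x)) = ?F x - ?H x"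
      using eventually_nonzero
    proof eventually_elim
      case (elim x)
      have "(\<Sum>j\<in>UNIV. \<Sum>k\<in>UNIV. (pd k (B j k) x - pd j (B k k) x) * (x $ j * rho 0 (-1/2) x)) =
          4 * m * ((norm x)\<^sup>2 * (rho 0 (-3/2) x * rho 0 (-1/2) x))"
        unfolding B_def pd_mass_term[OF elim] norm_sq_eq_sum by (simp add: sum_3 algebra_simps)
      also have "\<dots> = ?H x" by (simp add: rho_mult norm_sq_rho[OF elim])
      finally have "(\<Sum>j\<in>UNIV. \<Sum>k\<in>UNIV. (pd k (B j k) x - pd j (B k k) x) * (x $ j * rho 0 (-1/2) x)) = ?H x" .
      moreover have "?F x = (\<Sum>j\<in>UNIV. \<Sum>k\<in>UNIV.
        ((pd k (\<lambda>y. g y $ j $ k) x - pd k (B j k) x) - (pd j (\<lambda>y. g y $ k $ k) x - pd j (B k k) x)) *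
        (x $ j * rho 0 (-1/2) x)) + (\<Sum>j\<in>UNIV. \<Sum>k\<in>UNIV. (pd k (B j k) x - pd j (B k k) x) * (x $ j * rho 0 (-1/2) x))"
        unfolding sum.distrib[symmetric] unit_eq by (intro sum.cong refl) (simp add: algebra_simps)
      ultimately show ?case by simp
    qed
  qed
  then have "((\<lambda>r. sphere_integral r ?F) \<longlongrightarrow> 16 * pi * m) at_top"
  proof (rule sphere_integral_limit)
    show "symbol (-2) ?H" by (intro symbol_cmult symbol_rho) simp
    show "\<forall>\<^sub>F r in at_top. has_sphere_integral r ?H (16 * pi * m)"
      using eventually_gt_at_top[of 0]
    proof eventually_elim
      case (elim r)
      have "has_sphere_integral r ?H (4 * m / r\<^sup>2 * (4 * pi * r\<^sup>2))"
      proof (rule has_sphere_integral_cong[OF has_sphere_integral_const])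
        fix x :: "real ^ 3" assume "norm x = \<bar>r\<bar>"
        with elim have "x \<noteq> 0" "norm x = r" by auto
        then show "4 * m / r\<^sup>2 = ?H x" by (simp add: rho_0_inverse)
      qed
      with elim show ?case by (simp add: mult_ac)
    qed
  qed simp
  from tendsto_mult_left[OF this, of "1 / (16 * pi)"] show ?thesis
    unfolding has_ADM_energy_def by simp
qed

end

text \<open>\<open>D1\<close> and \<open>D2\<close> are meant to be the derivatives of the
  unregularized c r^(1/3) A, which are exactly homogeneous. They differ from those of f by two
  orders less than their own size. They enter as parameters because the unregularized function is
  singular at the origin.\<close>

locale modelled_graph = asymptotic_graph +
  fixes D1 :: "3 \<Rightarrow> real ^ 3 \<Rightarrow> real" and D2 :: "3 \<Rightarrow> 3 \<Rightarrow> real ^ 3 \<Rightarrow> real"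
  assumes symbol_D1_diff: "\<And>i. symbol (-8/3) (\<lambda>x. pd i f x - D1 i x)"
    and symbol_D2_diff: "\<And>i j. symbol (-11/3) (\<lambda>x. pd i (pd j f) x - D2 i j x)"
begin

definition model_laplacian :: "real ^ 3 \<Rightarrow> real" where "model_laplacian x = (\<Sum>i\<in>UNIV. D2 i i x)"
definition N0 :: "real ^ 3 \<Rightarrow> real" where "N0 x = (\<Sum>i\<in>UNIV. D1 i x * D1 i x)"

lemma symbol_D1: "symbol (-2/3) (D1 i)"
  by (rule symbol_model[OF symbol_D1_diff symbol_pd_f]) simp

lemma symbol_D2: "symbol (-5/3) (D2 i j)"
  by (rule symbol_model[OF symbol_D2_diff symbol_pd_pd_f]) simp

lemma symbol_model_laplacian_diff: "symbol (-11/3) (\<lambda>x. laplacian x - model_laplacian x)"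
  unfolding laplacian_def model_laplacian_def sum_subtractf[symmetric] by (intro symbol_sum symbol_D2_diff)

lemma symbol_model_laplacian: "symbol (-5/3) model_laplacian"
  by (rule symbol_model[OF symbol_model_laplacian_diff symbol_laplacian]) simp

lemma symbol_trace_model_laplacian: "symbol (-8/3) (\<lambda>x. trace_of g k x - model_laplacian x)"
  by (rule symbol_trans[OF symbol_trace_diff symbol_weaken[OF symbol_model_laplacian_diff]]) simp

lemma symbol_N0_diff: "symbol (-7/3) (\<lambda>x. N x - N0 x)"
proof -
  have "symbol (-5/3) (\<lambda>x. (\<Sum>j\<in>UNIV. (spatial_metric_inv m x $ i $ j - (if i = j then 1 else 0)) * pd j f x)
      + (pd i f x - D1 i x))" for i
    by (intro symbol_add symbol_sum symbol_mult[OF symbol_spatial_metric_inv symbol_pd_f] symbol_weaken[OF symbol_D1_diff]) auto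
  then have "symbol (-5/3) (\<lambda>x. grad m f i x - D1 i x)" for i
    by (simp add: left_diff_distrib sum_subtractf sum_delta_mult grad_def)
  then show ?thesis
    unfolding N_def N0_def sum_subtractf[symmetric]
    by (intro symbol_sum symbol_mult_diff[OF symbol_D1_diff symbol_grad symbol_D1]) auto
qed

text \<open>The expansion 1 - v/2 of (1 + v)^(-1/2), where v = 2m/r - |df|^2 is \<open>wsq\<close> -
  1 up to O(r^(-2)). Its last term, multiplied by the Hessian, is one of the two sources of cubic
  terms.\<close>

definition z0 :: "real ^ 3 \<Rightarrow> real" where "z0 x = 1 - m * rho 0 (-1/2) x + N0 x / 2"

lemma symbol_z0_diff: "symbol (-2) (\<lambda>x. z x - z0 x)"
proof -
  have "symbol (-2) (\<lambda>x. (z x - 1 + (wsq m f x - 1) / 2) -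
     (1/2) * ((1 / lapse_sq m x - 1 - 2 * m * rho 0 (-1/2) x) - (N x - N0 x)))"
    by (intro symbol_diff symbol_cmult symbol_z_expansion symbol_inverse_lapse_sq_2 symbol_weaken[OF symbol_N0_diff]) simp
  then show ?thesis by (simp add: z0_def wsq_def N_def[symmetric] algebra_simps diff_divide_distrib add_divide_distrib)
qed

lemma symbol_z0: "symbol 0 z0"
  by (rule symbol_model[OF symbol_z0_diff symbol_z_0]) simp

lemma symbol_momentum_diff:
  "symbol (-8/3) (\<lambda>x. conjugate_momentum g k x $ i $ l - (D2 i l x - (if i = l then 1 else 0) * model_laplacian x))"
proof -
  have 1: "symbol (-8/3) (\<lambda>x. k x $ i $ l - D2 i l x)"
    by (rule symbol_trans[OF symbol_k_diff symbol_weaken[OF symbol_D2_diff]]) simp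
  have 2: "symbol (-8/3) (\<lambda>x. trace_of g k x * g x $ i $ l - model_laplacian x * (if i = l then 1 else 0))"
    by (rule symbol_mult_diff[OF symbol_trace_model_laplacian symbol_g_0 symbol_model_laplacian symbol_g_1]) auto
  from symbol_diff[OF 1 2] show ?thesis by (simp add: conjugate_momentum_def algebra_simps)
qed

text \<open>The second fundamental form up to O(r^(-11/3)). The factor z is kept only on the
  Hessian, because the other terms are already O(r^(-8/3)) and z - 1 is O(r^(-1)). In them the lapse
  becomes 1 and the Christoffel symbols \<open>mass_christoffel\<close>; the term with grad of the
  lapse and three factors df is O(r^(-4)) and drops out.\<close>

definition k0 :: "3 \<Rightarrow> 3 \<Rightarrow> real ^ 3 \<Rightarrow> real" where
  "k0 i j x = z0 x * D2 i j x + m * (x $ i * rho 0 (-3/2) x * D1 j x + x $ j * rho 0 (-3/2) x * D1 i x)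
     - (\<Sum>l\<in>UNIV. D1 l x * mass_christoffel m l i j x)"

lemma pd_lapse_sq_eq: "x \<noteq> 0 \<Longrightarrow> pd i (lapse_sq m) x = 2 * m * (x $ i * rho 0 (-3/2) x)"
proof -
  assume x: "x \<noteq> 0"
  have "pd i (lapse_sq m) x = - (2 * m * pd i (rho 0 (-1/2)) x)"
    unfolding lapse_sq_def[abs_def]
    by (subst pd_diff) (use x in \<open>auto simp: pd_cmult differentiable_rho intro!: differentiable_mult\<close>)
  then show ?thesis by (simp add: pd_rho x)
qed

lemma symbol_k0_diff: "symbol (-11/3) (\<lambda>x. k x $ i $ j - k0 i j x)"
proof -
  define A where "A i j = (\<lambda>x. m * (x $ i * rho 0 (-3/2) x * pd j f x + x $ j * rho 0 (-3/2) x * pd i f x))" for i j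
  define A0 where "A0 i j = (\<lambda>x. m * (x $ i * rho 0 (-3/2) x * D1 j x + x $ j * rho 0 (-3/2) x * D1 i x))" for i j
  define C where "C i j l = (\<lambda>x. christoffel (spatial_metric m) l i j x + (1/2) * (grad m (lapse_sq m) l x * (pd i f x * pd j f x)))" for i j l
  have x3: "symbol (-2) (\<lambda>x. x $ i * rho 0 (-3/2) x)" for i by (rule symbol_xr) simp
  have sA: "symbol (-8/3) (A i j)" for i j
    unfolding A_def by (intro symbol_cmult symbol_add symbol_mult[OF x3 symbol_pd_f]) simp_all
  have dA: "symbol (-11/3) (\<lambda>x. A i j x - A0 i j x)" for i j
  proof -
    have "symbol (-11/3) (\<lambda>x. m * (x $ i * rho 0 (-3/2) x * (pd j f x - D1 j x) + x $ j * rho 0 (-3/2) x * (pd i f x - D1 i x)))"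
      by (intro symbol_cmult symbol_add symbol_mult[OF x3 symbol_D1_diff]) simp_all
    then show ?thesis by (simp add: A_def A0_def algebra_simps)
  qed
  have "symbol (-1) (\<lambda>x. 1 / lapse_sq m x - 1)"
  proof -
    have "symbol (-1) (\<lambda>x. (1 / lapse_sq m x - 1 - 2 * m * rho 0 (-1/2) x) + 2 * m * rho 0 (-1/2) x)"
      by (intro symbol_add symbol_weaken[OF symbol_inverse_lapse_sq_2] symbol_cmult symbol_rho) auto
    then show ?thesis by simp
  qed
  then have Al: "symbol (-11/3) (\<lambda>x. A i j x * (1 / lapse_sq m x) - A0 i j x * 1)"
    by (intro symbol_mult_diff[OF dA symbol_inverse_lapse_sq symbol_model[OF dA sA]]) auto
  have C: "symbol (-2) (C i j l)" for l
    unfolding C_def by (intro symbol_add symbol_christoffel_spatial_metric_2 symbol_cmult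
        symbol_mult[OF symbol_grad_lapse_sq symbol_mult[OF symbol_pd_f symbol_pd_f, of "-4/3"]]) auto
  have "symbol (-3) (\<lambda>x. (christoffel (spatial_metric m) l i j x - mass_christoffel m l i j x)
      + (1/2) * (grad m (lapse_sq m) l x * (pd i f x * pd j f x)))" for l
    by (intro symbol_add symbol_christoffel_spatial_metric symbol_cmult
        symbol_mult[OF symbol_grad_lapse_sq symbol_mult[OF symbol_pd_f symbol_pd_f, of "-4/3"]]) auto
  then have dC: "symbol (-3) (\<lambda>x. C i j l x - mass_christoffel m l i j x)" for l
    by (simp add: C_def algebra_simps)
  have S: "symbol (-11/3) (\<lambda>x. (\<Sum>l\<in>UNIV. pd l f x * C i j l x) - (\<Sum>l\<in>UNIV. D1 l x * mass_christoffel m l i j x))"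
    unfolding sum_subtractf[symmetric]
    by (intro symbol_sum symbol_mult_diff[OF symbol_D1_diff C symbol_D1 dC]) auto
  have T: "symbol (-8/3) (\<lambda>x. A i j x * (1 / lapse_sq m x) - (\<Sum>l\<in>UNIV. pd l f x * C i j l x))"
    by (intro symbol_diff symbol_sum symbol_mult[OF sA symbol_inverse_lapse_sq] symbol_mult[OF symbol_pd_f C]) auto
  have "symbol (-11/3) (\<lambda>x. (z x * pd i (pd j f) x - z0 x * D2 i j x)
      + (z x - 1) * (A i j x * (1 / lapse_sq m x) - (\<Sum>l\<in>UNIV. pd l f x * C i j l x))
      + ((A i j x * (1 / lapse_sq m x) - A0 i j x * 1) -
         ((\<Sum>l\<in>UNIV. pd l f x * C i j l x) - (\<Sum>l\<in>UNIV. D1 l x * mass_christoffel m l i j x))))"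
    by (intro symbol_add symbol_diff symbol_mult_diff[OF symbol_z0_diff symbol_pd_pd_f symbol_z0 symbol_D2_diff]
        symbol_mult[OF symbol_z T] Al S) auto
  then show ?thesis
  proof (rule symbol_cong)
    show "\<forall>\<^sub>F x in at_infinity. (z x * pd i (pd j f) x - z0 x * D2 i j x)
      + (z x - 1) * (A i j x * (1 / lapse_sq m x) - (\<Sum>l\<in>UNIV. pd l f x * C i j l x))
      + ((A i j x * (1 / lapse_sq m x) - A0 i j x * 1) -
         ((\<Sum>l\<in>UNIV. pd l f x * C i j l x) - (\<Sum>l\<in>UNIV. D1 l x * mass_christoffel m l i j x))) =
      k x $ i $ j - k0 i j x"
      using k_eq[of i j] eventually_nonzero
    proof eventually_elim
      case (elim x)
      have "pd i (lapse_sq m) x * pd j f x + pd j (lapse_sq m) x * pd i f x = 2 * A i j x"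
        by (simp add: pd_lapse_sq_eq[OF elim(2)] A_def algebra_simps)
      then have "(pd i (lapse_sq m) x * pd j f x + pd j (lapse_sq m) x * pd i f x) * (1 / lapse_sq m x) / 2 = A i j x * (1 / lapse_sq m x)"
        by simp
      moreover have "(\<Sum>l\<in>UNIV. pd l f x * (christoffel (spatial_metric m) l i j x + grad m (lapse_sq m) l x / 2 * (pd i f x * pd j f x)))
        = (\<Sum>l\<in>UNIV. pd l f x * C i j l x)" by (simp add: C_def)
      ultimately have "k x $ i $ j = z x * (pd i (pd j f) x + A i j x * (1 / lapse_sq m x) - (\<Sum>l\<in>UNIV. pd l f x * C i j l x))"
        using elim(1) by simp
      then show ?case by (simp add: k0_def A0_def[symmetric]) (simp add: A0_def algebra_simps add_divide_distrib diff_divide_distrib)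
    qed
  qed
qed

text \<open>A field Y tangent to the spheres annihilates every part of the momentum tensor built
  from the identity and x x^T, in particular the mass Christoffel symbols and the slice metric in
  the trace term. Of the derivatives of the lapse only m Y(f)/r^2 survives, and of (tr k) g only the
  part -df df, which gives the second cubic term, the Laplacian times Y(f) times the radial
  derivative.\<close>

lemma symbol_angular_diff:
  assumes Y: "\<And>j. symbol 1 (Y j)" and orth: "\<And>x. (\<Sum>j\<in>UNIV. Y j x * x $ j) = 0"
  shows "symbol (-8/3) (\<lambda>x. (\<Sum>j\<in>UNIV. \<Sum>l\<in>UNIV. conjugate_momentum g k x $ j $ l * Y j x * (x $ l / norm x)) -
    (z0 x * (\<Sum>j\<in>UNIV. \<Sum>l\<in>UNIV. D2 j l x * Y j x * (x $ l * rho 0 (-1/2) x))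
     + m * rho 0 (-1) x * (\<Sum>j\<in>UNIV. D1 j x * Y j x)
     + model_laplacian x * (\<Sum>j\<in>UNIV. D1 j x * Y j x) * (\<Sum>l\<in>UNIV. D1 l x * (x $ l * rho 0 (-1/2) x))))"
proof -
  have ff: "symbol (-7/3) (\<lambda>x. (lapse_sq m x * pd j f x) * pd l f x - D1 j x * D1 l x)" for j l
  proof (rule symbol_mult_diff[OF _ symbol_pd_f symbol_D1 symbol_D1_diff])
    have "symbol (-5/3) (\<lambda>x. lapse_sq m x * pd j f x - 1 * D1 j x)"
      by (rule symbol_mult_diff[OF symbol_lapse_sq symbol_pd_f symbol_const[of 0] symbol_D1_diff]) auto
    then show "symbol (-5/3) (\<lambda>x. lapse_sq m x * pd j f x - D1 j x)" by simp
  qed auto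
  have ff0: "symbol (-4/3) (\<lambda>x. (lapse_sq m x * pd j f x) * pd l f x)" for j l
    by (rule symbol_mult[OF symbol_mult[OF symbol_lapse_sq_0 symbol_pd_f, of "-2/3"] symbol_pd_f]) auto
  define E where "E j l = (\<lambda>x. (k x $ j $ l - k0 j l x) +
      (trace_of g k x * ((lapse_sq m x * pd j f x) * pd l f x) - model_laplacian x * (D1 j x * D1 l x)))" for j l
  have E: "symbol (-11/3) (E j l)" for j l
    unfolding E_def
    by (intro symbol_add symbol_k0_diff symbol_mult_diff[OF symbol_trace_model_laplacian ff0 symbol_model_laplacian ff]) auto
  define w where "w l x = x $ l * rho 0 (-1/2) x" for l :: 3 and x :: "real ^ 3"
  have "symbol (-8/3) (\<lambda>x. \<Sum>j\<in>UNIV. \<Sum>l\<in>UNIV. E j l x * Y j x * w l x)"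
    unfolding w_def by (intro symbol_sum symbol_mult[OF symbol_mult[OF E Y] symbol_unit, of "-8/3"]) auto
  then show ?thesis
  proof (rule symbol_cong)
    show "\<forall>\<^sub>F x in at_infinity. (\<Sum>j\<in>UNIV. \<Sum>l\<in>UNIV. E j l x * Y j x * w l x) =
      (\<Sum>j\<in>UNIV. \<Sum>l\<in>UNIV. conjugate_momentum g k x $ j $ l * Y j x * (x $ l / norm x)) -
      (z0 x * (\<Sum>j\<in>UNIV. \<Sum>l\<in>UNIV. D2 j l x * Y j x * (x $ l * rho 0 (-1/2) x))
       + m * rho 0 (-1) x * (\<Sum>j\<in>UNIV. D1 j x * Y j x)
       + model_laplacian x * (\<Sum>j\<in>UNIV. D1 j x * Y j x) * (\<Sum>l\<in>UNIV. D1 l x * (x $ l * rho 0 (-1/2) x)))"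
      using eventually_nonzero
    proof eventually_elim
      case (elim x)
      \<comment> \<open>Contraction with Y^j x^l / r. It is linear and factorizes on products u_j
        v_l, so each term of the integrand can be evaluated separately.\<close>
      define con where "con T = (\<Sum>j\<in>UNIV. \<Sum>l\<in>UNIV. T j l * Y j x * w l x)" for T
      have con_delta: "con (\<lambda>j l. if j = l then 1 else 0) = 0"
      proof -
        have "con (\<lambda>j l. if j = l then 1 else 0) = rho 0 (-1/2) x * (\<Sum>j\<in>UNIV. Y j x * x $ j)"
          unfolding con_def mult.assoc by (simp only: sum_delta_mult) (simp add: w_def sum_distrib_left mult_ac)
        then show ?thesis by (simp add: orth)
      qed
      have con_rank: "con (\<lambda>j l. u j * v l) = (\<Sum>j\<in>UNIV. u j * Y j x) * (\<Sum>l\<in>UNIV. v l * w l x)" for u v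
        unfolding con_def sum_product by (simp add: mult_ac)
      have con_add: "con (\<lambda>j l. S j l + T j l) = con S + con T" for S T
        by (simp add: con_def distrib_right sum.distrib)
      have con_diff: "con (\<lambda>j l. S j l - T j l) = con S - con T" for S T
        by (simp add: con_def left_diff_distrib sum_subtractf)
      have con_cmult: "con (\<lambda>j l. a * T j l) = a * con T" for a T
        by (simp add: con_def sum_distrib_left mult_ac)
      have con_sum: "con (\<lambda>j l. \<Sum>p\<in>UNIV. T p j l) = (\<Sum>p\<in>UNIV. con (T p))" for T :: "3 \<Rightarrow> 3 \<Rightarrow> 3 \<Rightarrow> real"
        by (simp add: con_def sum_3 algebra_simps)
      have orth': "(\<Sum>j\<in>UNIV. x $ j * Y j x) = 0" using orth[of x] by (simp add: mult.commute)
      have con_christ: "con (\<lambda>j l. mass_christoffel m p j l x) = 0" for p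
      proof -
        have "con (\<lambda>j l. mass_christoffel m p j l x) = con (\<lambda>j l. (2 * m * x $ p * rho 0 (-3/2) x) * (if j = l then 1 else 0)
            - (3 * m * x $ p * rho 0 (-5/2) x) * (x $ j * x $ l))"
          by (intro arg_cong[where f = con] ext) (simp add: mass_christoffel_def algebra_simps)
        then show ?thesis by (simp only: con_diff con_cmult con_delta con_rank orth' mult_zero_left mult_zero_right diff_self)
      qed
      have con_spatial_metric: "con (\<lambda>j l. spatial_metric m x $ j $ l) = 0"
      proof -
        have "con (\<lambda>j l. spatial_metric m x $ j $ l) = con (\<lambda>j l. 1 * (if j = l then 1 else 0)
            + ((1 / lapse_sq m x - 1) * rho 0 (-1) x) * (x $ j * x $ l))"
          by (intro arg_cong[where f = con] ext) (simp add: spatial_metric_def)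
        also have "\<dots> = 0" by (simp only: con_add con_cmult con_delta con_rank orth' mult_zero_left mult_zero_right add_0_left)
        finally show ?thesis .
      qed
      have xw: "(\<Sum>l\<in>UNIV. x $ l * w l x) * rho 0 (-3/2) x = rho 0 (-1) x"
      proof -
        have "(\<Sum>l\<in>UNIV. x $ l * w l x) * rho 0 (-3/2) x = (norm x)\<^sup>2 * (rho 0 (-1/2) x * rho 0 (-3/2) x)"
          by (simp add: norm_sq_eq_sum w_def sum_3 algebra_simps)
        then show ?thesis by (simp add: rho_mult norm_sq_rho[OF elim])
      qed
      have "con (\<lambda>j l. k0 j l x) = con (\<lambda>j l. (z0 x * D2 j l x +
          ((m * rho 0 (-3/2) x) * (x $ j * D1 l x) + (m * rho 0 (-3/2) x) * (D1 j x * x $ l)))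
          - (\<Sum>p\<in>UNIV. D1 p x * mass_christoffel m p j l x))"
        by (intro arg_cong[where f = con] ext) (simp add: k0_def algebra_simps)
      also have "\<dots> = z0 x * con (\<lambda>j l. D2 j l x) +
          (m * rho 0 (-3/2) x) * (\<Sum>j\<in>UNIV. D1 j x * Y j x) * (\<Sum>l\<in>UNIV. x $ l * w l x)"
        by (simp only: con_diff con_add con_cmult con_sum con_rank con_christ orth') simp
      also have "\<dots> = z0 x * con (\<lambda>j l. D2 j l x) + m * (\<Sum>j\<in>UNIV. D1 j x * Y j x) * ((\<Sum>l\<in>UNIV. x $ l * w l x) * rho 0 (-3/2) x)"
        by (simp add: mult_ac)
      finally have k0: "con (\<lambda>j l. k0 j l x) = z0 x * con (\<lambda>j l. D2 j l x) + m * (\<Sum>j\<in>UNIV. D1 j x * Y j x) * rho 0 (-1) x"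
        unfolding xw .
      have "con (\<lambda>j l. E j l x) = con (\<lambda>j l. (conjugate_momentum g k x $ j $ l + trace_of g k x * spatial_metric m x $ j $ l)
          - (k0 j l x + model_laplacian x * (D1 j x * D1 l x)))"
        by (intro arg_cong[where f = con] ext) (simp add: E_def conjugate_momentum_def induced_metric_nth[OF elim] algebra_simps)
      also have "\<dots> = con (\<lambda>j l. conjugate_momentum g k x $ j $ l) -
          (z0 x * con (\<lambda>j l. D2 j l x) + m * (\<Sum>j\<in>UNIV. D1 j x * Y j x) * rho 0 (-1) x +
            model_laplacian x * (\<Sum>j\<in>UNIV. D1 j x * Y j x) * (\<Sum>l\<in>UNIV. D1 l x * w l x))"
        by (simp only: con_diff con_add con_cmult con_spatial_metric con_rank k0 mult_zero_right add_0_right mult.assoc)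
      finally show ?case by (simp add: con_def w_def unit_eq mult_ac)
    qed
  qed
qed

end

section \<open>Homogeneous functions\<close>

definition homogeneous :: "real \<Rightarrow> (real ^ 3 \<Rightarrow> real) \<Rightarrow> bool" where
  "homogeneous a h \<longleftrightarrow> (\<forall>r x. r > 0 \<longrightarrow> h (r *\<^sub>R x) = r powr a * h x)"

lemma homogeneous_mult:
  "homogeneous a f \<Longrightarrow> homogeneous b g \<Longrightarrow> a + b = c \<Longrightarrow> homogeneous c (\<lambda>x. f x * g x)"
  by (auto simp: homogeneous_def powr_add)

lemma homogeneous_add: "homogeneous a f \<Longrightarrow> homogeneous a g \<Longrightarrow> homogeneous a (\<lambda>x. f x + g x)"
  by (simp add: homogeneous_def distrib_left)

lemma homogeneous_diff: "homogeneous a f \<Longrightarrow> homogeneous a g \<Longrightarrow> homogeneous a (\<lambda>x. f x - g x)"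
  by (simp add: homogeneous_def right_diff_distrib)

lemma homogeneous_cmult: "homogeneous a f \<Longrightarrow> homogeneous a (\<lambda>x. c * f x)"
  by (simp add: homogeneous_def)

lemma homogeneous_sum: "(\<And>j. homogeneous a (f j)) \<Longrightarrow> homogeneous a (\<lambda>x. \<Sum>j\<in>A. f j x)"
  by (simp add: homogeneous_def sum_distrib_left)

lemma homogeneous_coord: "homogeneous 1 (\<lambda>x. x $ i)"
  by (simp add: homogeneous_def)

lemma homogeneous_rho: "2 * s = a \<Longrightarrow> homogeneous a (rho 0 s)"
  by (auto simp: homogeneous_def rho_0 powr_mult)

lemma homogeneous_xr: "1 + 2 * s = a \<Longrightarrow> homogeneous a (\<lambda>x. x $ i * rho 0 s x)"
  by (rule homogeneous_mult[OF homogeneous_coord homogeneous_rho]) auto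

lemma homogeneous_xxr: "2 + 2 * s = a \<Longrightarrow> homogeneous a (\<lambda>x. x $ i * x $ j * rho 0 s x)"
  by (rule homogeneous_mult[OF homogeneous_mult[OF homogeneous_coord homogeneous_coord refl] homogeneous_rho[OF refl]]) auto

lemma homogeneous_xxxr: "3 + 2 * s = a \<Longrightarrow> homogeneous a (\<lambda>x. x $ i * x $ j * x $ k * rho 0 s x)"
  by (rule homogeneous_mult[OF homogeneous_mult[OF homogeneous_mult[OF homogeneous_coord homogeneous_coord refl]
          homogeneous_coord refl] homogeneous_rho[OF refl]]) auto

lemma homogeneous_xxxxr: "4 + 2 * s = a \<Longrightarrow> homogeneous a (\<lambda>x. x $ i * x $ j * x $ k * x $ l * rho 0 s x)"
  by (rule homogeneous_mult[OF homogeneous_mult[OF homogeneous_mult[OF homogeneous_mult[OF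
          homogeneous_coord homogeneous_coord refl] homogeneous_coord refl] homogeneous_coord refl] homogeneous_rho[OF refl]]) auto

text \<open>Reduces every radius to the unit sphere, where all functions \<open>rho 0 s\<close> are
  1 and the integrands become polynomials.\<close>

lemma has_sphere_integral_homogeneous:
  assumes "homogeneous a h" "has_sphere_integral 1 h v" "r > 0"
  shows "has_sphere_integral r h (r powr (a + 2) * v)"
proof -
  have "sphere_point r \<theta> \<phi> = r *\<^sub>R sphere_point 1 \<theta> \<phi>" for \<theta> \<phi>
    by (simp add: vec_eq_iff forall_3 mult.assoc)
  then have eq: "h (sphere_point r \<theta> \<phi>) * (r\<^sup>2 * sin \<theta>) = r powr (a + 2) * (h (sphere_point 1 \<theta> \<phi>) * (1\<^sup>2 * sin \<theta>))" for \<theta> \<phi>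
    using assms(1,3) by (simp add: homogeneous_def powr_add)
  show ?thesis unfolding has_sphere_integral_def eq
    by (rule has_integral_mult_right[OF assms(2)[unfolded has_sphere_integral_def]])
qed

section \<open>The graph function\<close>

text \<open>The powers make both summands homogeneous of degree 1/3 at \<open>L = 0\<close>.\<close>

definition profile :: "real \<Rightarrow> real ^ 3 \<Rightarrow> real" where
  "profile L x = x $ 2 * rho L (-1/3) x + x $ 1 * x $ 2 * rho L (-5/6) x"

text \<open>Closed forms of the first derivatives, and in \<open>profile2\<close> of the second
  ones. They also make sense at \<open>L = 0\<close>, where they supply the homogeneous models
  \<open>D1\<close> and \<open>D2\<close>, whereas the profile itself is differentiated only for
  nonzero \<open>L\<close>.\<close>

definition profile1 :: "real \<Rightarrow> 3 \<Rightarrow> real ^ 3 \<Rightarrow> real" where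
  "profile1 L i x =
     (if i = 2 then 1 else 0) * rho L (-1/3) x - 2/3 * (x $ 2 * x $ i * rho L (-4/3) x)
     + (if i = 1 then 1 else 0) * (x $ 2 * rho L (-5/6) x) + (if i = 2 then 1 else 0) * (x $ 1 * rho L (-5/6) x)
     - 5/3 * (x $ 1 * x $ 2 * x $ i * rho L (-11/6) x)"

definition profile2 :: "real \<Rightarrow> 3 \<Rightarrow> 3 \<Rightarrow> real ^ 3 \<Rightarrow> real" where
  "profile2 L j i x =
     - 2/3 * ((if i = 2 then 1 else 0) * (x $ j * rho L (-4/3) x) + (if j = 2 then 1 else 0) * (x $ i * rho L (-4/3) x)
        + (if j = i then 1 else 0) * (x $ 2 * rho L (-4/3) x))
     + 16/9 * (x $ 2 * x $ i * x $ j * rho L (-7/3) x)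
     + ((if i = 1 then 1 else 0) * (if j = 2 then 1 else 0) + (if i = 2 then 1 else 0) * (if j = 1 then 1 else 0)) * rho L (-5/6) x
     - 5/3 * ((if i = 1 then 1 else 0) * (x $ 2 * x $ j * rho L (-11/6) x) + (if i = 2 then 1 else 0) * (x $ 1 * x $ j * rho L (-11/6) x)
        + (if j = 1 then 1 else 0) * (x $ 2 * x $ i * rho L (-11/6) x) + (if j = 2 then 1 else 0) * (x $ 1 * x $ i * rho L (-11/6) x)
        + (if j = i then 1 else 0) * (x $ 1 * x $ 2 * rho L (-11/6) x))
     + 55/9 * (x $ 1 * x $ 2 * x $ i * x $ j * rho L (-17/6) x)"

lemma differentiable_xr:
  assumes "x \<noteq> 0 \<or> L \<noteq> 0"
  shows "(\<lambda>x. x $ i * rho L s x) differentiable (at x)"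
    "(\<lambda>x. x $ i * x $ j * rho L s x) differentiable (at x)"
    "(\<lambda>x. x $ i * x $ j * x $ k * rho L s x) differentiable (at x)"
  using assms by (auto intro!: differentiable_mult differentiable_rho)

lemma pd_profile: "L \<noteq> 0 \<Longrightarrow> pd i (profile L) = profile1 L i"
proof
  fix x :: "real ^ 3" assume "L \<noteq> 0"
  then have L: "x \<noteq> 0 \<or> L \<noteq> 0" by blast
  show "pd i (profile L) x = profile1 L i x"
    unfolding profile_def profile1_def
    by (simp only: pd_add differentiable_xr[OF L] pd_xr[OF L] pd_xxr[OF L]) (simp add: algebra_simps)
qed

lemma pd_profile1: "L \<noteq> 0 \<Longrightarrow> pd j (profile1 L i) = profile2 L j i"
proof
  fix x :: "real ^ 3" assume "L \<noteq> 0"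
  then have L: "x \<noteq> 0 \<or> L \<noteq> 0" by blast
  have c: "pd j (\<lambda>x. a * (x $ i * rho L s x)) x = a * pd j (\<lambda>x. x $ i * rho L s x) x"
    "pd j (\<lambda>x. a * (x $ i * x $ k * rho L s x)) x = a * pd j (\<lambda>x. x $ i * x $ k * rho L s x) x"
    "pd j (\<lambda>x. a * (x $ i * x $ k * x $ l * rho L s x)) x = a * pd j (\<lambda>x. x $ i * x $ k * x $ l * rho L s x) x"
    "pd j (\<lambda>x. a * rho L s x) x = a * pd j (rho L s) x"
    for a s i k l by (intro pd_cmult differentiable_xr differentiable_rho L)+
  have d: "(\<lambda>x. a * (x $ i * rho L s x)) differentiable (at x)"
    "(\<lambda>x. a * (x $ i * x $ k * rho L s x)) differentiable (at x)"
    "(\<lambda>x. a * (x $ i * x $ k * x $ l * rho L s x)) differentiable (at x)"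
    "(\<lambda>x. a * rho L s x) differentiable (at x)" for a s i k l
    by (intro differentiable_mult differentiable_const differentiable_coord differentiable_rho L)+
  show "pd j (profile1 L i) x = profile2 L j i x"
    unfolding profile1_def profile2_def
    by (simp only: pd_diff pd_add d differentiable_add differentiable_diff c pd_rho[OF L] pd_xr[OF L] pd_xxr[OF L] pd_xxxr[OF L])
       (simp add: algebra_simps)
qed

lemma symbol_rho_times_diff:
  "symbol p M \<Longrightarrow> p + 2 * s - 2 \<le> a \<Longrightarrow> symbol a (\<lambda>x. M x * (rho L s x - rho 0 s x))"
  by (rule symbol_mult[OF _ symbol_rho_diff[of s "2 * s - 2"]]) auto

lemma symbol_monomials:
  "symbol 1 (\<lambda>x. x $ i)" "symbol 2 (\<lambda>x. x $ i * x $ j)" "symbol 3 (\<lambda>x. x $ i * x $ j * x $ k)"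
  "symbol 4 (\<lambda>x. x $ i * x $ j * x $ k * x $ l)"
  by (rule symbol_coord symbol_mult[OF symbol_coord[of 1] symbol_coord[of 1]]
      symbol_mult[OF symbol_mult[OF symbol_coord[of 1] symbol_coord[of 1], of 2] symbol_coord[of 1]]
      symbol_mult[OF symbol_mult[OF symbol_mult[OF symbol_coord[of 1] symbol_coord[of 1], of 2] symbol_coord[of 1], of 3] symbol_coord[of 1]]; simp)+

lemma symbol_profile: "symbol (1/3) (profile L)"
  unfolding profile_def[abs_def] by (intro symbol_add symbol_xr symbol_xxr) simp_all

lemma symbol_profile1_diff: "symbol (-8/3) (\<lambda>x. profile1 L i x - profile1 0 i x)"
proof -
  have eq: "profile1 L i x - profile1 0 i x =
     (if i = 2 then 1 else 0) * (rho L (-1/3) x - rho 0 (-1/3) x) - 2/3 * ((x $ 2 * x $ i) * (rho L (-4/3) x - rho 0 (-4/3) x))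
     + (if i = 1 then 1 else 0) * (x $ 2 * (rho L (-5/6) x - rho 0 (-5/6) x)) + (if i = 2 then 1 else 0) * (x $ 1 * (rho L (-5/6) x - rho 0 (-5/6) x))
     - 5/3 * ((x $ 1 * x $ 2 * x $ i) * (rho L (-11/6) x - rho 0 (-11/6) x))" for x
    unfolding profile1_def by (simp add: algebra_simps)
  show ?thesis unfolding eq
    by (intro symbol_add symbol_diff symbol_cmult symbol_rho_times_diff[OF symbol_monomials(1)]
        symbol_rho_times_diff[OF symbol_monomials(2)] symbol_rho_times_diff[OF symbol_monomials(3)] symbol_rho_diff) simp_all
qed

lemma symbol_profile2_diff: "symbol (-11/3) (\<lambda>x. profile2 L j i x - profile2 0 j i x)"
proof -
  have eq: "profile2 L j i x - profile2 0 j i x =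
     - 2/3 * ((if i = 2 then 1 else 0) * (x $ j * (rho L (-4/3) x - rho 0 (-4/3) x)) + (if j = 2 then 1 else 0) * (x $ i * (rho L (-4/3) x - rho 0 (-4/3) x))
        + (if j = i then 1 else 0) * (x $ 2 * (rho L (-4/3) x - rho 0 (-4/3) x)))
     + 16/9 * ((x $ 2 * x $ i * x $ j) * (rho L (-7/3) x - rho 0 (-7/3) x))
     + ((if i = 1 then 1 else 0) * (if j = 2 then 1 else 0) + (if i = 2 then 1 else 0) * (if j = 1 then 1 else 0)) * (rho L (-5/6) x - rho 0 (-5/6) x)
     - 5/3 * ((if i = 1 then 1 else 0) * ((x $ 2 * x $ j) * (rho L (-11/6) x - rho 0 (-11/6) x)) + (if i = 2 then 1 else 0) * ((x $ 1 * x $ j) * (rho L (-11/6) x - rho 0 (-11/6) x))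
        + (if j = 1 then 1 else 0) * ((x $ 2 * x $ i) * (rho L (-11/6) x - rho 0 (-11/6) x)) + (if j = 2 then 1 else 0) * ((x $ 1 * x $ i) * (rho L (-11/6) x - rho 0 (-11/6) x))
        + (if j = i then 1 else 0) * ((x $ 1 * x $ 2) * (rho L (-11/6) x - rho 0 (-11/6) x)))
     + 55/9 * ((x $ 1 * x $ 2 * x $ i * x $ j) * (rho L (-17/6) x - rho 0 (-17/6) x))" for x
    unfolding profile2_def by (simp add: algebra_simps)
  show ?thesis unfolding eq
    by (intro symbol_add symbol_diff symbol_cmult symbol_rho_times_diff[OF symbol_monomials(1)]
        symbol_rho_times_diff[OF symbol_monomials(2)] symbol_rho_times_diff[OF symbol_monomials(3)]
        symbol_rho_times_diff[OF symbol_monomials(4)] symbol_rho_diff) simp_all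
qed

lemma homogeneous_profile1: "homogeneous (-2/3) (profile1 0 i)"
  unfolding profile1_def[abs_def]
  by (intro homogeneous_add homogeneous_diff homogeneous_cmult homogeneous_xr homogeneous_xxr homogeneous_xxxr homogeneous_rho) simp_all

lemma homogeneous_profile2: "homogeneous (-5/3) (profile2 0 j i)"
  unfolding profile2_def[abs_def]
  by (intro homogeneous_add homogeneous_diff homogeneous_cmult homogeneous_xr homogeneous_xxr homogeneous_xxxr homogeneous_xxxxr homogeneous_rho) simp_all

lemma elementary_profile: "elementary UNIV L (\<lambda>x. c * profile L x)"
proof -
  have "elementary UNIV L (rho L s :: real ^ 3 \<Rightarrow> real)" for s
    unfolding rho_def[abs_def] norm_sq_eq_sum by (rule elementary.powr)
  then show ?thesis unfolding profile_def by (intro elementary.mult elementary.add elementary.const elementary.coord)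
qed

text \<open>As |x_i| is at most (r^2 + L^2)^(1/2), each of the five terms is at most its coefficient
  times \<open>rho L (-1/3)\<close>, and 1 + 2/3 + 1 + 1 + 5/3 = 16/3.\<close>

lemma profile1_bound:
  assumes "L \<noteq> 0"
  shows "\<bar>profile1 L i x\<bar> \<le> 16/3 * rho L (-1/3) x"
proof -
  have x: "\<bar>x $ i\<bar> \<le> rho L (1/2) x" for i
  proof -
    have "\<bar>x $ i\<bar> \<le> norm x" by (rule component_le_norm_cart)
    also have "\<dots> = sqrt ((norm x)\<^sup>2)" by simp
    also have "\<dots> \<le> sqrt ((norm x)\<^sup>2 + L\<^sup>2)" by simp
    finally show ?thesis by (simp add: rho_def powr_half_sqrt)
  qed
  have r: "rho L s x \<ge> 0" for s by (simp add: rho_def)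
  have 1: "\<bar>x $ i * rho L (-5/6) x\<bar> \<le> rho L (-1/3) x" for i
  proof -
    have "\<bar>x $ i * rho L (-5/6) x\<bar> \<le> rho L (1/2) x * rho L (-5/6) x"
      unfolding abs_mult using r by (intro mult_mono x) auto
    then show ?thesis by (simp add: rho_mult)
  qed
  have 2: "\<bar>x $ i * x $ j * rho L (-4/3) x\<bar> \<le> rho L (-1/3) x" for i j
  proof -
    have "\<bar>x $ i * x $ j * rho L (-4/3) x\<bar> \<le> rho L (1/2) x * rho L (1/2) x * rho L (-4/3) x"
      unfolding abs_mult using r by (intro mult_mono x) auto
    then show ?thesis by (simp add: rho_mult)
  qed
  have 3: "\<bar>x $ i * x $ j * x $ k * rho L (-11/6) x\<bar> \<le> rho L (-1/3) x" for i j k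
  proof -
    have "\<bar>x $ i * x $ j * x $ k * rho L (-11/6) x\<bar> \<le> rho L (1/2) x * rho L (1/2) x * rho L (1/2) x * rho L (-11/6) x"
      unfolding abs_mult using r by (intro mult_mono x) auto
    then show ?thesis by (simp add: rho_mult)
  qed
  have d: "\<bar>(if P then 1 else 0) * t\<bar> \<le> R" if "\<bar>t\<bar> \<le> R" for P t and R :: real
    using that by auto
  show ?thesis unfolding profile1_def
    using d[of "rho L (-1/3) x" "rho L (-1/3) x" "i = 2"] d[OF 1[of 2], of "i = 1"] d[OF 1[of 1], of "i = 2"]
      2[of 2 i] 3[of 1 2 i] r[of "-1/3"] by linarith
qed

section \<open>Spacelike graphs\<close>

lemma elementary_spatial:
  "elementary UNIV L h \<Longrightarrow> elementary (range spatial_index) L (\<lambda>q. h (spatial q))"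
proof (induction rule: elementary.induct)
  case (powr s)
  have "(\<Sum>i\<in>UNIV. q $ spatial_index i * q $ spatial_index i) = (\<Sum>a\<in>range spatial_index. q $ a * q $ a)" for q :: "real ^ 4"
    by (simp add: sum.reindex inj_def)
  then show ?case using elementary.powr[of "range spatial_index" L s] by simp
qed (simp_all add: elementary.const elementary.coord elementary.add elementary.mult)

text \<open>Outside the horizon 0 < \<open>lapse_sq\<close> \<le> 1, so compared with the Minkowski
  form the time coefficient shrinks and the radial one grows. A Euclidean gradient bound therefore
  makes a graph spacelike all the way to the horizon.\<close>

lemma schwarzschild_ge:
  assumes "m > 0" "norm (spatial p) > 2 * m"
  shows "metric_apply (schwarzschild m p) v v \<ge> (norm (spatial v))\<^sup>2 - (v $ 1)\<^sup>2"
proof -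
  define x where "x = spatial p"
  have x: "x \<noteq> 0" "spatial p \<noteq> 0" using assms by (auto simp: x_def)
  have l: "lapse_sq m x > 0" using assms lapse_sq_pos[of m x] by (simp add: x_def)
  have "lapse_sq m x \<le> 1" using assms(1) by (simp add: lapse_sq_eq[OF x(1)])
  note l = l this
  have "(\<Sum>i\<in>UNIV. \<Sum>j\<in>UNIV. spatial_metric m x $ i $ j * v $ spatial_index i * v $ spatial_index j) =
     (norm (spatial v))\<^sup>2 + (1 / lapse_sq m x - 1) * rho 0 (-1) x * (\<Sum>i\<in>UNIV. x $ i * v $ spatial_index i)\<^sup>2"
    unfolding norm_sq_eq_sum sum_3 spatial_metric_def by (simp add: power2_eq_square algebra_simps)
  moreover have "(1 / lapse_sq m x - 1) * rho 0 (-1) x * (\<Sum>i\<in>UNIV. x $ i * v $ spatial_index i)\<^sup>2 \<ge> 0"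
    using l by (intro mult_nonneg_nonneg) (auto simp: rho_def)
  moreover have "lapse_sq m x * (v $ 1 * v $ 1) \<le> 1 * (v $ 1 * v $ 1)"
    using l by (intro mult_right_mono) auto
  ultimately show ?thesis
    unfolding metric_apply_schwarzschild[OF x(2)] x_def[symmetric] by (simp add: power2_eq_square)
qed

text \<open>A tangent vector satisfies v^0 = df(v), and three partial derivatives of size at most
  1/6 give |v^0| \<le> |v|/2 for the Euclidean length of the spatial part. The graph covers the
  whole exterior, so the single function t - f defines it near every point; 3m is just a radius
  beyond 2m.\<close>

lemma spacelike_graph:
  fixes f :: "real ^ 3 \<Rightarrow> real"
  assumes m: "m > 0" and f: "elementary UNIV L f" and L: "L \<noteq> 0"
    and grad: "\<And>i x. \<bar>pd i f x\<bar> \<le> 1/6"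
  defines "S \<equiv> graph_point f ` {x. norm x > 2 * m}"
  shows "spacelike_hypersurface m S" "graph_end m S (3 * m) f"
proof -
  have df: "f differentiable (at x)" for x by (rule elementary_differentiable[OF f L])
  then have cf: "continuous_on T f" for T
    by (intro continuous_at_imp_continuous_on ballI differentiable_imp_continuous_within)
  have S: "S = exterior m \<inter> {q. q $ 1 = f (spatial q)}"
  proof (intro set_eqI iffI)
    fix q assume "q \<in> exterior m \<inter> {q. q $ 1 = f (spatial q)}"
    moreover from this have "q = graph_point f (spatial q)"
      by (auto simp: vec_eq_iff) (metis spatial_index_cases graph_point_nth spatial_nth)
    ultimately show "q \<in> S" unfolding S_def exterior_def by blast
  qed (auto simp: S_def exterior_def)
  \<comment> \<open>Written with sums and products only, so that the rules of
    \<open>elementary\<close> apply.\<close>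
  define F where "F = (\<lambda>q :: real ^ 4. q $ 1 + (-1) * f (spatial q))"
  have eF: "elementary (range spatial_index) L F"
    unfolding F_def by (intro elementary.add elementary.coord elementary.mult elementary.const elementary_spatial f)
  have pdF: "pd 1 F q = 1" "pd (spatial_index i) F q = - pd i f (spatial q)" for q i
  proof -
    have d: "(\<lambda>q. f (spatial q)) differentiable (at q)"
      by (rule elementary_differentiable[OF elementary_spatial[OF f] L])
    have "pd a F q = pd a (\<lambda>q. q $ 1) q + pd a (\<lambda>q. (-1) * f (spatial q)) q" for a
      unfolding F_def by (intro pd_add differentiable_mult differentiable_const differentiable_coord d)
    then have "pd a F q = pd a (\<lambda>q. q $ 1) q + (-1) * pd a (\<lambda>q. f (spatial q)) q" for a
      unfolding pd_cmult[OF d] .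
    then show "pd 1 F q = 1" "pd (spatial_index i) F q = - pd i f (spatial q)" by simp_all
  qed
  show "spacelike_hypersurface m S"
    unfolding spacelike_hypersurface_def
  proof (intro conjI ballI)
    show "S \<subseteq> exterior m" unfolding S by blast
    fix p assume "p \<in> S"
    show "\<exists>U F. p \<in> U \<and> smooth_on U F \<and> S \<inter> U = {q \<in> U. F q = 0} \<and>
        (\<forall>q\<in>U. \<exists>a. pd a F q \<noteq> 0) \<and>
        (\<forall>q\<in>S \<inter> U. \<forall>v. v \<noteq> 0 \<longrightarrow> (\<Sum>a\<in>UNIV. pd a F q * v $ a) = 0 \<longrightarrow>
           metric_apply (schwarzschild m q) v v > 0)"
    proof (rule exI[of _ "exterior m"], rule exI[of _ F], intro conjI ballI allI impI)
      show "p \<in> exterior m" using \<open>p \<in> S\<close> by (simp add: S)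
      show "smooth_on (exterior m) F" by (rule elementary_smooth[OF eF L open_exterior])
      show "S \<inter> exterior m = {q \<in> exterior m. F q = 0}" by (auto simp: S F_def)
      show "\<exists>a. pd a F q \<noteq> 0" for q by (rule exI[of _ 1]) (simp add: pdF)
      fix q v assume q: "q \<in> S \<inter> exterior m" and v: "v \<noteq> 0" and tan: "(\<Sum>a\<in>UNIV. pd a F q * v $ a) = 0"
      let ?w = "norm (spatial v)"
      have v1: "v $ 1 = (\<Sum>i\<in>UNIV. pd i f (spatial q) * v $ spatial_index i)"
        using tan by (simp add: sum_spatial_index pdF sum_negf)
      have w: "?w > 0"
      proof (rule ccontr)
        assume "\<not> ?w > 0"
        then have "spatial v = 0" by simp
        then have "v $ spatial_index i = 0" for i by (metis spatial_nth zero_index)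
        then have "v $ a = 0" for a using v1 by (cases a rule: spatial_index_cases) auto
        with v show False by (simp add: vec_eq_iff)
      qed
      have "\<bar>v $ 1\<bar> \<le> (\<Sum>i\<in>(UNIV :: 3 set). (1/6) * ?w)"
        unfolding v1
      proof (rule order_trans[OF sum_abs sum_mono])
        fix i :: 3
        have "\<bar>v $ spatial_index i\<bar> \<le> ?w" using component_le_norm_cart[of "spatial v" i] by simp
        then show "\<bar>pd i f (spatial q) * v $ spatial_index i\<bar> \<le> (1/6) * ?w"
          unfolding abs_mult by (intro mult_mono grad) auto
      qed
      then have "\<bar>v $ 1\<bar> * 2 \<le> ?w" by simp
      with w have "\<bar>v $ 1\<bar> < ?w" by linarith
      then have "\<bar>v $ 1\<bar>\<^sup>2 < ?w\<^sup>2" by (intro power_strict_mono) auto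
      then have "(v $ 1)\<^sup>2 < ?w\<^sup>2" by simp
      moreover have "metric_apply (schwarzschild m q) v v \<ge> ?w\<^sup>2 - (v $ 1)\<^sup>2"
        using q by (intro schwarzschild_ge m) (auto simp: exterior_def)
      ultimately show "metric_apply (schwarzschild m q) v v > 0" by linarith
    qed
  qed
  have graph: "S \<inter> {p. norm (spatial p) > 3 * m} = graph_point f ` {x. norm x > 3 * m}"
    using m by (auto simp: S_def)
  have open_ball: "open {x :: real ^ 3. norm x > 3 * m}"
    by (intro open_Collect_less continuous_intros)
  have "closed {q :: real ^ 4. q $ 1 = f (spatial q)}"
    by (intro closed_Collect_eq continuous_intros continuous_on_compose2[OF cf continuous_spatial]) auto
  then have closedin: "closedin (top_of_set (exterior m)) S"
    unfolding S by (rule closedin_closed_Int)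
  have "bounded (f ` cball 0 (3 * m))"
    by (intro compact_imp_bounded compact_continuous_image cf compact_cball)
  then obtain B where "\<forall>y\<in>f ` cball 0 (3 * m). norm y \<le> B" unfolding bounded_iff by blast
  then have B: "\<bar>f x\<bar> \<le> B" if "norm x \<le> 3 * m" for x using that by simp
  have "bounded (S \<inter> {p. norm (spatial p) \<le> 3 * m})"
    unfolding bounded_iff
  proof (intro exI[of _ "B + 9 * m"] ballI)
    fix p assume "p \<in> S \<inter> {p. norm (spatial p) \<le> 3 * m}"
    then have p: "p $ 1 = f (spatial p)" "norm (spatial p) \<le> 3 * m" by (auto simp: S)
    have "norm p \<le> (\<Sum>a\<in>UNIV. \<bar>p $ a\<bar>)" by (rule norm_le_l1_cart)
    also have "\<dots> = \<bar>f (spatial p)\<bar> + (\<Sum>i\<in>UNIV. \<bar>spatial p $ i\<bar>)" by (simp add: sum_spatial_index p(1))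
    also have "\<dots> \<le> B + (\<Sum>i\<in>(UNIV :: 3 set). 3 * m)"
      using p(2) by (intro add_mono B sum_mono order_trans[OF component_le_norm_cart])
    finally show "norm p \<le> B + 9 * m" by simp
  qed
  then show "graph_end m S (3 * m) f"
    unfolding graph_end_def using m graph closedin elementary_smooth[OF f L open_ball] by simp
qed

section \<open>The graph function on the unit sphere\<close>

definition unit_profile1 :: "3 \<Rightarrow> real ^ 3 \<Rightarrow> real" where
  "unit_profile1 i x = (if i = 2 then 1 + x $ 1 else 0) + (if i = 1 then x $ 2 else 0)
     - (2/3 * x $ 2 + 5/3 * (x $ 1 * x $ 2)) * x $ i"

text \<open>A spherical harmonic of degree l times r^(1/3) has Laplacian (4/9 - l(l + 1)) times
  itself on the unit sphere: -14/9 for y (l = 1) and -50/9 for xy (l = 2).\<close>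

definition unit_laplacian :: "real ^ 3 \<Rightarrow> real" where
  "unit_laplacian x = - 14/9 * x $ 2 - 50/9 * (x $ 1 * x $ 2)"

lemma unit_sphere_rho: "norm x = 1 \<Longrightarrow> rho 0 s x = 1"
  by (simp add: rho_0)

lemma unit_sphere_sum: "norm x = 1 \<Longrightarrow> x $ 1 * x $ 1 + x $ 2 * x $ 2 + x $ 3 * x $ 3 = 1"
  for x :: "real ^ 3"
  using norm_sq_eq_sum[of x] by (simp add: sum_3)

lemma profile1_unit: "norm x = 1 \<Longrightarrow> profile1 0 i x = unit_profile1 i x"
  unfolding profile1_def unit_profile1_def by (simp only: unit_sphere_rho) (auto simp: algebra_simps)

text \<open>Euler's identity for the derivatives, which are homogeneous of degree \<open>- 2/3\<close>.\<close>

lemma profile2_unit: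
  assumes "norm x = 1"
  shows "(\<Sum>l\<in>UNIV. profile2 0 i l x * x $ l) = - 2/3 * unit_profile1 i x"
proof -
  let ?R = "x $ 1 * x $ 1 + x $ 2 * x $ 2 + x $ 3 * x $ 3"
  have "(\<Sum>l\<in>UNIV. profile2 0 i l x * x $ l) =
      - 2/3 * (2 * (x $ 2 * x $ i) + (if i = 2 then 1 else 0) * ?R) + 16/9 * (x $ 2 * x $ i * ?R)
      + (if i = 2 then x $ 1 else 0) + (if i = 1 then x $ 2 else 0)
      - 5/3 * (3 * (x $ 1 * x $ 2 * x $ i) + (if i = 1 then x $ 2 else 0) * ?R + (if i = 2 then x $ 1 else 0) * ?R)
      + 55/9 * (x $ 1 * x $ 2 * x $ i * ?R)"
    unfolding profile2_def unit_sphere_rho[OF assms] sum_3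
    using exhaust_3[of i] by (elim disjE) (simp_all add: algebra_simps)
  then show ?thesis unfolding unit_sphere_sum[OF assms] unit_profile1_def
    by (cases "i = 1"; cases "i = 2") (simp_all add: algebra_simps add_divide_distrib)
qed

lemma profile2_trace_unit:
  assumes "norm x = 1"
  shows "(\<Sum>i\<in>UNIV. profile2 0 i i x) = unit_laplacian x"
proof -
  let ?R = "x $ 1 * x $ 1 + x $ 2 * x $ 2 + x $ 3 * x $ 3"
  have "(\<Sum>i\<in>UNIV. profile2 0 i i x) = - 10/3 * x $ 2 + 16/9 * (x $ 2 * ?R)
      - 35/3 * (x $ 1 * x $ 2) + 55/9 * (x $ 1 * x $ 2 * ?R)"
    unfolding profile2_def unit_sphere_rho[OF assms] sum_3 by (simp add: algebra_simps)
  then show ?thesis unfolding unit_sphere_sum[OF assms] unit_laplacian_def by (simp add: algebra_simps)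
qed

text \<open>Euler's identity for r^(1/3) A, homogeneous of degree 1/3.\<close>

lemma unit_profile1_radial:
  assumes "norm x = 1"
  shows "(\<Sum>i\<in>UNIV. unit_profile1 i x * x $ i) = (x $ 2 + x $ 1 * x $ 2) / 3"
proof -
  have "(\<Sum>i\<in>UNIV. unit_profile1 i x * x $ i) = x $ 2 + 2 * (x $ 1 * x $ 2)
      - (2/3 * x $ 2 + 5/3 * (x $ 1 * x $ 2)) * (x $ 1 * x $ 1 + x $ 2 * x $ 2 + x $ 3 * x $ 3)"
    unfolding unit_profile1_def sum_3 by (simp add: algebra_simps)
  then show ?thesis unfolding unit_sphere_sum[OF assms] by (simp add: field_simps)
qed

lemma unit_profile1_norm:
  assumes "norm x = 1"
  shows "(\<Sum>i\<in>UNIV. unit_profile1 i x * unit_profile1 i x) = x $ 2 * x $ 2 + (1 + x $ 1) * (1 + x $ 1)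
    - 2 * (2/3 * x $ 2 + 5/3 * (x $ 1 * x $ 2)) * (x $ 2 + 2 * (x $ 1 * x $ 2))
    + (2/3 * x $ 2 + 5/3 * (x $ 1 * x $ 2)) * (2/3 * x $ 2 + 5/3 * (x $ 1 * x $ 2))"
proof -
  have "(\<Sum>i\<in>UNIV. unit_profile1 i x * unit_profile1 i x) = x $ 2 * x $ 2 + (1 + x $ 1) * (1 + x $ 1)
    - 2 * (2/3 * x $ 2 + 5/3 * (x $ 1 * x $ 2)) * (x $ 2 + 2 * (x $ 1 * x $ 2))
    + (2/3 * x $ 2 + 5/3 * (x $ 1 * x $ 2)) * (2/3 * x $ 2 + 5/3 * (x $ 1 * x $ 2))
      * (x $ 1 * x $ 1 + x $ 2 * x $ 2 + x $ 3 * x $ 3)"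
    unfolding unit_profile1_def sum_3 by (simp add: algebra_simps add_divide_distrib)
  then show ?thesis unfolding unit_sphere_sum[OF assms] by simp
qed

section \<open>Rotation fields and the polynomial integrals over the unit sphere\<close>

definition rot :: "3 \<Rightarrow> 3 \<Rightarrow> real ^ 3 \<Rightarrow> real" where
  "rot i j x = cross3 (axis i 1) x $ j"

lemma rot_simps:
  "rot 1 1 x = 0" "rot 1 2 x = - x $ 3" "rot 1 3 x = x $ 2"
  "rot 2 1 x = x $ 3" "rot 2 2 x = 0" "rot 2 3 x = - x $ 1"
  "rot 3 1 x = - x $ 2" "rot 3 2 x = x $ 1" "rot 3 3 x = 0"
  by (simp_all add: rot_def cross_components axis_def)

lemma rot_orthogonal: "(\<Sum>j\<in>UNIV. rot i j x * x $ j) = 0"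
  using dot_cross_self(3)[of "axis i 1" x] by (simp add: rot_def inner_vec_def)

lemma symbol_rot: "symbol 1 (rot i j)"
proof -
  have "symbol 1 (\<lambda>x. - x $ k)" "symbol 1 (\<lambda>x. x $ k)" "symbol 1 (\<lambda>x::real^3. 0)" for k :: 3
    by (intro symbol_minus symbol_coord symbol_zero order_refl)+
  then show ?thesis
    using exhaust_3[of i] exhaust_3[of j] by (elim disjE) (simp_all add: rot_simps[abs_def])
qed

lemma homogeneous_rot: "homogeneous 1 (rot i j)"
  by (simp add: homogeneous_def rot_def cross_mult_right)

text \<open>This is Y(A): rotation fields are tangent to the sphere, so the factor r^(1/3) is not
  differentiated.\<close>

definition unit_rot :: "3 \<Rightarrow> real ^ 3 \<Rightarrow> real" where
  "unit_rot i x = (\<Sum>j\<in>UNIV. unit_profile1 j x * rot i j x)"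

text \<open>The exponents 0 and 1 are kept so that each term matches
  \<open>has_sphere_integral_monomial\<close> literally.\<close>

lemma unit_rot_simps:
  "unit_rot 1 x = (-1) * (x $ 1 ^ 0 * x $ 2 ^ 0 * x $ 3 ^ 1) + (-1) * (x $ 1 ^ 1 * x $ 2 ^ 0 * x $ 3 ^ 1)"
  "unit_rot 2 x = x $ 1 ^ 0 * x $ 2 ^ 1 * x $ 3 ^ 1"
  "unit_rot 3 x = x $ 1 ^ 1 * x $ 2 ^ 0 * x $ 3 ^ 0 + (x $ 1 ^ 2 * x $ 2 ^ 0 * x $ 3 ^ 0
     + (-1) * (x $ 1 ^ 0 * x $ 2 ^ 2 * x $ 3 ^ 0))"
  by (simp_all add: unit_rot_def unit_profile1_def rot_simps sum_3 algebra_simps power2_eq_square)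

lemma has_sphere_integral_eqI: "has_sphere_integral r h v \<Longrightarrow> v = w \<Longrightarrow> has_sphere_integral r h w"
  by simp

text \<open>Rotations preserve the area, so a derivative along a rotation field has mean zero; with
  the explicit polynomials this is a check on moments. It eliminates all terms linear in the graph
  function.\<close>

lemma unit_rot_integral: "has_sphere_integral 1 (unit_rot i) 0"
proof -
  have "has_sphere_integral 1 (unit_rot 1) 0"
    unfolding unit_rot_simps(1)[abs_def]
    by (rule has_sphere_integral_eqI, (rule has_sphere_integral_add has_sphere_integral_cmult has_sphere_integral_monomial)+)
       (simp add: polar_int_simps azimuth_int_simps)
  moreover have "has_sphere_integral 1 (unit_rot 2) 0"
    unfolding unit_rot_simps(2)[abs_def]
    by (rule has_sphere_integral_eqI, rule has_sphere_integral_monomial)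
       (simp add: polar_int_simps azimuth_int_simps)
  moreover have "has_sphere_integral 1 (unit_rot 3) 0"
    unfolding unit_rot_simps(3)[abs_def]
    by (rule has_sphere_integral_eqI, (rule has_sphere_integral_add has_sphere_integral_cmult has_sphere_integral_monomial)+)
       (simp add: polar_int_simps azimuth_int_simps eval_nat_numeral)
  ultimately show ?thesis using exhaust_3[of i] by auto
qed

text \<open>On the unit sphere the part of the angular momentum integrand that is cubic in the graph function;
  the parts that are linear in it integrate to zero and the others vanish in the limit.\<close>

definition unit_cubic :: "3 \<Rightarrow> real ^ 3 \<Rightarrow> real" where
  "unit_cubic i x = 1/2 * (\<Sum>j\<in>UNIV. unit_profile1 j x * unit_profile1 j x) * (- 2/3 * unit_rot i x)
     + unit_laplacian x * unit_rot i x * (\<Sum>l\<in>UNIV. unit_profile1 l x * x $ l)"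

lemma unit_cubic_integral: "has_sphere_integral 1 (unit_cubic i) (sphere_integral 1 (unit_cubic i))"
proof (rule has_sphere_integral_continuous)
  fix x :: "real ^ 3"
  have "isCont (unit_profile1 j) x" for j
    unfolding unit_profile1_def[abs_def] by (cases "j = 1"; cases "j = 2"; simp; intro continuous_intros)
  moreover have "isCont (rot i j) x" for j
    using exhaust_3[of i] exhaust_3[of j]
    by (elim disjE) (simp_all add: rot_simps[abs_def] isCont_minus continuous_component)
  ultimately show "isCont (unit_cubic i) x"
    unfolding unit_cubic_def[abs_def] unit_rot_def unit_laplacian_def by (intro continuous_intros)
qed

text \<open>In the expanded polynomial only monomials even in both variables contribute. The sphere
  means are 1/3 for a square, 1/5 for a fourth power and 1/15 for x_1^2 x_2^2, and the two sextic
  terms cancel; the mean is -4/15, to be multiplied by 4 pi.\<close>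

lemma unit_cubic_3_integral: "has_sphere_integral 1 (unit_cubic 3) (- 16/15 * pi)"
proof (rule has_sphere_integral_cong)
  show "has_sphere_integral 1 (\<lambda>x. (1/3) * (x $ 1 ^ 0 * x $ 2 ^ 2 * x $ 3 ^ 0) + ((5/9) * (x $ 1 ^ 0 * x $ 2 ^ 4 * x $ 3 ^ 0)
    + ((-1/3) * (x $ 1 ^ 1 * x $ 2 ^ 0 * x $ 3 ^ 0) + ((1/9) * (x $ 1 ^ 1 * x $ 2 ^ 2 * x $ 3 ^ 0)
    + ((10/9) * (x $ 1 ^ 1 * x $ 2 ^ 4 * x $ 3 ^ 0) + ((-1) * (x $ 1 ^ 2 * x $ 2 ^ 0 * x $ 3 ^ 0)
    + ((-4/3) * (x $ 1 ^ 2 * x $ 2 ^ 2 * x $ 3 ^ 0) + ((5/9) * (x $ 1 ^ 2 * x $ 2 ^ 4 * x $ 3 ^ 0)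
    + ((-1) * (x $ 1 ^ 3 * x $ 2 ^ 0 * x $ 3 ^ 0) + ((-5/3) * (x $ 1 ^ 3 * x $ 2 ^ 2 * x $ 3 ^ 0)
    + ((-1/3) * (x $ 1 ^ 4 * x $ 2 ^ 0 * x $ 3 ^ 0) + (-5/9) * (x $ 1 ^ 4 * x $ 2 ^ 2 * x $ 3 ^ 0)))))))))))) (- 16/15 * pi)"
    by (rule has_sphere_integral_eqI, (rule has_sphere_integral_add has_sphere_integral_cmult has_sphere_integral_monomial)+)
       (simp add: polar_int_simps azimuth_int_simps eval_nat_numeral)
  fix x :: "real ^ 3" assume "norm x = \<bar>1\<bar>"
  then have x: "norm x = 1" by simp
  show "(1/3) * (x $ 1 ^ 0 * x $ 2 ^ 2 * x $ 3 ^ 0) + ((5/9) * (x $ 1 ^ 0 * x $ 2 ^ 4 * x $ 3 ^ 0)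
    + ((-1/3) * (x $ 1 ^ 1 * x $ 2 ^ 0 * x $ 3 ^ 0) + ((1/9) * (x $ 1 ^ 1 * x $ 2 ^ 2 * x $ 3 ^ 0)
    + ((10/9) * (x $ 1 ^ 1 * x $ 2 ^ 4 * x $ 3 ^ 0) + ((-1) * (x $ 1 ^ 2 * x $ 2 ^ 0 * x $ 3 ^ 0)
    + ((-4/3) * (x $ 1 ^ 2 * x $ 2 ^ 2 * x $ 3 ^ 0) + ((5/9) * (x $ 1 ^ 2 * x $ 2 ^ 4 * x $ 3 ^ 0)
    + ((-1) * (x $ 1 ^ 3 * x $ 2 ^ 0 * x $ 3 ^ 0) + ((-5/3) * (x $ 1 ^ 3 * x $ 2 ^ 2 * x $ 3 ^ 0)
    + ((-1/3) * (x $ 1 ^ 4 * x $ 2 ^ 0 * x $ 3 ^ 0) + (-5/9) * (x $ 1 ^ 4 * x $ 2 ^ 2 * x $ 3 ^ 0))))))))))) = unit_cubic 3 x"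
    unfolding unit_cubic_def unit_profile1_norm[OF x] unit_profile1_radial[OF x] unit_rot_simps unit_laplacian_def
    by (simp add: field_simps power2_eq_square eval_nat_numeral)
qed

text \<open>Behind this is a scaling argument: the Hessian minus the Laplacian times the identity is
  divergence free, so its flux is the same through all spheres, yet homogeneity makes it grow like
  r^(1/3); hence it is zero. The proof verifies this on monomials.\<close>

lemma unit_momentum_integral:
  "has_sphere_integral 1 (\<lambda>x. - 2/3 * unit_profile1 i x - unit_laplacian x * x $ i) 0"
proof -
  have 1: "has_sphere_integral 1 (\<lambda>x. (-2/3) * (x $ 1 ^ 0 * x $ 2 ^ 1 * x $ 3 ^ 0) + (2 * (x $ 1 ^ 1 * x $ 2 ^ 1 * x $ 3 ^ 0)
      + 20/3 * (x $ 1 ^ 2 * x $ 2 ^ 1 * x $ 3 ^ 0))) 0"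
    by (rule has_sphere_integral_eqI, (rule has_sphere_integral_add has_sphere_integral_cmult has_sphere_integral_monomial)+)
       (simp add: polar_int_simps azimuth_int_simps eval_nat_numeral)
  have 2: "has_sphere_integral 1 (\<lambda>x. (-2/3) * (x $ 1 ^ 0 * x $ 2 ^ 0 * x $ 3 ^ 0) + (2 * (x $ 1 ^ 0 * x $ 2 ^ 2 * x $ 3 ^ 0)
      + ((-2/3) * (x $ 1 ^ 1 * x $ 2 ^ 0 * x $ 3 ^ 0) + 20/3 * (x $ 1 ^ 1 * x $ 2 ^ 2 * x $ 3 ^ 0)))) 0"
    by (rule has_sphere_integral_eqI, (rule has_sphere_integral_add has_sphere_integral_cmult has_sphere_integral_monomial)+)
       (simp add: polar_int_simps azimuth_int_simps eval_nat_numeral)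
  have 3: "has_sphere_integral 1 (\<lambda>x. 2 * (x $ 1 ^ 0 * x $ 2 ^ 1 * x $ 3 ^ 1)
      + 20/3 * (x $ 1 ^ 1 * x $ 2 ^ 1 * x $ 3 ^ 1)) 0"
    by (rule has_sphere_integral_eqI, (rule has_sphere_integral_add has_sphere_integral_cmult has_sphere_integral_monomial)+)
       (simp add: polar_int_simps azimuth_int_simps eval_nat_numeral)
  have "has_sphere_integral 1 (\<lambda>x. - 2/3 * unit_profile1 1 x - unit_laplacian x * x $ 1) 0"
    by (rule has_sphere_integral_cong[OF 1]) (simp add: unit_profile1_def unit_laplacian_def field_simps power2_eq_square)
  moreover have "has_sphere_integral 1 (\<lambda>x. - 2/3 * unit_profile1 2 x - unit_laplacian x * x $ 2) 0"
    by (rule has_sphere_integral_cong[OF 2]) (simp add: unit_profile1_def unit_laplacian_def field_simps power2_eq_square)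
  moreover have "has_sphere_integral 1 (\<lambda>x. - 2/3 * unit_profile1 3 x - unit_laplacian x * x $ 3) 0"
    by (rule has_sphere_integral_cong[OF 3]) (simp add: unit_profile1_def unit_laplacian_def field_simps power2_eq_square)
  ultimately show ?thesis using exhaust_3[of i] by blast
qed

section \<open>ADM quantities of the profile graphs and the choice of constants\<close>

lemma profile_modelled_graph:
  assumes L: "L \<noteq> 0"
  shows "modelled_graph (\<lambda>x. c * profile L x) (\<lambda>i x. c * profile1 0 i x) (\<lambda>i j x. c * profile2 0 i j x)"
proof -
  let ?f = "\<lambda>x. c * profile L x"
  have e: "elementary UNIV L ?f" "elementary UNIV L (profile L)"
    using elementary_profile[of L c] elementary_profile[of L 1] by simp_all
  have e1: "elementary UNIV L (pd i ?f)" for i by (rule elementary_pd[OF e(1) L])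
  have "profile L differentiable (at x)" for x by (rule elementary_differentiable[OF e(2) L])
  then have d1: "pd i ?f = (\<lambda>x. c * profile1 L i x)" for i
    unfolding pd_profile[OF L, symmetric] by (intro ext pd_cmult)
  have "profile1 L i differentiable (at x)" for i x
    using elementary_differentiable[OF elementary_pd[OF e(2) L] L] by (simp only: pd_profile[OF L])
  then have d2: "pd j (\<lambda>x. c * profile1 L i x) = (\<lambda>x. c * profile2 L j i x)" for i j
    unfolding pd_profile1[OF L, symmetric] by (intro ext pd_cmult)
  show ?thesis
  proof
    show "symbol (1/3) ?f" by (intro symbol_cmult symbol_profile)
    show "pd i (pd j ?f) = pd j (pd i ?f)" for i j by (rule elementary_pd_commute[OF e(1) L])
    show "pd i (pd j (pd l ?f)) = pd j (pd i (pd l ?f))" for i j l by (rule elementary_pd_commute[OF e1 L])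
    show "symbol (-8/3) (\<lambda>x. pd i ?f x - c * profile1 0 i x)" for i
      using symbol_cmult[OF symbol_profile1_diff[of L i], of c] by (simp add: d1 right_diff_distrib)
    show "symbol (-11/3) (\<lambda>x. pd i (pd j ?f) x - c * profile2 0 i j x)" for i j
      using symbol_cmult[OF symbol_profile2_diff[of L i j], of c] by (simp add: d1 d2 right_diff_distrib)
  qed
qed

lemma profile_ADM_momentum:
  fixes c L m :: real
  assumes L: "L \<noteq> 0"
  defines "f \<equiv> \<lambda>x. c * profile L x"
  shows "has_ADM_momentum (induced_metric m f) (second_fundamental_form m f) 0"
  unfolding has_ADM_momentum_def
proof
  fix i
  interpret modelled_graph m f "\<lambda>i x. c * profile1 0 i x" "\<lambda>i j x. c * profile2 0 i j x"
    unfolding f_def by (rule profile_modelled_graph[OF L])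
  let ?Q = "\<lambda>l x. c * profile2 0 i l x - (if i = l then 1 else 0) * model_laplacian x"
  let ?H = "\<lambda>x. \<Sum>l\<in>UNIV. ?Q l x * (x $ l * rho 0 (-1/2) x)"
  let ?F = "\<lambda>x. \<Sum>l\<in>UNIV. conjugate_momentum g k x $ i $ l * (x $ l / norm x)"
  have "symbol (-8/3) (\<lambda>x. \<Sum>l\<in>UNIV. (conjugate_momentum g k x $ i $ l - ?Q l x) * (x $ l * rho 0 (-1/2) x))"
    by (intro symbol_sum symbol_mult[OF symbol_momentum_diff symbol_unit]) simp
  then have "symbol (-8/3) (\<lambda>x. ?F x - ?H x)"
    by (simp add: unit_eq left_diff_distrib sum_subtractf)
  then have "((\<lambda>r. sphere_integral r ?F) \<longlongrightarrow> 0) at_top"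
  proof (rule sphere_integral_limit)
    show "symbol (-5/3) ?H"
      by (intro symbol_sum symbol_mult[OF symbol_diff[OF symbol_D2 symbol_cmult[OF symbol_model_laplacian]] symbol_unit]) simp
    have hl: "homogeneous (-5/3) model_laplacian"
      unfolding model_laplacian_def by (intro homogeneous_sum homogeneous_cmult homogeneous_profile2)
    have hom: "homogeneous (-5/3) ?H"
      by (intro homogeneous_sum homogeneous_mult[of "-5/3" _ 0] homogeneous_diff homogeneous_cmult
          homogeneous_profile2 hl homogeneous_xr) simp_all
    have "has_sphere_integral 1 ?H (c * 0)"
    proof (rule has_sphere_integral_cong[OF has_sphere_integral_cmult[OF unit_momentum_integral[of i]]])
      fix x :: "real ^ 3" assume "norm x = \<bar>1\<bar>"
      then have x: "norm x = 1" by simp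
      have H: "?H x = c * (\<Sum>l\<in>UNIV. profile2 0 i l x * x $ l) - model_laplacian x * x $ i"
        by (simp add: unit_sphere_rho[OF x] left_diff_distrib sum_subtractf sum_distrib_left sum_delta_mult mult.assoc)
      have "model_laplacian x = c * unit_laplacian x"
        by (simp add: model_laplacian_def sum_distrib_left[symmetric] profile2_trace_unit[OF x])
      then show "c * (- 2/3 * unit_profile1 i x - unit_laplacian x * x $ i) = ?H x"
        unfolding H profile2_unit[OF x] by (simp add: algebra_simps)
    qed
    note int = has_sphere_integral_homogeneous[OF hom this]
    show "\<forall>\<^sub>F r in at_top. has_sphere_integral r ?H 0"
      using eventually_gt_at_top[of 0] by eventually_elim (use int in simp)
  qed simp
  from tendsto_mult_left[OF this, of "1 / (8 * pi)"]
  show "((\<lambda>r. 1 / (8 * pi) * sphere_integral r ?F) \<longlongrightarrow> 0 $ i) at_top" by simp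
qed

lemma profile_ADM_angular_momentum:
  fixes c L m :: real
  assumes L: "L \<noteq> 0"
  defines "f \<equiv> \<lambda>x. c * profile L x"
  shows "has_ADM_angular_momentum (induced_metric m f) (second_fundamental_form m f)
    (\<chi> i. c ^ 3 * sphere_integral 1 (unit_cubic i) / (8 * pi))"
  unfolding has_ADM_angular_momentum_def
proof
  fix i
  interpret modelled_graph m f "\<lambda>i x. c * profile1 0 i x" "\<lambda>i j x. c * profile2 0 i j x"
    unfolding f_def by (rule profile_modelled_graph[OF L])
  define V where "V x = (\<Sum>j\<in>UNIV. \<Sum>l\<in>UNIV. c * profile2 0 j l x * rot i j x * (x $ l * rho 0 (-1/2) x))" for x
  define U where "U x = (\<Sum>j\<in>UNIV. c * profile1 0 j x * rot i j x)" for x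
  define T where "T x = (\<Sum>l\<in>UNIV. c * profile1 0 l x * (x $ l * rho 0 (-1/2) x))" for x
  let ?K = "sphere_integral 1 (unit_cubic i)"
  let ?H = "\<lambda>x. z0 x * V x + m * rho 0 (-1) x * U x + model_laplacian x * U x * T x"
  let ?F = "\<lambda>x. \<Sum>j\<in>UNIV. \<Sum>l\<in>UNIV. conjugate_momentum g k x $ j $ l * cross3 (axis i 1) x $ j * (x $ l / norm x)"
  have "symbol (-8/3) (\<lambda>x. ?F x - ?H x)"
    using symbol_angular_diff[OF symbol_rot rot_orthogonal, of i] by (simp add: rot_def U_def V_def T_def)
  then have "((\<lambda>r. sphere_integral r ?F) \<longlongrightarrow> c ^ 3 * ?K) at_top"
  proof (rule sphere_integral_limit)
    have sV: "symbol (-2/3) V"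
      unfolding V_def[abs_def] by (intro symbol_sum symbol_mult[OF symbol_mult[OF symbol_D2 symbol_rot, of "-2/3"] symbol_unit]) auto
    have sU: "symbol (1/3) U"
      unfolding U_def[abs_def] by (intro symbol_sum symbol_mult[OF symbol_D1 symbol_rot]) simp
    have sT: "symbol (-2/3) T"
      unfolding T_def[abs_def] by (intro symbol_sum symbol_mult[OF symbol_D1 symbol_unit]) simp
    show "symbol 0 ?H"
      by (intro symbol_add symbol_mult[OF symbol_z0 sV] symbol_mult[OF symbol_cmult[OF symbol_rho[of "-1" "-2"]] sU]
          symbol_mult[OF symbol_mult[OF symbol_model_laplacian sU, of "-4/3"] sT]) simp_all
    have hV: "homogeneous (-2/3) V"
      unfolding V_def[abs_def] by (intro homogeneous_sum homogeneous_mult[of "-2/3" _ 0] homogeneous_mult[of "-5/3" _ 1]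
          homogeneous_cmult homogeneous_profile2 homogeneous_rot homogeneous_xr) simp_all
    have hU: "homogeneous (1/3) U"
      unfolding U_def[abs_def] by (intro homogeneous_sum homogeneous_mult[of "-2/3" _ 1]
          homogeneous_cmult homogeneous_profile1 homogeneous_rot) simp_all
    have hT: "homogeneous (-2/3) T"
      unfolding T_def[abs_def] by (intro homogeneous_sum homogeneous_mult[of "-2/3" _ 0]
          homogeneous_cmult homogeneous_profile1 homogeneous_xr) simp_all
    have hl: "homogeneous (-5/3) model_laplacian"
      unfolding model_laplacian_def by (intro homogeneous_sum homogeneous_cmult homogeneous_profile2)
    have hN: "homogeneous (-4/3) N0"
      unfolding N0_def by (intro homogeneous_sum homogeneous_mult[of "-2/3" _ "-2/3"] homogeneous_cmult homogeneous_profile1) simp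
    have U1: "U x = c * unit_rot i x" if "norm x = 1" for x
      by (simp add: U_def profile1_unit[OF that] unit_rot_def sum_distrib_left mult.assoc)
    have V1: "V x = c * (- 2/3 * unit_rot i x)" if "norm x = 1" for x
    proof -
      have "V x = c * (\<Sum>j\<in>UNIV. rot i j x * (\<Sum>l\<in>UNIV. profile2 0 j l x * x $ l))"
        by (simp add: V_def unit_sphere_rho[OF that] sum_distrib_left mult_ac)
      then show ?thesis unfolding profile2_unit[OF that] unit_rot_def
        by (simp add: sum_distrib_left mult_ac sum_negf)
    qed
    have 1: "has_sphere_integral 1 V 0"
      using has_sphere_integral_cong[OF has_sphere_integral_cmult[OF unit_rot_integral[of i], of "c * (-2/3)"], of V]
      by (simp add: V1)
    have 2: "has_sphere_integral 1 (\<lambda>x. rho 0 (-1/2) x * V x) 0"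
      by (rule has_sphere_integral_cong[OF 1]) (simp add: unit_sphere_rho)
    have 3: "has_sphere_integral 1 (\<lambda>x. rho 0 (-1) x * U x) 0"
      using has_sphere_integral_cong[OF has_sphere_integral_cmult[OF unit_rot_integral[of i], of c], of "\<lambda>x. rho 0 (-1) x * U x"]
      by (simp add: U1 unit_sphere_rho)
    have 4: "has_sphere_integral 1 (\<lambda>x. 1/2 * (N0 x * V x) + model_laplacian x * U x * T x) (c ^ 3 * ?K)"
    proof (rule has_sphere_integral_cong[OF has_sphere_integral_cmult[OF unit_cubic_integral]])
      fix x :: "real ^ 3" assume "norm x = \<bar>1\<bar>"
      then have x: "norm x = 1" by simp
      have "N0 x = c\<^sup>2 * (\<Sum>j\<in>UNIV. unit_profile1 j x * unit_profile1 j x)"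
        by (simp add: N0_def profile1_unit[OF x] sum_distrib_left power2_eq_square mult_ac)
      moreover have "model_laplacian x = c * unit_laplacian x"
        by (simp add: model_laplacian_def sum_distrib_left[symmetric] profile2_trace_unit[OF x])
      moreover have "T x = c * (\<Sum>l\<in>UNIV. unit_profile1 l x * x $ l)"
        by (simp add: T_def profile1_unit[OF x] unit_sphere_rho[OF x] sum_distrib_left mult_ac)
      ultimately show "c ^ 3 * unit_cubic i x = 1/2 * (N0 x * V x) + model_laplacian x * U x * T x"
        by (simp add: U1[OF x] V1[OF x] unit_cubic_def power2_eq_square power3_eq_cube algebra_simps)
    qed
    have h2: "homogeneous (-5/3) (\<lambda>x. rho 0 (-1/2) x * V x)"
      by (intro homogeneous_mult[OF homogeneous_rho[OF refl] hV]) simp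
    have h3: "homogeneous (-5/3) (\<lambda>x. rho 0 (-1) x * U x)"
      by (intro homogeneous_mult[OF homogeneous_rho[OF refl] hU]) simp
    have h4: "homogeneous (-2) (\<lambda>x. 1/2 * (N0 x * V x) + model_laplacian x * U x * T x)"
      by (intro homogeneous_add homogeneous_cmult homogeneous_mult[OF hN hV]
          homogeneous_mult[OF homogeneous_mult[OF hl hU refl] hT]) simp_all
    show "\<forall>\<^sub>F r in at_top. has_sphere_integral r ?H (c ^ 3 * ?K)"
      using eventually_gt_at_top[of 0]
    proof eventually_elim
      case (elim r)
      \<comment> \<open>The factor \<open>z0\<close> is multiplied out so that each piece is
        homogeneous: V scales like r^(4/3), the two terms with m like r^(1/3), and all three have
        integral zero on the unit sphere. The cubic piece has degree -2, so its integral is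
        independent of r.\<close>
      have "has_sphere_integral r (\<lambda>x. (V x + (- m) * (rho 0 (-1/2) x * V x)) + (m * (rho 0 (-1) x * U x)
          + (1/2 * (N0 x * V x) + model_laplacian x * U x * T x)))
         ((r powr (- 2/3 + 2) * 0 + (- m) * (r powr (- 5/3 + 2) * 0)) + (m * (r powr (- 5/3 + 2) * 0) + r powr (- 2 + 2) * (c ^ 3 * ?K)))"
        by (intro has_sphere_integral_add has_sphere_integral_cmult has_sphere_integral_homogeneous
            1 2 3 4 hV h2 h3 h4 elim)
      moreover have "(\<lambda>x. (V x + (- m) * (rho 0 (-1/2) x * V x)) + (m * (rho 0 (-1) x * U x)
          + (1/2 * (N0 x * V x) + model_laplacian x * U x * T x))) = ?H"
        by (simp add: fun_eq_iff z0_def algebra_simps)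
      ultimately show ?case using elim by simp
    qed
  qed simp
  from tendsto_mult_left[OF this, of "1 / (8 * pi)"]
  show "((\<lambda>r. 1 / (8 * pi) * sphere_integral r ?F) \<longlongrightarrow>
      (\<chi> i. c ^ 3 * sphere_integral 1 (unit_cubic i) / (8 * pi)) $ i) at_top" by simp
qed

theorem theorem4:
  fixes m :: real
  assumes "m > 0"
  shows "\<exists>S R f. spacelike_hypersurface m S \<and> graph_end m S R f \<and>
    (let g = induced_metric m f; k = second_fundamental_form m f in
       asymptotically_flat g k \<and>
       has_ADM_energy g m \<and>
       has_ADM_momentum g k 0 \<and>
       (\<exists>J. has_ADM_angular_momentum g k J \<and> norm J > m))"
proof -
  \<comment> \<open>From c \<ge> 8 follows c^3 \<ge> 64 c = 512 (1 + m), so 2/15 c^3, the size of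
    the third component of the angular momentum, exceeds m by a wide margin.\<close>
  define c where "c = 8 * (1 + m)"
  \<comment> \<open>Then \<open>rho L (-1/3)\<close> is at most (L^2)^(-1/3) = 1/(32 c), and with
    the constant 16/3 of \<open>profile1_bound\<close> the partial derivatives of f are at most c
    (16/3)/(32 c) = 1/6, as \<open>spacelike_graph\<close> demands.\<close>
  define L where "L = sqrt ((32 * c) ^ 3)"
  define f where "f = (\<lambda>x. c * profile L x)"
  have c: "c \<ge> 8" "c > 0" using assms by (simp_all add: c_def)
  have L2: "L\<^sup>2 = (32 * c) powr 3" using c by (simp add: L_def)
  then have L: "L \<noteq> 0" using c by auto
  have e: "elementary UNIV L f" unfolding f_def by (rule elementary_profile)
  have grad: "\<bar>pd i f x\<bar> \<le> 1/6" for i x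
  proof -
    have "rho L (-1/3) x \<le> (L\<^sup>2) powr (-1/3)"
      unfolding rho_def using L by (intro powr_mono2') auto
    also have "\<dots> = (32 * c) powr (-1)" unfolding L2 powr_powr by simp
    also have "\<dots> = 1 / (32 * c)" using c by (simp add: powr_minus_divide)
    finally have r: "rho L (-1/3) x \<le> 1 / (32 * c)" .
    have "profile L differentiable (at x)"
      using elementary_differentiable[OF elementary_profile[of L 1] L] by simp
    then have "\<bar>pd i f x\<bar> = c * \<bar>profile1 L i x\<bar>"
      using c by (simp add: f_def pd_cmult pd_profile[OF L] abs_mult)
    also have "\<dots> \<le> c * (16/3 * (1 / (32 * c)))"
      using c r by (intro mult_left_mono order_trans[OF profile1_bound[OF L]] mult_left_mono) auto
    finally show ?thesis using c by simp
  qed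
  interpret asymptotic_graph m f
    using profile_modelled_graph[OF L, of c] unfolding f_def by (rule modelled_graph.axioms(1))
  define J :: "real ^ 3" where "J = (\<chi> i. c ^ 3 * sphere_integral 1 (unit_cubic i) / (8 * pi))"
  \<comment> \<open>This is -16/15 pi divided by 8 pi. Since a single component bounds the norm from
    below, the other two components can stay unevaluated.\<close>
  have "J $ 3 = - (2/15) * c ^ 3"
    unfolding J_def using has_sphere_integralD[OF unit_cubic_3_integral] by simp
  then have "2/15 * c ^ 3 \<le> norm J"
    using component_le_norm_cart[of J 3] c by simp
  moreover have "c * 64 \<le> c ^ 3"
  proof -
    have "8 * 8 \<le> c * c" using c by (intro mult_mono) auto
    then show ?thesis using c by (simp add: power3_eq_cube)
  qed
  then have "m < 2/15 * c ^ 3" using assms by (simp add: c_def)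
  ultimately have J: "norm J > m" by linarith
  have "has_ADM_momentum g k 0" "has_ADM_angular_momentum g k J"
    unfolding f_def J_def by (rule profile_ADM_momentum[OF L] profile_ADM_angular_momentum[OF L])+
  then show ?thesis
    using spacelike_graph[OF assms e L grad] asymptotically_flat has_ADM_energy J
    unfolding Let_def by blast
qed

end
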